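(* Let $\underline{L}$ be an integral (positive definite) unimodular lattice of rank $n$. Let $\vartheta_{\underline{L}}:=\vartheta_{\underline{L},\lambda}$ for some non-zero $\lambda$ in the one-dimensional space $W(\underline{L})$. Then, for $\mathrm{parity}\in\{\mathrm{even},\mathrm{odd}\}$, $$J_{\mathrm{parity},\underline{L}}(\varepsilon^* )=\begin{cases}M_*(\varepsilon^* )\,\vartheta_{\underline{L}}&\text{if parity is the parity of }n,\\0&\text{otherwise.}\end{cases}$$ The function $\vartheta_{\underline{L}}$ is, up to multiplication by a constant, the unique non-zero Jacobi form of singular weight (i.e. of weight $n/2$) for $\underline{L}$. It affords the character $\varepsilon^{3n}$ (i.e. $\vartheta_{\underline{L}}\in J_{n/2,\underline{L}}(\varepsilon^{3n})$).
   Context: Notation: $e(x)=e^{2\pi i x}$, $\mathbb{H}$ is the upper half plane, $q^a=e(a\tau)$ for $\tau\in\mathbb{H}$. $G=\mathrm{Mp}(2,\mathbb{Z})$ is the group of pairs $(A,w)$ with $A=\begin{pmatrix}a&b\\c&d\end{pmatrix}\in\mathrm{SL}(2,\mathbb{Z})$ and $w$ a holomorphic function on $\mathbb{H}$ with $w(\tau)^2=c\tau+d$, with product $(A,w)(B,v)=(AB,\,w(B\tau)v(\tau))$. With $\eta(\tau)=q^{1/24}\prod_{m\ge1}(1-q^m)$, the linear character $\varepsilon$ of $G$, of order $24$, is $\varepsilon(A,w)=\eta(A\tau)/(\eta(\tau)w(\tau))$ (a constant). An integral lattice of rank $n$ is $\underline{L}=(L,\beta)$ with $L$ a free $\mathbb{Z}$-module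 of rank $n$ and $\beta$ a $\mathbb{Z}$-valued symmetric bilinear form on $L$; put $\beta(x)=\frac12\beta(x,x)$; $\beta$ is extended bilinearly to $R\otimes L$ for rings $R\supseteq\mathbb{Z}$. The shadow is $L^\bullet=\{r\in\mathbb{Q}\otimes L:\beta(r,x)\equiv\beta(x)\bmod\mathbb{Z}\text{ for all }x\in L\}$. $W(\underline{L})$ is the space of maps $\lambda:L^\bullet\to\mathbb{C}$ with $\lambda(r+x)=e(\beta(x))\lambda(r)$ for $r\in L^\bullet$, $x\in L$, and $\vartheta_{\underline{L},\lambda}(\tau,z)=\sum_{r\in L^\bullet}\lambda(r)q^{\beta(r)}e(\beta(r,z))$. $J_{k,\underline{L}}(\varepsilon^h)$ ($k\in\frac12\mathbb{Z}$, $h\in\mathbb{Z}$, $\underline{L}$ positive definite integral) is the space of holomorphic functions $\phi(\tau,z)$ on $\mathbb{H}\times(\mathbb{C}\otimes L)$ such that: (i) for all $\alpha=(A,w)\in G$ with $A=\begin{pmatrix}a&b\\c&d\end{pmatrix}$: $\phi\bigl(A\tau,\frac{z}{c\tau+d}\bigr)e\bigl(\frac{-c\beta(z)}{c\tau+d}\bigr)w(\tau)^{-2k}=\varepsilon^h(\alpha)\phi(\tau,z)$; (ii) for all $x,y\in L$: $\phi(\tau,z+x\tau+y)\,e(\tau\beta(x)+\beta(x,z))=e(\beta(x+y))\,\phi(\tau,z)$; (iii) $\phi$ has a Fourier expansion $\phi=\sum_{m\in\frac h{24}+\mathbb{Z}}\sum_{r\in L^\bullet,\,m\ge\beta(r)}c(m,r)\,q^m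 e(\beta(z,r))$. $J_{\mathrm{even},\underline{L}}(\varepsilon^h)$ (resp. $J_{\mathrm{odd},\underline{L}}(\varepsilon^h)$) is the direct sum of all $J_{k,\underline{L}}(\varepsilon^h)$ with $k\in\frac12\mathbb{Z}$ and $k-\frac h2$ an even (resp. odd) integer, and $J_{\mathrm{parity},\underline{L}}(\varepsilon^* )=\bigoplus_{h\bmod24}J_{\mathrm{parity},\underline{L}}(\varepsilon^h)$. $M_*(1)=\bigoplus_{k\in2\mathbb{Z}}M_k(\mathrm{SL}(2,\mathbb{Z}))=\mathbb{C}[E_4,E_6]$ and $M_*(\varepsilon^* )=\bigoplus_{0\le h\le23}\eta^hM_*(1)=\mathbb{C}[E_4,E_6,\eta]$, acting by multiplication of functions. *)

theory Defs
  imports "HOL-Analysis.Analysis" "HOL-Library.Function_Algebras"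
begin

text \<open>
  Functions on a proper subset of a type (the upper half plane, its product with \<open>\<complex>\<^sup>n\<close>, the shadow
  of a lattice) are represented by total functions that are \<open>0\<close> outside that subset. Equality of
  such functions, and of spaces of them, is then equality in HOL, and the spaces below are
  subspaces of the complex vector space of all functions on the type. Sums of subspaces are spans
  of unions in that vector space. Those formed below are direct: forms for different powers of the
  character are eigenfunctions of \<open>\<tau> \<mapsto> \<tau> + 1\<close> with different eigenvalues, and for a fixed power
  forms of different weights are linearly independent by the transformation law.
\<close>

global_interpretation fun_space: vector_space "\<lambda>(c::complex) (f::'a \<Rightarrow> complex) x. c * f x"
  by unfold_locales (auto simp: algebra_simps)

definition ee :: "complex \<Rightarrow> complex" where
  "ee x = exp (2 * of_real pi * \<i> * x)"

definition upper_half_plane :: "complex set" where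
  "upper_half_plane = {\<tau>. 0 < Im \<tau>}"


section \<open>Modular forms and the metaplectic group\<close>

definition eta :: "complex \<Rightarrow> complex" where
  "eta \<tau> = (if \<tau> \<in> upper_half_plane
            then ee (\<tau> / 24) * (\<Prod>m. 1 - ee (of_nat (Suc m) * \<tau>)) else 0)"

definition SL2Z :: "(int^2^2) set" where
  "SL2Z = {A. det A = 1}"

definition cocycle :: "int^2^2 \<Rightarrow> complex \<Rightarrow> complex" where
  "cocycle A \<tau> = of_int (A $ 2 $ 1) * \<tau> + of_int (A $ 2 $ 2)"

definition moebius_act :: "int^2^2 \<Rightarrow> complex \<Rightarrow> complex" where
  "moebius_act A \<tau> = (of_int (A $ 1 $ 1) * \<tau> + of_int (A $ 1 $ 2)) / cocycle A \<tau>"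

definition Mp2Z :: "((int^2^2) \<times> (complex \<Rightarrow> complex)) set" where
  "Mp2Z = {(A, w). A \<in> SL2Z \<and> w holomorphic_on upper_half_plane \<and>
             (\<forall>\<tau>\<in>upper_half_plane. (w \<tau>)\<^sup>2 = cocycle A \<tau>) \<and>
             (\<forall>\<tau>. \<tau> \<notin> upper_half_plane \<longrightarrow> w \<tau> = 0)}"

text \<open>
  The quotient \<open>\<eta>(A\<tau>) / (\<eta>(\<tau>) w(\<tau>))\<close> does not depend on \<open>\<tau>\<close>; its value is taken at \<open>\<tau> = \<i>\<close>.
\<close>
definition eps :: "(int^2^2) \<times> (complex \<Rightarrow> complex) \<Rightarrow> complex" where
  "eps \<alpha> = eta (moebius_act (fst \<alpha>) \<i>) / (eta \<i> * snd \<alpha> \<i>)"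

definition modular_forms :: "int \<Rightarrow> (complex \<Rightarrow> complex) set" where
  "modular_forms k = {f.
     (\<forall>\<tau>. \<tau> \<notin> upper_half_plane \<longrightarrow> f \<tau> = 0) \<and>
     f holomorphic_on upper_half_plane \<and>
     (\<forall>A\<in>SL2Z. \<forall>\<tau>\<in>upper_half_plane. f (moebius_act A \<tau>) = cocycle A \<tau> powi k * f \<tau>) \<and>
     (\<exists>a :: nat \<Rightarrow> complex. \<forall>\<tau>\<in>upper_half_plane. (\<lambda>m. a m * ee (of_nat m * \<tau>)) sums f \<tau>)}"

definition modular_forms_star :: "(complex \<Rightarrow> complex) set" where
  "modular_forms_star = fun_space.span (\<Union>k\<in>{k. even k}. modular_forms k)"

text \<open>The sum over \<open>0 \<le> h \<le> 23\<close> of the spaces \<open>\<eta>\<^sup>h M\<^sub>*(1)\<close>.\<close>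
definition modular_forms_eps_star :: "(complex \<Rightarrow> complex) set" where
  "modular_forms_eps_star =
     fun_space.span (\<Union>h\<in>{0..23::nat}. (\<lambda>f \<tau>. eta \<tau> ^ h * f \<tau>) ` modular_forms_star)"


section \<open>Lattices\<close>

text \<open>
  A free \<open>\<int>\<close>-module of rank \<open>n\<close> is taken with a chosen basis, as \<open>int^'n\<close> with \<open>n = CARD('n)\<close>; its
  scalar extension to a ring \<open>R\<close> is \<open>R^'n\<close>.
\<close>

definition integral_lattice :: "(int^'n \<Rightarrow> int^'n \<Rightarrow> int) \<Rightarrow> bool" where
  "integral_lattice \<beta> \<longleftrightarrow>
     (\<forall>x y. \<beta> x y = \<beta> y x) \<and> (\<forall>x y z. \<beta> (x + y) z = \<beta> x z + \<beta> y z)"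

definition positive_definite :: "(int^'n \<Rightarrow> int^'n \<Rightarrow> int) \<Rightarrow> bool" where
  "positive_definite \<beta> \<longleftrightarrow> (\<forall>x. x \<noteq> 0 \<longrightarrow> 0 < \<beta> x x)"

definition vec_of_int :: "int^'n \<Rightarrow> 'a::ring_1^'n" where
  "vec_of_int x = (\<chi> i. of_int (x $ i))"

definition vec_of_rat :: "rat^'n \<Rightarrow> 'a::field_char_0^'n" where
  "vec_of_rat x = (\<chi> i. of_rat (x $ i))"

definition bil :: "(int^'n \<Rightarrow> int^'n \<Rightarrow> int) \<Rightarrow> 'a::comm_ring_1^'n \<Rightarrow> 'a^'n \<Rightarrow> 'a" where
  "bil \<beta> x y = (\<Sum>i\<in>UNIV. \<Sum>j\<in>UNIV. x $ i * y $ j * of_int (\<beta> (axis i 1) (axis j 1)))"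

definition quad :: "(int^'n \<Rightarrow> int^'n \<Rightarrow> int) \<Rightarrow> 'a::field_char_0^'n \<Rightarrow> 'a" where
  "quad \<beta> x = bil \<beta> x x / 2"

lemma bil_vec_of_int:
  fixes \<beta> :: "int^'n \<Rightarrow> int^'n \<Rightarrow> int"
  assumes "integral_lattice \<beta>"
  shows "bil \<beta> (vec_of_int x) (vec_of_int y) = (of_int (\<beta> x y) :: 'a::comm_ring_1)"
proof -
  have sym: "\<beta> x y = \<beta> y x" and add: "\<beta> (x + y) z = \<beta> x z + \<beta> y z" for x y z
    using assms by (auto simp: integral_lattice_def)
  have zero: "\<beta> 0 z = 0" for z
    using add[of 0 0 z] by simp
  have uminus: "\<beta> (- x) z = - \<beta> x z" for x z
    using add[of x "- x" z] by (simp add: zero)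
  have nat: "\<beta> (int k *s x) z = int k * \<beta> x z" for k x z
    by (induction k) (simp_all add: zero add vector_sadd_rdistrib algebra_simps)
  have scale: "\<beta> (k *s x) z = k * \<beta> x z" for k x z
  proof (cases k rule: int_cases2)
    case (nonneg n)
    then show ?thesis by (simp add: nat)
  next
    case (nonpos n)
    then have "k *s x = - (int n *s x)"
      by (simp add: vec_eq_iff)
    then show ?thesis
      using nonpos by (simp add: uminus nat)
  qed
  have sum: "\<beta> (\<Sum>i\<in>S. f i) z = (\<Sum>i\<in>S. \<beta> (f i) z)" for f :: "'n \<Rightarrow> int^'n" and S z
    by (induction S rule: infinite_finite_induct) (simp_all add: zero add)
  have "\<beta> x y = (\<Sum>i\<in>UNIV. x $ i * \<beta> (axis i 1) y)" for x y
  proof -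
    have "\<beta> x y = \<beta> (\<Sum>i\<in>UNIV. (x $ i) *s axis i 1) y"
      by (simp only: basis_expansion)
    then show ?thesis
      by (simp only: sum scale)
  qed
  note expand = this
  have "\<beta> x y = (\<Sum>i\<in>UNIV. x $ i * \<beta> y (axis i 1))"
    by (subst expand) (simp only: sym[of _ y])
  also have "\<dots> = (\<Sum>i\<in>UNIV. \<Sum>j\<in>UNIV. x $ i * y $ j * \<beta> (axis i 1) (axis j 1))"
    by (subst expand)
       (simp add: sum_distrib_left mult.assoc sym[of "axis _ 1" "axis _ 1"] cong: sum.cong)
  finally show ?thesis
    by (simp add: bil_def vec_of_int_def)
qed

definition dual_lattice :: "(int^'n \<Rightarrow> int^'n \<Rightarrow> int) \<Rightarrow> (rat^'n) set" where
  "dual_lattice \<beta> = {r. \<forall>x. bil \<beta> r (vec_of_int x) \<in> \<int>}"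

definition unimodular :: "(int^'n \<Rightarrow> int^'n \<Rightarrow> int) \<Rightarrow> bool" where
  "unimodular \<beta> \<longleftrightarrow> dual_lattice \<beta> = range vec_of_int"

definition shadow :: "(int^'n \<Rightarrow> int^'n \<Rightarrow> int) \<Rightarrow> (rat^'n) set" where
  "shadow \<beta> = {r. \<forall>x. bil \<beta> r (vec_of_int x) - quad \<beta> (vec_of_int x) \<in> \<int>}"

definition W_space :: "(int^'n \<Rightarrow> int^'n \<Rightarrow> int) \<Rightarrow> (rat^'n \<Rightarrow> complex) set" where
  "W_space \<beta> = {l. (\<forall>r. r \<notin> shadow \<beta> \<longrightarrow> l r = 0) \<and>
     (\<forall>r\<in>shadow \<beta>. \<forall>x. l (r + vec_of_int x) = ee (quad \<beta> (vec_of_int x)) * l r)}"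


section \<open>Jacobi forms of lattice index\<close>

definition theta ::
  "(int^'n \<Rightarrow> int^'n \<Rightarrow> int) \<Rightarrow> (rat^'n \<Rightarrow> complex) \<Rightarrow> complex \<times> (complex^'n) \<Rightarrow> complex" where
  "theta \<beta> l = (\<lambda>(\<tau>, z). if \<tau> \<in> upper_half_plane
     then \<Sum>\<^sub>\<infinity>r\<in>shadow \<beta>. l r * ee (of_rat (quad \<beta> r) * \<tau>) * ee (bil \<beta> (vec_of_rat r) z)
     else 0)"

text \<open>Holomorphic in several variables: the total derivative exists and is \<open>\<complex>\<close>-linear.\<close>
definition holomorphic_jacobi :: "(complex \<times> (complex^'n) \<Rightarrow> complex) \<Rightarrow> bool" where
  "holomorphic_jacobi \<phi> \<longleftrightarrow> (\<forall>p \<in> upper_half_plane \<times> UNIV. \<exists>D.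
     (\<phi> has_derivative D) (at p) \<and> (\<forall>c v. D (c * fst v, c *s snd v) = c * D v))"

text \<open>
  The weight \<open>k\<close> is half-integral, and \<open>\<lfloor>2 * k\<rfloor>\<close> is the integer \<open>2k\<close>. The Fourier expansion
  converges unconditionally, i.e. absolutely.
\<close>
definition jacobi_forms ::
  "(int^'n \<Rightarrow> int^'n \<Rightarrow> int) \<Rightarrow> rat \<Rightarrow> int \<Rightarrow> (complex \<times> (complex^'n) \<Rightarrow> complex) set" where
  "jacobi_forms \<beta> k h = {\<phi>.
     (\<forall>\<tau> z. \<tau> \<notin> upper_half_plane \<longrightarrow> \<phi> (\<tau>, z) = 0) \<and>
     holomorphic_jacobi \<phi> \<and>
     (\<forall>(A, w)\<in>Mp2Z. \<forall>\<tau>\<in>upper_half_plane. \<forall>z.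
        \<phi> (moebius_act A \<tau>, inverse (cocycle A \<tau>) *s z)
          * ee (- of_int (A $ 2 $ 1) * quad \<beta> z / cocycle A \<tau>) * w \<tau> powi (- \<lfloor>2 * k\<rfloor>)
        = eps (A, w) powi h * \<phi> (\<tau>, z)) \<and>
     (\<forall>x y. \<forall>\<tau>\<in>upper_half_plane. \<forall>z.
        \<phi> (\<tau>, z + \<tau> *s vec_of_int x + vec_of_int y)
          * ee (\<tau> * quad \<beta> (vec_of_int x) + bil \<beta> (vec_of_int x) z)
        = ee (quad \<beta> (vec_of_int (x + y))) * \<phi> (\<tau>, z)) \<and>
     (\<exists>c :: rat \<times> (rat^'n) \<Rightarrow> complex. \<forall>\<tau>\<in>upper_half_plane. \<forall>z.
        ((\<lambda>(m, r). c (m, r) * ee (of_rat m * \<tau>) * ee (bil \<beta> z (vec_of_rat r)))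
          has_sum \<phi> (\<tau>, z))
        {(m, r). m - of_int h / 24 \<in> \<int> \<and> r \<in> shadow \<beta> \<and> quad \<beta> r \<le> m})}"

text \<open>
  The parity \<open>P\<close> is one of the predicates \<^const>\<open>even\<close>, \<^term>\<open>odd\<close> on the integers. If \<open>k - h/2\<close> is an
  integer, then \<open>k\<close> is half-integral.
\<close>
definition jacobi_forms_parity ::
  "(int \<Rightarrow> bool) \<Rightarrow> (int^'n \<Rightarrow> int^'n \<Rightarrow> int) \<Rightarrow> int \<Rightarrow> (complex \<times> (complex^'n) \<Rightarrow> complex) set" where
  "jacobi_forms_parity P \<beta> h =
     fun_space.span (\<Union>k\<in>{k. \<exists>j. P j \<and> k - of_int h / 2 = of_int j}. jacobi_forms \<beta> k h)"

text \<open>As \<open>\<epsilon>\<close> has order 24, \<open>0, \<dots>, 23\<close> represent the possible powers of \<open>\<epsilon>\<close>.\<close>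
definition jacobi_forms_parity_star ::
  "(int \<Rightarrow> bool) \<Rightarrow> (int^'n \<Rightarrow> int^'n \<Rightarrow> int) \<Rightarrow> (complex \<times> (complex^'n) \<Rightarrow> complex) set" where
  "jacobi_forms_parity_star P \<beta> = fun_space.span (\<Union>h\<in>{0..23}. jacobi_forms_parity P \<beta> h)"

end

theory Submission
  imports Defs "HOL-Complex_Analysis.Complex_Analysis"
begin

text \<open>
  Let \<open>n\<close> be the rank of the lattice. Unimodularity makes the shadow a single coset \<open>r\<^sub>0 + L\<close>. The
  quasi-periodicity of a Jacobi form \<open>\<phi>\<close> under \<open>z \<mapsto> z + x\<tau>\<close> relates its Fourier coefficients at \<open>r\<close>
  and \<open>r + x\<close>; with only one coset there is, for fixed \<open>\<tau>\<close>, only one free coefficient, and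
  \<open>\<phi>(\<tau>, z) = f(\<tau>) \<theta>(\<tau>, z)\<close> (\<open>jacobi_form_multiple_of_theta\<close>). Everything else is a statement about the
  transformation laws of \<open>\<theta>\<close> and of the quotient \<open>f\<close>.

  The function \<open>\<theta>\<close> has weight \<open>n/2\<close> and character \<open>\<epsilon>\<^sup>3\<^sup>n\<close> (\<open>theta_transform\<close>). It suffices to know this
  for the generators \<open>S\<close> and \<open>T\<close>. Poisson summation yields the law under \<open>S\<close> up to a positive constant,
  the ratio of a Gaussian integral and a volume, and \<open>T\<close> multiplies \<open>\<theta>\<close> by a number of modulus 1, the
  common value of \<open>e(\<beta>(r))\<close> on the shadow. The relation \<open>(ST)\<^sup>3 = S\<^sup>2\<close> determines the product of these two
  constants as \<open>e(n/8)\<close>; hence the positive one is 1, and the other one is \<open>e(n/8)\<close>, which is van der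
  Blij's lemma \<open>\<beta>(r) \<equiv> n/8 mod 1\<close>. Poisson summation itself compares Fourier coefficients along real
  translations of \<open>z\<close>, first for imaginary \<open>\<tau>\<close>; analytic continuation does the rest.

  The character is defined by \<open>\<eta>\<close>. By Jacobi's identity for \<open>\<Prod>(1 - q\<^sup>m)\<^sup>3\<close>, the cube of \<open>\<eta>\<close> is up to a
  constant the derivative at \<open>z = 0\<close> of the function \<open>\<theta>\<close> of the lattice \<open>\<int>\<close>, so its inversion formula is
  a special case of that of \<open>\<theta>\<close> (\<open>eta_inversion\<close>); a continuous function on the half plane with a constant
  power is constant, which removes the cube.

  Now let \<open>\<phi> = f \<theta>\<close> have weight \<open>k\<close> and character \<open>\<epsilon>\<^sup>h\<close>, and let \<open>a\<close> be the residue of \<open>h - 3n\<close> mod 24.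
  The Fourier expansion shows that \<open>f = q\<^sup>a\<^sup>/\<^sup>2\<^sup>4 F(q)\<close> with \<open>F\<close> holomorphic on the disc. So \<open>g = f / \<eta>\<^sup>a\<close> is
  holomorphic in \<open>q\<close>, and it transforms with trivial character and a weight \<open>\<kappa>\<close> with
  \<open>2k = n + a + 2\<kappa>\<close>. The matrix \<open>-1\<close> shows that \<open>\<kappa>\<close> is even unless \<open>g = 0\<close>. Thus
  \<open>\<phi> = \<eta>\<^sup>a g \<theta>\<close> with a modular form \<open>g\<close> (\<open>jacobi_form_decomposition\<close>), and conversely all these products are
  Jacobi forms. The relation between \<open>k\<close>, \<open>a\<close> and \<open>\<kappa>\<close> forces the parity of \<open>k - h/2\<close> to be that of \<open>n\<close>.
  For \<open>k = n/2\<close> the absolute value of \<open>f\<close> is invariant under the modular group; as every orbit comes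
  close to the cusp, the maximum principle makes \<open>f\<close> constant (\<open>weight_zero_constant\<close>).
\<close>

section \<open>The exponential and the Euler product\<close>

lemma ee_add: "ee (x + y) = ee x * ee y"
  by (simp add: ee_def exp_add algebra_simps)

lemma ee_0 [simp]: "ee 0 = 1"
  by (simp add: ee_def)

lemma ee_nonzero [simp]: "ee x \<noteq> 0"
  by (simp add: ee_def)

lemma ee_minus: "ee (- x) = inverse (ee x)"
  by (simp add: ee_def exp_minus)

lemma ee_diff: "ee (x - y) = ee x / ee y"
  by (simp add: ee_def exp_diff algebra_simps)

lemma norm_ee: "norm (ee x) = exp (- (2 * pi * Im x))"
  by (simp add: ee_def)

lemma ee_power: "ee x ^ n = ee (of_nat n * x)"
  by (simp add: ee_def exp_of_nat_mult [symmetric] algebra_simps)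

lemma ee_of_nat_mult: "ee (of_nat n * x) = ee x ^ n"
  by (simp add: ee_power)

lemma ee_eq_1_iff: "ee x = 1 \<longleftrightarrow> x \<in> \<int>"
proof
  assume "ee x = 1"
  then obtain n where n: "Re (2 * of_real pi * \<i> * x) = 0" "Im (2 * of_real pi * \<i> * x) = of_int (2 * n) * pi"
    unfolding ee_def exp_eq_1 by blast
  then have "x = of_int n"
    by (auto simp: complex_eq_iff)
  then show "x \<in> \<int>" by auto
next
  assume "x \<in> \<int>"
  then obtain n where "x = of_int n" by (rule Ints_cases)
  then show "ee x = 1"
    unfolding ee_def exp_eq_1 by (auto intro!: exI [of _ n])
qed

lemma ee_Ints: "x \<in> \<int> \<Longrightarrow> ee x = 1"
  by (simp add: ee_eq_1_iff)

lemma ee_eqI: "x - y \<in> \<int> \<Longrightarrow> ee x = ee y"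
  using ee_Ints [of "x - y"] by (simp add: ee_diff)

lemma ee_holomorphic [holomorphic_intros]:
  "f holomorphic_on A \<Longrightarrow> (\<lambda>x. ee (f x)) holomorphic_on A"
  unfolding ee_def by (intro holomorphic_intros)

lemma ee_continuous [continuous_intros]:
  "continuous_on A f \<Longrightarrow> continuous_on A (\<lambda>x. ee (f x))"
  unfolding ee_def by (intro continuous_intros)

lemma ee_has_field_derivative: "(ee has_field_derivative (2 * of_real pi * \<i> * ee x)) (at x within A)"
  unfolding ee_def by (auto intro!: derivative_eq_intros)

lemma norm_ee_less_1: "\<tau> \<in> upper_half_plane \<Longrightarrow> norm (ee \<tau>) < 1"
  by (simp add: norm_ee upper_half_plane_def)

text \<open>
  The coordinate \<open>q = e(\<tau>)\<close> maps the half plane onto the punctured disc; functions of \<open>q\<close> are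
  studied through it.
\<close>
lemma ee_surj:
  assumes "q \<noteq> 0" "norm q < 1"
  obtains \<tau> where "\<tau> \<in> upper_half_plane" "ee \<tau> = q"
proof
  define \<tau> where "\<tau> = Ln q / (2 * of_real pi * \<i>)"
  show "ee \<tau> = q"
    using assms by (simp add: ee_def \<tau>_def exp_Ln)
  then show "\<tau> \<in> upper_half_plane"
    using assms norm_ee [of \<tau>] by (simp add: upper_half_plane_def zero_less_mult_iff)
qed

text \<open>
  The \<open>q\<close>-Pochhammer symbol \<open>(q; q)\<^sub>n\<close>.
\<close>
definition qpoch :: "complex \<Rightarrow> nat \<Rightarrow> complex" where
  "qpoch q n = (\<Prod>k<n. 1 - q ^ Suc k)"

definition euler_prod :: "complex \<Rightarrow> complex" where
  "euler_prod q = (\<Prod>k. 1 - q ^ Suc k)"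

lemma one_minus_power_nonzero: "norm (q::complex) < 1 \<Longrightarrow> 1 - q ^ Suc k \<noteq> 0"
  by (metis eq_iff_diff_eq_0 norm_one norm_power power_less_one_iff norm_ge_zero zero_less_Suc less_irrefl)

lemma qpoch_nonzero: "norm q < 1 \<Longrightarrow> qpoch q n \<noteq> 0"
  using one_minus_power_nonzero by (auto simp: qpoch_def)

lemma convergent_prod_euler:
  assumes "norm (q::complex) < 1"
  shows "convergent_prod (\<lambda>k. 1 - q ^ Suc k)"
proof -
  have "summable (\<lambda>k. norm (1 - q ^ Suc k - 1))"
    using assms by (simp add: norm_mult norm_power summable_mult summable_geometric)
  then have "abs_convergent_prod (\<lambda>k. 1 - q ^ Suc k)"
    by (rule summable_imp_abs_convergent_prod)
  then show ?thesis by (rule abs_convergent_prod_imp_convergent_prod)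
qed

lemma euler_prod_nonzero: "norm q < 1 \<Longrightarrow> euler_prod q \<noteq> 0"
  unfolding euler_prod_def
  by (intro prodinf_nonzero convergent_prod_euler one_minus_power_nonzero)

lemma qpoch_tendsto: "norm q < 1 \<Longrightarrow> qpoch q \<longlonglongrightarrow> euler_prod q"
  using convergent_prod_LIMSEQ [OF convergent_prod_euler, of q]
  unfolding qpoch_def euler_prod_def
  by (simp add: LIMSEQ_lessThan_iff_atMost)

lemma euler_prod_holomorphic: "euler_prod holomorphic_on ball 0 1"
proof (rule holomorphic_uniform_sequence [where f = "\<lambda>n q. qpoch q n"])
  show "(\<lambda>q. qpoch q n) holomorphic_on ball 0 1" for n
    unfolding qpoch_def by (intro holomorphic_intros)
  fix x :: complex assume x: "x \<in> ball 0 1"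
  define d where "d = (1 - norm x) / 2"
  have d: "0 < d" "cball x d \<subseteq> cball 0 (1 - d)" "1 - d < 1" "0 \<le> 1 - d"
    using x by (auto simp: d_def field_simps dist_norm)
       (smt (verit) norm_triangle_sub norm_minus_commute field_sum_of_halves)
  have "uniformly_convergent_on (cball 0 (1 - d)) (\<lambda>N q. \<Prod>n<N. 1 + - ((q::complex) ^ Suc n))"
  proof (rule uniformly_convergent_on_prod)
    show "uniformly_convergent_on (cball 0 (1 - d)) (\<lambda>N q. \<Sum>n<N. norm (- ((q::complex) ^ Suc n)))"
    proof (rule Weierstrass_m_test')
      show "norm (norm (- (q ^ Suc n))) \<le> (1 - d) ^ Suc n" if "q \<in> cball 0 (1 - d)" for n and q :: complex
        using that power_mono [of "norm q" "1 - d" "Suc n"] by (simp add: norm_mult norm_power)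
      show "summable (\<lambda>n. (1 - d) ^ Suc n)"
        using d by (simp add: summable_mult summable_geometric)
    qed
  qed (auto intro!: continuous_intros)
  then have "uniformly_convergent_on (cball 0 (1 - d)) (\<lambda>n q. qpoch q n)"
    by (simp add: qpoch_def)
  then obtain l where l: "uniform_limit (cball 0 (1 - d)) (\<lambda>n q. qpoch q n) l sequentially"
    by (auto simp: uniformly_convergent_on_def)
  have "l q = euler_prod q" if "q \<in> cball 0 (1 - d)" for q
    using tendsto_uniform_limitI [OF l that] qpoch_tendsto [of q] that d
    by (auto intro: LIMSEQ_unique)
  then have "uniform_limit (cball 0 (1 - d)) (\<lambda>n q. qpoch q n) euler_prod sequentially"
    using l uniform_limit_cong' [of "cball 0 (1 - d)" "\<lambda>n q. qpoch q n" "\<lambda>n q. qpoch q n" l euler_prod]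
    by simp
  then show "\<exists>d>0. cball x d \<subseteq> ball 0 1 \<and> uniform_limit (cball x d) (\<lambda>n q. qpoch q n) euler_prod sequentially"
    using d by (intro exI [of _ d]) (auto elim: uniform_limit_on_subset)
qed auto

lemma eta_eq: "\<tau> \<in> upper_half_plane \<Longrightarrow> eta \<tau> = ee (\<tau> / 24) * euler_prod (ee \<tau>)"
  by (simp add: eta_def euler_prod_def ee_of_nat_mult del: of_nat_Suc)

lemma eta_nonzero: "\<tau> \<in> upper_half_plane \<Longrightarrow> eta \<tau> \<noteq> 0"
  by (simp add: eta_eq euler_prod_nonzero norm_ee_less_1)

lemma open_upper_half_plane: "open upper_half_plane"
  unfolding upper_half_plane_def by (rule open_halfspace_Im_gt)

lemma connected_upper_half_plane: "connected upper_half_plane"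
  unfolding upper_half_plane_def
  by (intro convex_connected convex_halfspace_Im_gt)

lemma eta_holomorphic: "eta holomorphic_on upper_half_plane"
proof -
  have "(\<lambda>\<tau>. ee (\<tau> / 24) * euler_prod (ee \<tau>)) holomorphic_on upper_half_plane"
    by (intro holomorphic_intros holomorphic_on_compose_gen [OF _ euler_prod_holomorphic, unfolded o_def])
       (auto simp: norm_ee_less_1)
  then show ?thesis by (simp add: eta_eq cong: holomorphic_cong)
qed

section \<open>Jacobi's identity for the cube of the Euler product\<close>

text \<open>
  Gaussian binomial coefficients, defined by the \<open>q\<close>-Pascal recursion so that they are polynomials in
  \<open>q\<close> and need no division.
\<close>
fun gauss_binom :: "complex \<Rightarrow> nat \<Rightarrow> nat \<Rightarrow> complex" where
  "gauss_binom q n 0 = 1"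
| "gauss_binom q 0 (Suc k) = 0"
| "gauss_binom q (Suc n) (Suc k) = gauss_binom q n (Suc k) + q ^ (n - k) * gauss_binom q n k"

lemma gauss_binom_eq_0: "n < k \<Longrightarrow> gauss_binom q n k = 0"
  by (induction q n k rule: gauss_binom.induct) auto

lemma gauss_binom_eq:
  "k \<le> n \<Longrightarrow> gauss_binom q n k * qpoch q k * qpoch q (n - k) = qpoch q n"
proof (induction q n k rule: gauss_binom.induct)
  case (3 q n k)
  show ?case
  proof (cases "k = n")
    case True
    have "gauss_binom q m m = 1" for m
      by (induction m) (auto simp: gauss_binom_eq_0)
    then show ?thesis using True by (simp add: gauss_binom_eq_0 qpoch_def)
  next
    case False
    with 3 have k: "Suc k \<le> n" by simp
    define m where "m = n - Suc k"
    have n: "n = m + Suc k" using k by (simp add: m_def)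
    have IH: "gauss_binom q n (Suc k) * qpoch q (Suc k) * qpoch q m = qpoch q n"
             "gauss_binom q n k * qpoch q k * qpoch q (Suc m) = qpoch q n"
      using 3 k by (simp_all add: n)
    have S: "qpoch q (Suc i) = qpoch q i * (1 - q ^ Suc i)" for i
      by (simp add: qpoch_def)
    have "gauss_binom q (Suc n) (Suc k) * qpoch q (Suc k) * qpoch q (Suc m)
        = (gauss_binom q n (Suc k) * qpoch q (Suc k) * qpoch q m) * (1 - q ^ Suc m)
          + q ^ Suc m * (gauss_binom q n k * qpoch q k * qpoch q (Suc m)) * (1 - q ^ Suc k)"
      by (simp add: S n algebra_simps)
    also have "\<dots> = qpoch q n * (1 - q ^ Suc n)"
      unfolding IH by (simp add: n algebra_simps power_add)
    finally show ?thesis by (simp add: S n)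
  qed
qed (auto simp: qpoch_def)

text \<open>
  The finite \<open>q\<close>-binomial theorem; its derivative at a zero is a finite form of Jacobi's identity.
\<close>
lemma gauss_binom_theorem:
  "(\<Prod>k<n. 1 - x * q ^ k) = (\<Sum>k\<le>n. (- 1) ^ k * q ^ (k choose 2) * gauss_binom q n k * x ^ k)"
proof (induction n)
  case (Suc n)
  define a where "a = (\<lambda>k. (- 1) ^ k * q ^ (k choose 2) * gauss_binom q n k * x ^ k)"
  have "(\<Sum>k\<le>Suc n. (- 1) ^ k * q ^ (k choose 2) * gauss_binom q (Suc n) k * x ^ k)
      = 1 + (\<Sum>k\<le>n. a (Suc k) - x * q ^ n * a k)"
  proof -
    have "(- 1) ^ Suc k * q ^ (Suc k choose 2) * gauss_binom q (Suc n) (Suc k) * x ^ Suc k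
        = a (Suc k) - x * q ^ n * a k" if "k \<le> n" for k
    proof -
      have "q ^ n = q ^ (n - k) * q ^ k" using that by (simp flip: power_add)
      moreover have "Suc k choose 2 = (k choose 2) + k"
        by (simp add: numeral_2_eq_2)
      ultimately show ?thesis by (simp add: a_def power_add algebra_simps)
    qed
    then show ?thesis
      by (subst sum.atMost_Suc_shift) (simp add: binomial_eq_0 del: power_Suc gauss_binom.simps(3))
  qed
  also have "1 + (\<Sum>k\<le>n. a (Suc k) - x * q ^ n * a k) = (\<Sum>k\<le>Suc n. a k) - x * q ^ n * (\<Sum>k\<le>n. a k)"
    by (subst sum.atMost_Suc_shift) (simp add: sum_subtractf sum_distrib_left a_def binomial_eq_0)
  also have "(\<Sum>k\<le>Suc n. a k) = (\<Sum>k\<le>n. a k)"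
    by (simp add: a_def gauss_binom_eq_0)
  finally show ?case
    using Suc by (simp add: a_def algebra_simps)
qed (simp add: binomial_eq_0)

lemma gauss_binom_symmetric:
  assumes "norm q < 1" "k \<le> n"
  shows "gauss_binom q n (n - k) = gauss_binom q n k"
proof -
  have "gauss_binom q n (n - k) * (qpoch q k * qpoch q (n - k)) = gauss_binom q n k * (qpoch q k * qpoch q (n - k))"
    using gauss_binom_eq [of k n q] gauss_binom_eq [of "n - k" n q] assms(2) by (simp add: mult_ac)
  then show ?thesis using qpoch_nonzero [OF assms(1)] by simp
qed

lemma triangle_choose: "2 * (Suc n choose 2) = n * Suc n"
  by (induction n) (auto simp: numeral_2_eq_2)

lemma choose_2_int: "2 * int (k choose 2) = int k * (int k - 1)"
  using triangle_choose [of "k - 1"] by (cases k) (auto simp: algebra_simps simp flip: of_nat_mult)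

text \<open>
  Differentiate the \<open>q\<close>-binomial expansion of \<open>\<Prod>\<^sub>k\<^sub>\<le>\<^sub>2\<^sub>N (1 - x q\<^sup>k)\<close> at its zero \<open>x = q\<^sup>-\<^sup>N\<close>. The derivative
  of the product is, up to sign and a power of \<open>q\<close>, the product of the other factors, which is a square; on
  the other side the terms pair up.
\<close>
lemma finite_jacobi_identity:
  assumes q: "norm q < 1" "q \<noteq> 0"
  shows "(\<Sum>j\<le>N. (2 * of_nat j + 1) * (- 1) ^ j * q ^ (Suc j choose 2)
            * gauss_binom q (2 * N + 1) (N + 1 + j)) = (qpoch q N)\<^sup>2"
proof -
  define M where "M = 2 * N + 1"
  define a where "a = (\<lambda>k. (- 1) ^ k * q ^ (k choose 2) * gauss_binom q M k)"
  define x0 where "x0 = inverse (q ^ N)"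
  define R where "R = (\<lambda>x. \<Prod>k\<in>{..<M} - {N}. 1 - x * q ^ k)"
  define Q where "Q = q ^ (Suc N choose 2)"
  have Q0: "Q \<noteq> 0" using q by (simp add: Q_def)
  have eq: "(\<Sum>k\<le>M. a k * x ^ k) = (1 - x * q ^ N) * R x" for x
  proof -
    have "(\<Prod>k<M. 1 - x * q ^ k) = (1 - x * q ^ N) * R x"
      unfolding R_def by (subst prod.remove [of _ N]) (auto simp: M_def)
    then show ?thesis
      using gauss_binom_theorem [of x q M] by (simp add: a_def)
  qed
  have x0: "x0 * q ^ N = 1" using q by (simp add: x0_def)
  have deriv: "((\<lambda>x. \<Sum>k\<le>M. a k * x ^ k) has_field_derivative (\<Sum>k\<le>M. a k * (of_nat k * x0 ^ (k - 1)))) (at x0)"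
    by (auto intro!: derivative_eq_intros sum.cong)
  have "R holomorphic_on UNIV" unfolding R_def by (intro holomorphic_intros)
  then obtain R' where R': "(R has_field_derivative R') (at x0)"
    using holomorphic_on_imp_differentiable_at [of R UNIV x0] by (auto simp: field_differentiable_def)
  have "((\<lambda>x. (1 - x * q ^ N) * R x) has_field_derivative (1 - x0 * q ^ N) * R' + (0 - q ^ N) * R x0) (at x0)"
    by (rule derivative_eq_intros R' refl | simp)+
  then have "((\<lambda>x. \<Sum>k\<le>M. a k * x ^ k) has_field_derivative - (q ^ N) * R x0) (at x0)"
    by (simp add: eq x0)
  from DERIV_unique [OF deriv this] have "(\<Sum>k\<le>M. a k * (of_nat k * x0 ^ (k - 1))) * x0 = - R x0"
    using x0 by (simp add: mult_ac)
  then have sum_R: "(\<Sum>k\<le>M. of_nat k * (a k * x0 ^ k)) = - R x0"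
    unfolding sum_distrib_right
  proof (subst (asm) sum.cong [OF refl])
    show "a k * (of_nat k * x0 ^ (k - 1)) * x0 = of_nat k * (a k * x0 ^ k)" for k
      by (cases k) auto
  qed

  \<comment> \<open>At the zero \<open>q\<^sup>-\<^sup>N\<close> the terms \<open>N - j\<close> and \<open>N + 1 + j\<close> of the expansion differ only by the sign.\<close>
  define b where "b = (\<lambda>j. (- 1) ^ j * q ^ (Suc j choose 2) * gauss_binom q M (N + 1 + j))"
  have cancel: "q ^ k * x0 ^ m = q ^ i / q ^ j" if "k + j = i + N * m" for k m i j
    using that q by (simp add: x0_def power_inverse field_simps flip: power_mult power_add)
  have up: "a (N + 1 + j) * x0 ^ (N + 1 + j) = (- 1) ^ Suc N * b j / Q" if "j \<le> N" for j
  proof -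
    have "2 * int ((N + 1 + j choose 2) + (Suc N choose 2)) = 2 * int ((Suc j choose 2) + N * (N + 1 + j))"
      unfolding of_nat_add distrib_left choose_2_int by (simp add: algebra_simps)
    note this [unfolded mult_cancel_left of_nat_eq_iff]
    then have "(N + 1 + j choose 2) + (Suc N choose 2) = (Suc j choose 2) + N * (N + 1 + j)"
      by simp
    from cancel [OF this] show ?thesis
      by (simp add: a_def b_def Q_def power_add mult_ac)
  qed
  have down: "a (N - j) * x0 ^ (N - j) = (- 1) ^ N * b j / Q" if "j \<le> N" for j
  proof -
    have "2 * int ((N - j choose 2) + (Suc N choose 2)) = 2 * int ((Suc j choose 2) + N * (N - j))"
      using that unfolding of_nat_add distrib_left choose_2_int by (simp add: algebra_simps of_nat_diff)
    note this [unfolded mult_cancel_left of_nat_eq_iff]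
    then have "(N - j choose 2) + (Suc N choose 2) = (Suc j choose 2) + N * (N - j)"
      by simp
    from cancel [OF this] have c: "q ^ (N - j choose 2) * x0 ^ (N - j) = q ^ (Suc j choose 2) / Q"
      by (simp add: Q_def)
    have "gauss_binom q M (N - j) = gauss_binom q M (N + 1 + j)"
      using gauss_binom_symmetric [of q "N + 1 + j" M] q that by (simp add: M_def)
    moreover have "(- 1) ^ (N - j) = (- 1 :: complex) ^ N * (- 1) ^ j"
      using that by (auto simp: minus_one_power_iff)
    moreover have "a (N - j) * x0 ^ (N - j) = (- 1) ^ (N - j) * (q ^ (N - j choose 2) * x0 ^ (N - j)) * gauss_binom q M (N - j)"
      by (simp add: a_def mult_ac)
    ultimately show ?thesis
      unfolding c by (simp add: b_def)
  qed
  have "(\<Sum>k\<le>M. of_nat k * (a k * x0 ^ k)) =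
        (\<Sum>k\<le>N. of_nat k * (a k * x0 ^ k)) + (\<Sum>k\<in>{Suc N..M}. of_nat k * (a k * x0 ^ k))"
  proof -
    have "{..M} = {..N} \<union> {Suc N..M}" by (auto simp: M_def)
    then show ?thesis by (simp add: sum.union_disjoint)
  qed
  also have "(\<Sum>k\<le>N. of_nat k * (a k * x0 ^ k)) = (\<Sum>j\<le>N. of_nat (N - j) * (a (N - j) * x0 ^ (N - j)))"
    by (rule sum.reindex_bij_witness [of _ "\<lambda>j. N - j" "\<lambda>j. N - j"]) auto
  also have "(\<Sum>k\<in>{Suc N..M}. of_nat k * (a k * x0 ^ k))
           = (\<Sum>j\<le>N. of_nat (N + 1 + j) * (a (N + 1 + j) * x0 ^ (N + 1 + j)))"
    by (rule sum.reindex_bij_witness [of _ "\<lambda>j. N + 1 + j" "\<lambda>j. j - (N + 1)"]) (auto simp: M_def)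
  also have "(\<Sum>j\<le>N. of_nat (N - j) * (a (N - j) * x0 ^ (N - j))) + \<dots>
           = (\<Sum>j\<le>N. (- 1) ^ Suc N * ((2 * of_nat j + 1) * b j) / Q)"
    unfolding sum.distrib [symmetric]
  proof (rule sum.cong [OF refl])
    fix j assume "j \<in> {..N}"
    then have j: "j \<le> N" by simp
    show "of_nat (N - j) * (a (N - j) * x0 ^ (N - j)) + of_nat (N + 1 + j) * (a (N + 1 + j) * x0 ^ (N + 1 + j))
        = (- 1) ^ Suc N * ((2 * of_nat j + 1) * b j) / Q"
      unfolding up [OF j] down [OF j] using j by (simp add: of_nat_diff algebra_simps add_divide_distrib diff_divide_distrib)
  qed
  also have "\<dots> = (- 1) ^ Suc N / Q * (\<Sum>j\<le>N. (2 * of_nat j + 1) * b j)"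
    unfolding sum_distrib_left by (simp add: mult_ac)
  finally have main: "(- 1) ^ Suc N / Q * (\<Sum>j\<le>N. (2 * of_nat j + 1) * b j) = - R x0"
    using sum_R by simp

  have "R x0 = (\<Prod>k<N. 1 - x0 * q ^ k) * (\<Prod>k\<in>{Suc N..<M}. 1 - x0 * q ^ k)"
  proof -
    have split: "{..<M} - {N} = {..<N} \<union> {Suc N..<M}" by (auto simp: M_def)
    show ?thesis unfolding R_def split by (rule prod.union_disjoint) auto
  qed
  also have "(\<Prod>k\<in>{Suc N..<M}. 1 - x0 * q ^ k) = qpoch q N"
  proof -
    have "{Suc N..<M} = {0 + Suc N..<N + Suc N}" by (simp add: M_def mult_2)
    moreover have "1 - x0 * q ^ (k + Suc N) = 1 - q ^ Suc k" for k
    proof -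
      have "x0 * q ^ (k + Suc N) = (x0 * q ^ N) * q ^ Suc k"
        by (simp add: power_add mult_ac)
      then show ?thesis by (simp only: x0 mult_1_left)
    qed
    ultimately show ?thesis
      by (simp only: prod.shift_bounds_nat_ivl qpoch_def lessThan_atLeast0)
  qed
  also have "(\<Prod>k<N. 1 - x0 * q ^ k) = (\<Prod>k<N. - inverse (q ^ Suc k) * (1 - q ^ Suc k))"
  proof (rule prod.reindex_bij_witness [of _ "\<lambda>k. N - Suc k" "\<lambda>k. N - Suc k"])
    fix k assume "k \<in> {..<N}"
    then have N: "N = k + Suc (N - Suc k)" by simp
    have "x0 * q ^ k = inverse (q ^ Suc (N - Suc k))"
      unfolding x0_def by (subst N, subst power_add) (use q in \<open>simp add: divide_simps\<close>)
    moreover have "- inverse y * (1 - y) = 1 - inverse y" if "y \<noteq> 0" for y :: complex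
      using that by (simp add: right_diff_distrib)
    ultimately show "- inverse (q ^ Suc (N - Suc k)) * (1 - q ^ Suc (N - Suc k)) = 1 - x0 * q ^ k"
      using q by (metis power_not_zero)
  qed auto
  also have "\<dots> = (\<Prod>k<N. - inverse (q ^ Suc k)) * qpoch q N"
    by (simp only: qpoch_def prod.distrib)
  also have "(\<Prod>k<N. - inverse (q ^ Suc k)) = (- 1) ^ N / q ^ (Suc N choose 2)"
  proof (induction N)
    case (Suc n)
    have "Suc (Suc n) choose 2 = (Suc n choose 2) + Suc n"
      by (simp add: numeral_2_eq_2)
    then show ?case
      using Suc by (simp only: prod.lessThan_Suc power_add) (simp add: divide_simps)
  qed (simp add: binomial_eq_0)
  finally have "R x0 = (- 1) ^ N / Q * (qpoch q N)\<^sup>2"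
    by (simp add: Q_def power2_eq_square)
  with main have "(- 1) ^ N / Q * (\<Sum>j\<le>N. (2 * of_nat j + 1) * b j) = (- 1) ^ N / Q * (qpoch q N)\<^sup>2"
    by simp
  then have "(\<Sum>j\<le>N. (2 * of_nat j + 1) * b j) = (qpoch q N)\<^sup>2"
    using Q0 by simp
  then show ?thesis by (simp add: b_def M_def mult.assoc)
qed

text \<open>
  For \<open>N \<rightarrow> \<infinity>\<close> the Gaussian binomial coefficients in the finite identity tend to \<open>1 / \<Prod>(1 - q\<^sup>m)\<close> and are
  bounded uniformly, so Tannery's theorem permits the passage to the limit.
\<close>
theorem jacobi_identity:
  assumes q: "norm q < 1" "q \<noteq> 0"
  shows "(\<lambda>j. (2 * of_nat j + 1) * (- 1) ^ j * q ^ (Suc j choose 2)) sums (euler_prod q ^ 3)"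
    and "summable (\<lambda>j. norm ((2 * of_nat j + 1) * (- 1) ^ j * q ^ (Suc j choose 2)))"
proof -
  define P where "P = euler_prod q"
  have P: "P \<noteq> 0" using q by (simp add: P_def euler_prod_nonzero)
  define c where "c = (\<lambda>j. (2 * of_nat j + 1) * (- 1) ^ j * q ^ (Suc j choose 2))"
  have lim: "qpoch q \<longlonglongrightarrow> P" using qpoch_tendsto q by (simp add: P_def)
  have lim_inv: "(\<lambda>n. inverse (qpoch q n)) \<longlonglongrightarrow> inverse P"
    using lim P by (rule tendsto_inverse)
  obtain B1 where B1: "\<And>n. norm (qpoch q n) \<le> B1"
    using convergent_imp_Bseq [OF convergentI [OF lim]] by (auto simp: Bseq_def)
  obtain B2 where B2: "\<And>n. norm (inverse (qpoch q n)) \<le> B2"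
    using convergent_imp_Bseq [OF convergentI [OF lim_inv]] by (auto simp: Bseq_def)
  note B = B1 B2
  have B0: "0 \<le> B1" "0 \<le> B2"
    using B(1) [of 0] B(2) [of 0] norm_ge_zero order_trans by blast+
  define g where "g = (\<lambda>j N. gauss_binom q (2 * N + 1) (N + 1 + j))"
  have g_eq: "g j N = qpoch q (2 * N + 1) * inverse (qpoch q (N + 1 + j)) * inverse (qpoch q (N - j))"
    if "j \<le> N" for j N
    using gauss_binom_eq [of "N + 1 + j" "2 * N + 1" q] qpoch_nonzero [of q] q that
    by (simp add: g_def field_simps)
  have g_bound: "norm (g j N) \<le> B1 * B2 * B2" for j N
  proof (cases "j \<le> N")
    case True
    then show ?thesis
      unfolding g_eq [OF True] norm_mult by (intro mult_mono B) (use B0 in auto)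
  next
    case False
    then show ?thesis using B0 by (simp add: g_def gauss_binom_eq_0)
  qed
  have g_lim: "(\<lambda>N. g j N) \<longlonglongrightarrow> P * inverse P * inverse P" for j
  proof -
    have 1: "filterlim (\<lambda>N. 2 * N + 1) at_top (sequentially)"
      by (rule filterlim_subseq) (auto simp: strict_mono_def)
    have 2: "filterlim (\<lambda>N. N + 1 + j) at_top (sequentially)"
      by (rule filterlim_subseq) (auto simp: strict_mono_def)
    have 3: "filterlim (\<lambda>N. N - j) at_top (sequentially)"
      by (simp add: filterlim_minus_const_nat_at_top)
    have "(\<lambda>N. qpoch q (2 * N + 1) * inverse (qpoch q (N + 1 + j)) * inverse (qpoch q (N - j)))
            \<longlonglongrightarrow> P * inverse P * inverse P"
      by (intro tendsto_mult filterlim_compose [OF lim 1] filterlim_compose [OF lim_inv 2] filterlim_compose [OF lim_inv 3])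
    then show ?thesis
      by (rule Lim_transform_eventually) (use g_eq in \<open>simp add: eventually_sequentially exI [of _ j]\<close>)
  qed
  define D where "D = (\<lambda>j. 2 * (of_nat (Suc j) * norm q ^ j))"
  have c_bound: "norm (c j) \<le> D j" for j
  proof -
    have "norm (2 * of_nat j + 1 :: complex) = 2 * real j + 1"
      using norm_of_nat [of "2 * j + 1", where 'a = complex] by (simp add: add.commute)
    moreover have "norm q ^ (Suc j choose 2) \<le> norm q ^ j"
      using q by (intro power_decreasing) (auto simp: numeral_2_eq_2)
    ultimately show ?thesis
      unfolding c_def D_def norm_mult norm_power
      using mult_mono [of "2 * real j + 1" "2 * real (Suc j)" "norm q ^ (Suc j choose 2)" "norm q ^ j"]
      by (simp add: algebra_simps)
  qed
  have D: "summable D"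
    unfolding D_def using geometric_deriv_sums [of "norm q"] q by (intro summable_mult) (auto simp: sums_iff)
  have "(\<lambda>N. \<Sum>j. c j * g j N) \<longlonglongrightarrow> (\<Sum>j. c j * (P * inverse P * inverse P))"
  proof (rule tannerys_theorem [THEN conjunct2, THEN conjunct2])
    show "(\<lambda>N. c j * g j N) \<longlonglongrightarrow> c j * (P * inverse P * inverse P)" for j
      by (intro tendsto_intros g_lim)
    have "norm (c j * g j N) \<le> D j * (B1 * B2 * B2)" for j N
      unfolding norm_mult by (intro mult_mono c_bound g_bound) (auto intro: order_trans [OF norm_ge_zero c_bound])
    then show "eventually (\<lambda>(j, N). norm (c j * g j N) \<le> D j * (B1 * B2 * B2)) (at_top \<times>\<^sub>F sequentially)"
      by (intro always_eventually) auto
    show "summable (\<lambda>j. D j * (B1 * B2 * B2))" by (intro summable_mult2 D)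
  qed simp
  moreover have "(\<Sum>j. c j * g j N) = (qpoch q N)\<^sup>2" for N
  proof -
    have "(\<Sum>j. c j * g j N) = (\<Sum>j\<le>N. c j * g j N)"
      by (rule suminf_finite) (auto simp: g_def gauss_binom_eq_0)
    then show ?thesis
      using finite_jacobi_identity [OF q, of N] by (simp add: c_def g_def)
  qed
  ultimately have "(\<lambda>N. (qpoch q N)\<^sup>2) \<longlonglongrightarrow> (\<Sum>j. c j * (P * inverse P * inverse P))"
    by simp
  moreover have "(\<lambda>N. (qpoch q N)\<^sup>2) \<longlonglongrightarrow> P\<^sup>2"
    by (intro tendsto_intros lim)
  ultimately have "(\<Sum>j. c j * (P * inverse P * inverse P)) = P\<^sup>2"
    by (rule LIMSEQ_unique)
  show sm: "summable (\<lambda>j. norm ((2 * of_nat j + 1) * (- 1) ^ j * q ^ (Suc j choose 2)))"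
    using summable_comparison_test' [OF D, of 0 "\<lambda>j. norm (c j)"] c_bound by (simp add: c_def)
  then have "summable c" unfolding c_def by (rule summable_norm_cancel)
  then have "(\<Sum>j. c j) * inverse P = P\<^sup>2"
    using \<open>(\<Sum>j. c j * (P * inverse P * inverse P)) = P\<^sup>2\<close> P suminf_mult2 [of c "inverse P"] by simp
  then have "suminf c = P ^ 3" using P by (simp add: field_simps power2_eq_square power3_eq_cube)
  then show "(\<lambda>j. (2 * of_nat j + 1) * (- 1) ^ j * q ^ (Suc j choose 2)) sums (euler_prod q ^ 3)"
    using \<open>summable c\<close> by (simp add: sums_iff c_def P_def)
qed

no_notation fps_nth (infixl "$" 75)

section \<open>Fourier series on the torus\<close>

abbreviation rvec :: "int^'n \<Rightarrow> real^'n" where "rvec \<equiv> vec_of_int"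

definition unit_cube :: "(real^'n) set" where
  "unit_cube = {u. \<forall>i. 0 \<le> u $ i \<and> u $ i < 1}"

definition fchar :: "int^'n \<Rightarrow> real^'n \<Rightarrow> complex" where
  "fchar k u = ee (of_real (\<Sum>i\<in>UNIV. of_int (k $ i) * u $ i))"

lemma vec_of_int_add: "vec_of_int (x + y) = vec_of_int x + vec_of_int y"
  by (simp add: vec_of_int_def vec_eq_iff)

lemma vec_of_int_minus: "vec_of_int (- x) = - vec_of_int x"
  by (simp add: vec_of_int_def vec_eq_iff)

lemma vec_of_int_diff: "vec_of_int (x - y) = vec_of_int x - vec_of_int y"
  by (simp add: vec_of_int_def vec_eq_iff)

lemma vec_of_int_0 [simp]: "vec_of_int 0 = 0"
  by (simp add: vec_of_int_def vec_eq_iff)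

lemma fchar_add: "fchar k (u + v) = fchar k u * fchar k v"
  by (simp add: fchar_def sum.distrib distrib_left flip: ee_add)

lemma fchar_add_left: "fchar (k + l) u = fchar k u * fchar l u"
  by (simp add: fchar_def sum.distrib distrib_right flip: ee_add)

lemma fchar_0 [simp]: "fchar 0 u = 1"
  by (simp add: fchar_def)

lemma norm_fchar [simp]: "norm (fchar k u) = 1"
  by (simp add: fchar_def norm_ee)

lemma fchar_vec_of_int [simp]: "fchar k (vec_of_int x) = 1"
  unfolding fchar_def by (rule ee_Ints) (auto simp: vec_of_int_def)

lemma fchar_uminus: "fchar (- k) u = cnj (fchar k u)"
  by (simp add: fchar_def ee_def exp_cnj sum_negf)

lemma continuous_on_fchar [continuous_intros]: "continuous_on A (fchar k)"
  unfolding fchar_def by (intro continuous_intros)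

lemma borel_measurable_fchar [measurable]: "fchar k \<in> borel_measurable borel"
  by (intro borel_measurable_continuous_onI continuous_intros)

lemma countable_int_vec: "countable (UNIV :: (int^'n) set)"
  by (rule countableI_type)

lemma infinite_int_vec: "infinite (UNIV :: (int^'n) set)"
proof
  assume "finite (UNIV :: (int^'n) set)"
  then have "finite (range (\<lambda>k. (\<chi> i. k) :: int^'n))"
    by (rule rev_finite_subset) auto
  moreover have "inj (\<lambda>k. (\<chi> i. k) :: int^'n)"
    by (auto simp: inj_def vec_eq_iff)
  ultimately show False
    using finite_imageD infinite_UNIV_int by blast
qed

text \<open>
  An enumeration of \<open>\<int>\<^sup>n\<close>, by which facts on series indexed by the natural numbers apply to unordered
  sums over the lattice.
\<close>
definition int_vec_enum :: "nat \<Rightarrow> int^'n" where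
  "int_vec_enum = from_nat_into UNIV"

lemma bij_int_vec_enum: "bij (int_vec_enum :: nat \<Rightarrow> int^'n)"
  unfolding int_vec_enum_def by (rule bij_betw_from_nat_into [OF countable_int_vec infinite_int_vec])

lemma has_sum_imp_sums_enum:
  assumes "(f has_sum S) (UNIV :: (int^'n) set)"
  shows "(\<lambda>k. f (int_vec_enum k)) sums S"
proof (rule has_sum_imp_sums)
  show "((\<lambda>k. f (int_vec_enum k)) has_sum S) UNIV"
    using has_sum_reindex_bij_betw [OF bij_int_vec_enum, of f S] assms by simp
qed

lemma summable_on_imp_summable_enum:
  fixes f :: "int^'n \<Rightarrow> 'b :: {topological_comm_monoid_add,t2_space}"
  shows "f summable_on UNIV \<Longrightarrow> summable (\<lambda>k. f (int_vec_enum k))"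
  using has_sum_imp_sums_enum [of f] by (auto simp: summable_on_def dest: sums_summable)

lemma summable_norm_enum:
  fixes f :: "int^'n \<Rightarrow> complex"
  shows "f summable_on UNIV \<Longrightarrow> summable (\<lambda>k. norm (f (int_vec_enum k)))"
  by (intro summable_on_imp_summable_enum) (simp add: summable_on_iff_abs_summable_on_complex)

lemma borel_unit_cube [measurable]: "(unit_cube :: (real^'n) set) \<in> sets borel"
proof -
  have eq: "(unit_cube :: (real^'n) set) = (\<Inter>i. {u. 0 \<le> u $ i} \<inter> {u. u $ i < 1})"
    by (auto simp: unit_cube_def)
  moreover  have "{u::real^'n. 0 \<le> u $ i} \<in> sets borel" "{u::real^'n. u $ i < 1} \<in> sets borel" for i
    by (auto intro!: borel_open open_Collect_less borel_closed closed_Collect_le continuous_intros)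
  then show ?thesis unfolding eq by (intro sets.finite_INT sets.Int) auto
qed

lemma unit_cube_subset: "unit_cube \<subseteq> cbox 0 1"
  by (auto simp: unit_cube_def mem_box_cart less_imp_le)

lemma box_subset_unit_cube: "box 0 1 \<subseteq> unit_cube"
  by (auto simp: unit_cube_def mem_box_cart less_imp_le)

lemma emeasure_unit_cube_finite: "emeasure lborel (unit_cube :: (real^'n) set) < \<infinity>"
  using emeasure_mono [OF unit_cube_subset, of lborel] emeasure_lborel_cbox_finite [of "0::real^'n" 1]
  by (auto intro: le_less_trans)

lemma measure_unit_cube_pos: "measure lborel (unit_cube :: (real^'n) set) > 0"
proof -
  have "measure lborel (box 0 1 :: (real^'n) set) > 0"
    by (subst measure_lborel_box_eq)
       (auto simp: Basis_vec_def inner_axis intro!: prod_pos)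
  also have "measure lborel (box 0 1 :: (real^'n) set) \<le> measure lborel (unit_cube :: (real^'n) set)"
    by (rule measure_mono_fmeasurable [OF box_subset_unit_cube])
       (use emeasure_unit_cube_finite in \<open>auto simp: fmeasurable_def\<close>)
  finally show ?thesis .
qed

text \<open>
  The translates of the half-open cube tile the space: the one that contains a point is found by rounding
  down.
\<close>
lemma unit_cube_tile:
  fixes u :: "real^'n"
  shows "u - rvec x \<in> unit_cube \<longleftrightarrow> x = (\<chi> i. \<lfloor>u $ i\<rfloor>)"
proof
  assume "u - rvec x \<in> unit_cube"
  then have "\<lfloor>u $ i\<rfloor> = x $ i" for i
    by (intro floor_unique) (auto simp: unit_cube_def vec_of_int_def algebra_simps less_diff_eq)
  then show "x = (\<chi> i. \<lfloor>u $ i\<rfloor>)" by (simp add: vec_eq_iff)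
next
  assume "x = (\<chi> i. \<lfloor>u $ i\<rfloor>)"
  moreover have "0 \<le> v - of_int \<lfloor>v\<rfloor> \<and> v - of_int \<lfloor>v\<rfloor> < 1" for v :: real
    by linarith
  ultimately show "u - rvec x \<in> unit_cube"
    by (simp add: unit_cube_def vec_of_int_def)
qed

lemma lborel_translate:
  fixes f :: "real^'n \<Rightarrow> complex"
  assumes [measurable]: "f \<in> borel_measurable borel"
  shows "(\<integral>u. f (u + a) \<partial>lborel) = (\<integral>u. f u \<partial>lborel)"
    and "integrable lborel (\<lambda>u. f (u + a)) \<longleftrightarrow> integrable lborel f"
proof -
  have "integral\<^sup>L (distr lborel borel ((+) a)) f = (\<integral>u. f (a + u) \<partial>lborel)"
    by (rule integral_distr) auto
  then show "(\<integral>u. f (u + a) \<partial>lborel) = (\<integral>u. f u \<partial>lborel)"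
    by (simp add: lborel_distr_plus add.commute)
  have "integrable (distr lborel borel ((+) a)) f \<longleftrightarrow> integrable lborel (\<lambda>u. f (a + u))"
    by (rule integrable_distr_eq) auto
  then show "integrable lborel (\<lambda>u. f (u + a)) \<longleftrightarrow> integrable lborel f"
    by (simp add: lborel_distr_plus add.commute)
qed

text \<open>
  Since the translates of the cube tile the space, both sides are the sum of the integrals of \<open>g\<close> over the
  translates; integrability of \<open>g\<close> justifies the exchange of sum and integral.
\<close>
lemma unfold_integral:
  fixes g :: "real^'n \<Rightarrow> complex"
  assumes g: "integrable lborel g"
    and G: "\<And>u. ((\<lambda>x. g (u - rvec x)) has_sum G u) UNIV"
  shows "(LINT u:unit_cube|lborel. G u) = (\<integral>u. g u \<partial>lborel)"
proof -
  let ?e = "int_vec_enum :: nat \<Rightarrow> int^'n"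
  have [measurable]: "g \<in> borel_measurable borel" using g by (auto dest: borel_measurable_integrable)
  define F where "F = (\<lambda>k u. indicator unit_cube (u + rvec (?e k)) *\<^sub>R g u)"
  define H where "H = (\<lambda>k u. indicator unit_cube u *\<^sub>R g (u - rvec (?e k)))"
  have [measurable]: "F k \<in> borel_measurable borel" for k
    unfolding F_def by measurable
  have F_int: "integrable lborel (F k)" for k
    by (rule Bochner_Integration.integrable_bound [OF g]) (auto simp: F_def indicator_def)
  have HF: "H k u = F k (u + - rvec (?e k))" for k u
    by (simp add: F_def H_def)
  have H_int: "integrable lborel (H k)" for k
    using lborel_translate(2) [of "F k" "- rvec (?e k)"] F_int by (simp add: HF [abs_def])
  have HF_eq: "(\<integral>u. H k u \<partial>lborel) = (\<integral>u. F k u \<partial>lborel)" for k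
    using lborel_translate(1) [of "F k" "- rvec (?e k)"] by (simp add: HF)
  have HF_norm: "(\<integral>u. norm (H k u) \<partial>lborel) = (\<integral>u. norm (F k u) \<partial>lborel)" for k
  proof -
    have "(\<integral>u. complex_of_real (norm (H k u)) \<partial>lborel) = (\<integral>u. complex_of_real (norm (F k u)) \<partial>lborel)"
      using lborel_translate(1) [of "\<lambda>u. complex_of_real (norm (F k u))" "- rvec (?e k)"] by (simp add: HF)
    then show ?thesis by (simp only: integral_complex_of_real of_real_eq_iff)
  qed
  \<comment> \<open>Each point lies in exactly one translate of the cube.\<close>
  have tile: "\<exists>k0. \<forall>k. indicator unit_cube (u + rvec (?e k)) = (if k = k0 then 1 else 0 :: real)" for u
  proof -
    obtain k0 where k0: "?e k0 = - (\<chi> i. \<lfloor>u $ i\<rfloor>)"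
      using bij_int_vec_enum by (metis bij_pointE)
    have "u + rvec (?e k) \<in> unit_cube \<longleftrightarrow> k = k0" for k
    proof -
      have "u + rvec (?e k) \<in> unit_cube \<longleftrightarrow> - ?e k = (\<chi> i. \<lfloor>u $ i\<rfloor>)"
        using unit_cube_tile [of u "- ?e k"] by (simp add: vec_of_int_minus)
      also have "\<dots> \<longleftrightarrow> ?e k = ?e k0" by (simp add: k0) (metis minus_minus)
      also have "\<dots> \<longleftrightarrow> k = k0"
        using bij_int_vec_enum by (auto simp: bij_def inj_def)
      finally show ?thesis .
    qed
    then show ?thesis by (intro exI [of _ k0]) (auto simp: indicator_def)
  qed
  have F_sums: "(\<lambda>k. F k u) sums g u" and Fn_sums: "(\<lambda>k. norm (F k u)) sums norm (g u)" for u
  proof -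
    obtain k0 where k0: "\<And>k. indicator unit_cube (u + rvec (?e k)) = (if k = k0 then 1 else 0 :: real)"
      using tile by blast
    show "(\<lambda>k. F k u) sums g u"
      using sums_single [of k0 "\<lambda>_. g u"] by (simp add: F_def k0 if_distrib [of "\<lambda>c. c *\<^sub>R _"] cong: if_cong)
    show "(\<lambda>k. norm (F k u)) sums norm (g u)"
      using sums_single [of k0 "\<lambda>_. norm (g u)"]
      by (simp add: F_def k0 if_distrib [of "\<lambda>c. c * _"] cong: if_cong)
  qed
  have summ: "summable (\<lambda>k. \<integral>u. norm (F k u) \<partial>lborel)"
  proof (rule summableI_nonneg_bounded)
    fix n
    have "(\<Sum>k<n. \<integral>u. norm (F k u) \<partial>lborel) = (\<integral>u. (\<Sum>k<n. norm (F k u)) \<partial>lborel)"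
      using F_int by (intro Bochner_Integration.integral_sum [symmetric]) auto
    also have "\<dots> \<le> (\<integral>u. norm (g u) \<partial>lborel)"
    proof (intro integral_mono)
      show "(\<Sum>k<n. norm (F k u)) \<le> norm (g u)" for u
        using Fn_sums [of u] sum_le_suminf [of "\<lambda>k. norm (F k u)" "{..<n}"] by (auto simp: sums_iff)
    qed (use F_int g in auto)
    finally show "(\<Sum>k<n. \<integral>u. norm (F k u) \<partial>lborel) \<le> (\<integral>u. norm (g u) \<partial>lborel)" .
  qed auto
  have "(\<integral>u. g u \<partial>lborel) = (\<Sum>k. \<integral>u. F k u \<partial>lborel)"
  proof -
    have "(\<integral>u. (\<Sum>k. F k u) \<partial>lborel) = (\<Sum>k. \<integral>u. F k u \<partial>lborel)"
      by (rule integral_suminf [OF F_int _ summ]) (use Fn_sums in \<open>auto simp: sums_iff\<close>)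
    then show ?thesis using F_sums by (simp add: sums_iff)
  qed
  also have "\<dots> = (\<Sum>k. \<integral>u. H k u \<partial>lborel)" by (simp add: HF_eq)
  also have "\<dots> = (\<integral>u. (\<Sum>k. H k u) \<partial>lborel)"
  proof (rule integral_suminf [symmetric, OF H_int])
    have "summable (\<lambda>k. norm (g (u - rvec (?e k))))" for u
      using summable_norm_enum [of "\<lambda>x. g (u - rvec x)"] G [of u] by (auto simp: summable_on_def)
    then show "AE u in lborel. summable (\<lambda>k. norm (H k u))"
      by (auto simp: H_def intro!: summable_mult)
  qed (simp add: HF_norm summ)
  also have "(\<lambda>u. \<Sum>k. H k u) = (\<lambda>u. indicator unit_cube u *\<^sub>R G u)"
  proof
    fix u
    have "(\<lambda>k. g (u - rvec (?e k))) sums G u"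
      using has_sum_imp_sums_enum [OF G [of u]] .
    from sums_scaleR_right [OF this, of "indicator unit_cube u"]
    show "(\<Sum>k. H k u) = indicator unit_cube u *\<^sub>R G u"
      by (simp add: H_def sums_iff)
  qed
  finally show ?thesis by (simp add: set_lebesgue_integral_def)
qed

lemma integrable_indicator_unit_cube:
  fixes f :: "real^'n \<Rightarrow> complex"
  assumes [measurable]: "f \<in> borel_measurable borel" and bound: "\<And>u. u \<in> unit_cube \<Longrightarrow> norm (f u) \<le> B"
  shows "integrable lborel (\<lambda>u. indicator unit_cube u *\<^sub>R f u)"
proof (rule Bochner_Integration.integrable_bound)
  show "integrable lborel (\<lambda>u::real^'n. indicator unit_cube u *\<^sub>R B :: real)"
  proof -
    have "integrable lborel (indicat_real (unit_cube :: (real^'n) set))"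
      using emeasure_unit_cube_finite by (intro integrable_real_indicator) auto
    then show ?thesis by simp
  qed
  show "AE u in lborel. norm (indicator unit_cube u *\<^sub>R f u) \<le> norm (indicator unit_cube u *\<^sub>R B :: real)"
    using bound by (intro AE_I2) (force simp: indicator_def)
qed simp

lemma integral_unit_cube_shift:
  fixes f :: "real^'n \<Rightarrow> complex"
  assumes [measurable]: "f \<in> borel_measurable borel" and bound: "\<And>u. norm (f u) \<le> B"
    and periodic: "\<And>u x. f (u + rvec x) = f u"
  shows "(LINT u:unit_cube|lborel. f (u + a)) = (LINT u:unit_cube|lborel. f u)"
proof -
  define g where "g = (\<lambda>u. indicator unit_cube (u - a) *\<^sub>R f u)"
  have [measurable]: "g \<in> borel_measurable borel" unfolding g_def by measurable
  have shift: "(\<lambda>u. g (u + a)) = (\<lambda>u. indicator unit_cube u *\<^sub>R f (u + a))"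
    by (simp add: g_def)
  have g_int: "integrable lborel g"
    using lborel_translate(2) [of g a] integrable_indicator_unit_cube [of "\<lambda>u. f (u + a)" B] bound
    by (simp add: shift)
  have "(LINT u:unit_cube|lborel. f u) = (\<integral>u. g u \<partial>lborel)"
  proof (rule unfold_integral [OF g_int])
    fix u
    define x0 where "x0 = (\<chi> i. \<lfloor>(u - a) $ i\<rfloor>)"
    have *: "u - rvec x - a \<in> unit_cube \<longleftrightarrow> x = x0" for x
      using unit_cube_tile [of "u - a" x] by (simp add: x0_def algebra_simps)
    have f: "f (u - rvec x) = f u" for x
      using periodic [of "u - rvec x" x] by simp
    show "((\<lambda>x. g (u - rvec x)) has_sum f u) UNIV"
      by (rule has_sum_finite_neutralI [where B = "{x0}"]) (use * f in \<open>auto simp: g_def indicator_def\<close>)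
  qed
  also have "\<dots> = (\<integral>u. g (u + a) \<partial>lborel)"
    by (simp add: lborel_translate)
  finally show ?thesis
    by (simp add: shift set_lebesgue_integral_def)
qed

lemma integral_fchar:
  "(LINT u:unit_cube|lborel. fchar k u) = (if k = 0 then of_real (measure lborel (unit_cube :: (real^'n) set)) else 0)"
  for k :: "int^'n"
proof (cases "k = 0")
  case True
  have "(LINT u:(unit_cube :: (real^'n) set)|lborel. (1::complex)) = of_real (measure lborel (unit_cube :: (real^'n) set))"
    using emeasure_unit_cube_finite by (simp add: set_lebesgue_integral_def scaleR_conv_of_real)
  then show ?thesis using True by simp
next
  case False
  then obtain i where i: "k $ i \<noteq> 0" by (auto simp: vec_eq_iff)
  \<comment> \<open>a shift by which the character changes its sign\<close>
  define a :: "real^'n" where "a = axis i (1 / (2 * of_int (k $ i)))"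
  have "(\<Sum>j\<in>UNIV. of_int (k $ j) * a $ j) = (\<Sum>j\<in>UNIV. if j = i then 1/2 else 0)"
    using i by (intro sum.cong) (auto simp: a_def axis_def)
  then have "(\<Sum>j\<in>UNIV. of_int (k $ j) * a $ j) = 1/2" by simp
  then have "fchar k a = ee (of_real (1/2))"
    by (simp only: fchar_def)
  then have "fchar k a = -1"
    by (simp add: ee_def)
  then have "(LINT u:unit_cube|lborel. fchar k (u + a)) = - (LINT u:unit_cube|lborel. fchar k u)"
    by (simp add: fchar_add set_lebesgue_integral_def)
  moreover have "(LINT u:unit_cube|lborel. fchar k (u + a)) = (LINT u:unit_cube|lborel. fchar k u)"
    by (rule integral_unit_cube_shift [where B = 1]) (auto simp: fchar_add)
  ultimately show ?thesis using False by simp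
qed

lemma fourier_coefficient_series:
  fixes b :: "int^'n \<Rightarrow> complex"
  assumes b: "b summable_on UNIV"
    and F: "\<And>u. ((\<lambda>k. b k * fchar k u) has_sum F u) UNIV"
  shows "(LINT u:unit_cube|lborel. F u * fchar (- l) u) = of_real (measure lborel (unit_cube :: (real^'n) set)) * b l"
proof -
  let ?e = "int_vec_enum :: nat \<Rightarrow> int^'n"
  define f where "f = (\<lambda>j u. indicator unit_cube u *\<^sub>R (b (?e j) * fchar (?e j - l) u))"
  have f_int: "integrable lborel (f j)" for j
    unfolding f_def by (rule integrable_indicator_unit_cube [where B = "norm (b (?e j))"]) (auto simp: norm_mult)
  have val: "(\<integral>u. f j u \<partial>lborel) = (if ?e j = l then of_real (measure lborel (unit_cube :: (real^'n) set)) * b l else 0)" for j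
  proof -
    have "(\<integral>u. f j u \<partial>lborel) = b (?e j) * (LINT u:unit_cube|lborel. fchar (?e j - l) u)"
      by (simp add: f_def set_lebesgue_integral_def mult_scaleR_right [symmetric] del: mult_scaleR_right)
    then show ?thesis by (simp add: integral_fchar)
  qed
  obtain j0 where j0: "?e j = l \<longleftrightarrow> j = j0" for j
    using bij_int_vec_enum by (metis bij_pointE)
  have "(\<integral>u. (\<Sum>j. f j u) \<partial>lborel) = (\<Sum>j. \<integral>u. f j u \<partial>lborel)"
  proof (rule integral_suminf [OF f_int])
    have s: "summable (\<lambda>j. norm (b (?e j)))" by (rule summable_norm_enum [OF b])
    then show "AE u in lborel. summable (\<lambda>j. norm (f j u))"
      by (auto simp: f_def norm_mult intro!: summable_mult)
    have "(\<integral>u. norm (f j u) \<partial>lborel) = norm (b (?e j)) * measure lborel (unit_cube :: (real^'n) set)" for j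
    proof -
      have "(\<lambda>u. norm (f j u)) = (\<lambda>u. norm (b (?e j)) * indicator unit_cube u)"
        by (auto simp: f_def norm_mult)
      then show ?thesis using emeasure_unit_cube_finite by simp
    qed
    then show "summable (\<lambda>j. \<integral>u. norm (f j u) \<partial>lborel)"
      using s by (simp add: summable_mult2)
  qed
  also have "(\<Sum>j. \<integral>u. f j u \<partial>lborel) = of_real (measure lborel (unit_cube :: (real^'n) set)) * b l"
    unfolding val j0 using sums_single [of j0 "\<lambda>_. of_real (measure lborel (unit_cube :: (real^'n) set)) * b l"]
    by (simp add: sums_iff)
  also have "(\<lambda>u. \<Sum>j. f j u) = (\<lambda>u. indicator unit_cube u *\<^sub>R (F u * fchar (- l) u))"
  proof
    fix u
    have "(\<lambda>j. b (?e j) * fchar (?e j) u) sums F u"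
      using has_sum_imp_sums_enum [OF F [of u]] .
    from sums_scaleR_right [OF sums_mult2 [OF this, of "fchar (- l) u"], of "indicator unit_cube u"]
    show "(\<Sum>j. f j u) = indicator unit_cube u *\<^sub>R (F u * fchar (- l) u)"
      by (simp add: f_def sums_iff mult.assoc fchar_add_left [symmetric])
  qed
  finally show ?thesis by (simp add: set_lebesgue_integral_def)
qed

text \<open>
  Trigonometric polynomials, as the span of the characters of the torus.
\<close>
definition trig_polys :: "(real^'n \<Rightarrow> complex) set" where
  "trig_polys = fun_space.span (range fchar)"

lemma trig_polys_fchar: "fchar k \<in> trig_polys"
  unfolding trig_polys_def by (rule fun_space.span_base) auto

lemma trig_polys_add: "p \<in> trig_polys \<Longrightarrow> q \<in> trig_polys \<Longrightarrow> (\<lambda>u. p u + q u) \<in> trig_polys"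
  unfolding trig_polys_def using fun_space.span_add [of p "range fchar" q] by (simp add: plus_fun_def)

lemma trig_polys_scale: "p \<in> trig_polys \<Longrightarrow> (\<lambda>u. c * p u) \<in> trig_polys"
  unfolding trig_polys_def by (rule fun_space.span_scale)

lemma trig_polys_const: "(\<lambda>u. c) \<in> trig_polys"
  using trig_polys_scale [OF trig_polys_fchar [of 0], of c] by simp

lemma trig_polys_sum: "(\<And>i. i \<in> I \<Longrightarrow> f i \<in> trig_polys) \<Longrightarrow> (\<lambda>u. \<Sum>i\<in>I. f i u) \<in> trig_polys"
  by (induction I rule: infinite_finite_induct) (auto intro: trig_polys_add trig_polys_const)

lemma trig_polys_induct [consumes 1, case_names zero step]:
  assumes "p \<in> trig_polys" "P (\<lambda>u. 0)" "\<And>c k p. P p \<Longrightarrow> P (\<lambda>u. c * fchar k u + p u)"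
  shows "P p"
  using assms(1) unfolding trig_polys_def
  by (rule fun_space.span_induct_alt) (use assms(2,3) in \<open>auto simp: zero_fun_def plus_fun_def\<close>)

lemma trig_polys_mult:
  assumes "p \<in> trig_polys" "q \<in> trig_polys"
  shows "(\<lambda>u. p u * q u) \<in> trig_polys"
proof -
  have *: "(\<lambda>u. fchar k u * q u) \<in> trig_polys" for k
    using assms(2)
  proof (induction q rule: trig_polys_induct)
    case zero
    then show ?case using trig_polys_const [of 0] by simp
  next
    case (step c l q)
    have "(\<lambda>u. c * fchar (k + l) u + fchar k u * q u) \<in> trig_polys"
      by (intro trig_polys_add trig_polys_scale trig_polys_fchar step)
    then show ?case by (simp add: fchar_add_left algebra_simps)
  qed
  show ?thesis using assms(1)
  proof (induction p rule: trig_polys_induct)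
    case zero
    then show ?case using trig_polys_const [of 0] by simp
  next
    case (step c l p)
    have "(\<lambda>u. c * (fchar l u * q u) + p u * q u) \<in> trig_polys"
      by (intro trig_polys_add trig_polys_scale * step)
    then show ?case by (simp add: algebra_simps)
  qed
qed

text \<open>
  The embedding of \<open>\<real>\<^sup>n/\<int>\<^sup>n\<close> as a compact set in \<open>\<complex>\<^sup>n\<close>. Periodic functions become functions on this
  compact set, where the Stone-Weierstrass theorem holds.
\<close>
definition torus_point :: "real^'n \<Rightarrow> complex^'n" where
  "torus_point u = (\<chi> i. fchar (axis i 1) u)"

lemma continuous_on_torus_point: "continuous_on A torus_point"
  unfolding torus_point_def by (intro continuous_intros)

lemma fchar_axis: "fchar (axis i 1 :: int^'n) u = ee (of_real (u $ i))"
proof -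
  have "(\<Sum>j\<in>UNIV. of_int ((axis i 1 :: int^'n) $ j) * u $ j) = (\<Sum>j\<in>UNIV. if j = i then u $ i else 0)"
    by (intro sum.cong) (auto simp: axis_def)
  then show ?thesis by (simp only: fchar_def) simp
qed

lemma torus_point_surj:
  assumes "\<And>i. norm (w $ i) = 1"
  obtains u where "u \<in> unit_cube" "torus_point u = w"
proof
  define u where "u = (\<chi> i. Arg2pi (w $ i) / (2 * pi))"
  show "u \<in> unit_cube"
    using Arg2pi_ge_0 Arg2pi_lt_2pi by (auto simp: u_def unit_cube_def)
  have "w $ i = ee (of_real (u $ i))" for i
    using Arg2pi_eq [of "w $ i"] assms by (simp add: u_def ee_def mult_ac)
  then show "torus_point u = w"
    by (simp add: torus_point_def vec_eq_iff fchar_axis)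
qed

lemma torus_point_eq:
  assumes "torus_point u = torus_point v"
  obtains x where "u = v + rvec x"
proof -
  have "\<exists>n::int. u $ i = v $ i + of_int n" for i
  proof -
    have "ee (of_real (u $ i)) = ee (of_real (v $ i))"
      using assms by (simp add: torus_point_def vec_eq_iff fchar_axis)
    then have "ee (of_real (u $ i - v $ i)) = 1" by (simp add: ee_diff)
    then obtain n where "complex_of_real (u $ i - v $ i) = of_int n"
      unfolding ee_eq_1_iff by (elim Ints_cases)
    then have "u $ i - v $ i = of_int n" by (metis of_real_eq_iff of_real_of_int_eq)
    then show ?thesis by (intro exI [of _ n]) simp
  qed
  then obtain n where "\<And>i. u $ i = v $ i + of_int (n i)" by metis
  then have "u = v + rvec (\<chi> i. n i)" by (simp add: vec_eq_iff vec_of_int_def)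
  then show thesis by (rule that)
qed

text \<open>
  Real and imaginary part of a character are linear combinations of the character and its conjugate, again a
  character; so real polynomials in the coordinates become trigonometric polynomials.
\<close>
lemma real_polynomial_torus_point:
  assumes "real_polynomial_function f"
  shows "(\<lambda>u. complex_of_real (f (torus_point u))) \<in> trig_polys"
  using assms
proof (induction rule: real_polynomial_function.induct)
  case (linear f)
  interpret f: bounded_linear f by fact
  have "complex_of_real (f (torus_point u)) =
    (\<Sum>i\<in>UNIV. of_real (f (axis i 1)) * (1/2 * fchar (axis i 1) u + 1/2 * fchar (- axis i 1) u)
             + of_real (f (axis i \<i>)) * (-\<i>/2 * fchar (axis i 1) u + \<i>/2 * fchar (- axis i 1) u))" for u
  proof -
    have "torus_point u = (\<Sum>i\<in>UNIV. Re (fchar (axis i 1) u) *\<^sub>R axis i 1 + Im (fchar (axis i 1) u) *\<^sub>R axis i \<i>)"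
    proof (rule vec_eq_iff [THEN iffD2], rule allI)
      fix j
      have "(\<Sum>i\<in>UNIV. Re (fchar (axis i 1) u) *\<^sub>R axis i 1 + Im (fchar (axis i 1) u) *\<^sub>R axis i \<i>) $ j
         = (\<Sum>i\<in>UNIV. if i = j then Re (fchar (axis i 1) u) *\<^sub>R 1 + Im (fchar (axis i 1) u) *\<^sub>R \<i> else 0)"
        unfolding sum_component by (intro sum.cong) (auto simp: axis_def)
      also have "\<dots> = fchar (axis j 1) u" by (simp add: complex_eq_iff)
      finally show "torus_point u $ j = (\<Sum>i\<in>UNIV. Re (fchar (axis i 1) u) *\<^sub>R axis i 1 + Im (fchar (axis i 1) u) *\<^sub>R axis i \<i>) $ j"
        by (simp add: torus_point_def)
    qed
    then have "f (torus_point u) = (\<Sum>i\<in>UNIV. Re (fchar (axis i 1) u) * f (axis i 1) + Im (fchar (axis i 1) u) * f (axis i \<i>))"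
      by (simp add: f.sum f.add f.scaleR)
    moreover have "of_real (Re z) = 1/2 * z + 1/2 * cnj z" "of_real (Im z) = -\<i>/2 * z + \<i>/2 * cnj z" for z
      by (auto simp: complex_eq_iff)
    ultimately show ?thesis
      by (simp add: fchar_uminus mult.commute)
  qed
  then show ?case
    by (simp only:) (intro trig_polys_sum trig_polys_add trig_polys_scale trig_polys_fchar)
next
  case (const c)
  show ?case by (rule trig_polys_const)
next
  case (add f g)
  then show ?case using trig_polys_add by fastforce
next
  case (mult f g)
  then show ?case using trig_polys_mult by fastforce
qed

lemma trig_poly_approx_real:
  fixes r :: "real^'n \<Rightarrow> real"
  assumes cont: "continuous_on UNIV r" and periodic: "\<And>u x. r (u + rvec x) = r u" and "e > 0"
  obtains p where "p \<in> trig_polys" "\<And>u. norm (of_real (r u) - p u) < e"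
proof -
  define T where "T = {w :: complex^'n. \<forall>i. norm (w $ i) = 1}"
  define g where "g w = r (SOME u. torus_point u = w)" for w
  have g: "g (torus_point u) = r u" for u
  proof -
    have "torus_point (SOME v. torus_point v = torus_point u) = torus_point u"
      by (rule someI) simp
    then obtain x where "(SOME v. torus_point v = torus_point u) = u + rvec x"
      by (rule torus_point_eq)
    then show ?thesis by (simp add: g_def periodic)
  qed
  have T_eq: "torus_point ` cbox 0 1 = T"
  proof (intro equalityI subsetI)
    fix w assume "w \<in> T"
    then obtain u where "u \<in> unit_cube" "torus_point u = w"
      using torus_point_surj [of w] by (auto simp: T_def)
    then show "w \<in> torus_point ` cbox 0 1" using unit_cube_subset by auto
  qed (auto simp: T_def torus_point_def)
  have "compact T"
    unfolding T_eq [symmetric] by (intro compact_continuous_image continuous_on_torus_point compact_cbox)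
  have "continuous_on T g"
    unfolding continuous_on_closed_invariant
  proof (intro allI impI)
    fix B :: "real set" assume B: "closed B"
    have "closed (r -` B)" using continuous_closed_vimage [OF B, of r] cont
      by (simp add: continuous_on_eq_continuous_at)
    then have "compact (torus_point ` (cbox 0 1 \<inter> r -` B))"
      by (intro compact_continuous_image continuous_on_torus_point compact_Int_closed compact_cbox)
    moreover have "torus_point ` (cbox 0 1 \<inter> r -` B) = g -` B \<inter> T"
      unfolding T_eq [symmetric] by (auto simp: g)
    ultimately show "\<exists>A. closed A \<and> A \<inter> T = g -` B \<inter> T"
      by (intro exI [of _ "g -` B \<inter> T"]) (auto dest: compact_imp_closed)
  qed
  with \<open>compact T\<close> obtain f where f: "real_polynomial_function f" "\<And>w. w \<in> T \<Longrightarrow> \<bar>g w - f w\<bar> < e"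
    using Stone_Weierstrass_real_polynomial_function \<open>e > 0\<close> by metis
  show thesis
  proof (rule that)
    show "(\<lambda>u. complex_of_real (f (torus_point u))) \<in> trig_polys"
      by (rule real_polynomial_torus_point [OF f(1)])
    show "norm (complex_of_real (r u) - complex_of_real (f (torus_point u))) < e" for u
      using f(2) [of "torus_point u"] g [of u]
      by (simp add: T_def torus_point_def flip: of_real_diff)
  qed
qed

lemma integral_trig_poly_zero:
  assumes h: "continuous_on UNIV h"
    and zero: "\<And>k. (LINT u:unit_cube|lborel. h u * fchar k u) = 0"
    and "p \<in> trig_polys"
  shows "set_integrable lborel unit_cube (\<lambda>u. h u * p u) \<and> (LINT u:unit_cube|lborel. h u * p u) = 0"
  using \<open>p \<in> trig_polys\<close>
proof (induction p rule: trig_polys_induct)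
  case zero
  then show ?case by (simp add: set_integrable_def set_lebesgue_integral_def)
next
  case (step c k p)
  have "set_integrable lborel unit_cube (\<lambda>u. h u * fchar k u)"
  proof (rule set_integrable_subset)
    show "set_integrable lborel (cbox 0 1) (\<lambda>u. h u * fchar k u)"
      unfolding set_integrable_def
      by (intro borel_integrable_compact compact_cbox continuous_intros continuous_on_subset [OF h]) auto
  qed (use unit_cube_subset in auto)
  then have "set_integrable lborel unit_cube (\<lambda>u. c * (h u * fchar k u))"
    by (rule set_integrable_mult_right)
  with step show ?case
    using zero [of k] set_integral_add [of lborel unit_cube "\<lambda>u. c * (h u * fchar k u)" "\<lambda>u. h u * p u"]
    by (simp add: algebra_simps)
qed

text \<open>
  All integrals of \<open>h\<close> against trigonometric polynomials vanish. Approximating the conjugate of \<open>h\<close>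
  uniformly by such polynomials gives \<open>\<integral>\<bar>h\<bar>\<^sup>2 = 0\<close>.
\<close>
theorem fourier_uniqueness:
  fixes h :: "real^'n \<Rightarrow> complex"
  assumes h: "continuous_on UNIV h" and periodic: "\<And>u x. h (u + rvec x) = h u"
    and zero: "\<And>k. (LINT u:unit_cube|lborel. h u * fchar k u) = 0"
  shows "h u = 0"
proof -
  let ?V = "measure lborel (unit_cube :: (real^'n) set)"
  have [measurable]: "h \<in> borel_measurable borel"
    by (rule borel_measurable_continuous_onI [OF h])
  have "compact (h ` cbox 0 1)"
    by (intro compact_continuous_image continuous_on_subset [OF h] compact_cbox) auto
  then obtain B where B: "\<And>u. u \<in> cbox 0 1 \<Longrightarrow> norm (h u) \<le> B" "B > 0"
    using compact_imp_bounded bounded_pos by (metis imageI)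
  have B': "norm (h u) \<le> B" if "u \<in> unit_cube" for u
    using B(1) unit_cube_subset that by blast
  define I where "I = (LINT u:unit_cube|lborel. complex_of_real ((norm (h u))\<^sup>2))"
  have "norm I \<le> e" if "e > 0" for e
  proof -
    define d where "d = e / (2 * B * ?V)"
    have d: "d > 0" using that B measure_unit_cube_pos [where 'n = 'n] by (simp add: d_def)
    obtain p where p: "p \<in> trig_polys" "\<And>u. norm (of_real (Re (h u)) - p u) < d"
      by (rule trig_poly_approx_real [of "\<lambda>u. Re (h u)" d]) (use h periodic d in \<open>auto intro!: continuous_intros\<close>)
    obtain q where q: "q \<in> trig_polys" "\<And>u. norm (of_real (Im (h u)) - q u) < d"
      by (rule trig_poly_approx_real [of "\<lambda>u. Im (h u)" d]) (use h periodic d in \<open>auto intro!: continuous_intros\<close>)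
    define s where "s = (\<lambda>u. p u + (- \<i>) * q u)"
    have s: "s \<in> trig_polys" unfolding s_def by (intro trig_polys_add trig_polys_scale p q)
    have approx: "norm (cnj (h u) - s u) \<le> 2 * d" for u
    proof -
      have "cnj (h u) - s u = (of_real (Re (h u)) - p u) + (- \<i>) * (of_real (Im (h u)) - q u)"
        by (simp add: s_def complex_eq_iff)
      also have "norm \<dots> \<le> norm (of_real (Re (h u)) - p u) + norm ((- \<i>) * (of_real (Im (h u)) - q u))"
        by (rule norm_triangle_ineq)
      finally show ?thesis using p(2) [of u] q(2) [of u] by (simp add: norm_mult)
    qed
    have 1: "set_integrable lborel unit_cube (\<lambda>u. h u * s u)" "(LINT u:unit_cube|lborel. h u * s u) = 0"
      using integral_trig_poly_zero [OF h zero s] by auto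
    have 2: "set_integrable lborel unit_cube (\<lambda>u. complex_of_real ((norm (h u))\<^sup>2))"
      unfolding set_integrable_def
      by (rule integrable_indicator_unit_cube [where B = "B\<^sup>2"]) (auto simp: norm_power intro!: power_mono B')
    have hs: "complex_of_real ((norm (h u))\<^sup>2) - h u * s u = h u * (cnj (h u) - s u)" for u
      unfolding complex_norm_square by (simp add: algebra_simps)
    have int_diff: "set_integrable lborel unit_cube (\<lambda>u. h u * (cnj (h u) - s u))"
      using set_integral_diff(1) [OF 2 1(1)] unfolding hs .
    have "I = (LINT u:unit_cube|lborel. h u * (cnj (h u) - s u))"
      unfolding hs [symmetric] set_integral_diff(2) [OF 2 1(1)] 1(2) I_def by simp
    also have "norm \<dots> \<le> (LINT u:unit_cube|lborel. norm (h u * (cnj (h u) - s u)))"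
      by (intro set_integral_norm_bound int_diff)
    also have "\<dots> \<le> (LINT u:(unit_cube :: (real^'n) set)|lborel. B * (2 * d))"
    proof (rule set_integral_mono)
      show "set_integrable lborel unit_cube (\<lambda>u. norm (h u * (cnj (h u) - s u)))"
        by (intro set_integrable_norm int_diff)
      have "integrable lborel (indicat_real (unit_cube :: (real^'n) set))"
        using emeasure_unit_cube_finite by (intro integrable_real_indicator) auto
      then show "set_integrable lborel (unit_cube :: (real^'n) set) (\<lambda>u. B * (2 * d))"
        by (simp add: set_integrable_def)
      show "norm (h u * (cnj (h u) - s u)) \<le> B * (2 * d)" if "u \<in> unit_cube" for u
        unfolding norm_mult by (intro mult_mono B' that approx) (use B in auto)
    qed
    also have "\<dots> = B * (2 * d) * ?V"
      using emeasure_unit_cube_finite by (simp add: set_lebesgue_integral_def)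
    also have "\<dots> = e" using B measure_unit_cube_pos [where 'n = 'n] by (simp add: d_def)
    finally show ?thesis .
  qed
  then have "norm I \<le> 0" by (rule field_le_epsilon [of _ 0, simplified])
  then have I: "I = 0" by simp
  have "I = of_real (LINT u:unit_cube|lborel. (norm (h u))\<^sup>2)"
    unfolding I_def by (rule set_integral_complex_of_real)
  with I have int0: "(LINT u:unit_cube|lborel. (norm (h u))\<^sup>2) = 0" by (simp only: of_real_eq_0_iff)
  have int: "set_integrable lborel unit_cube (\<lambda>u. (norm (h u))\<^sup>2)"
  proof (rule set_integrable_subset)
    show "set_integrable lborel (cbox 0 1) (\<lambda>u. (norm (h u))\<^sup>2)"
      unfolding set_integrable_def
      by (intro borel_integrable_compact compact_cbox continuous_intros continuous_on_subset [OF h]) auto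
  qed (use unit_cube_subset in auto)
  have AE: "AE u in lborel. indicator unit_cube u *\<^sub>R (norm (h u))\<^sup>2 = 0"
    using integral_nonneg_eq_0_iff_AE [OF int [unfolded set_integrable_def]] int0
    by (simp add: set_lebesgue_integral_def indicator_def)
  \<comment> \<open>an open set of measure zero is empty, so \<open>h\<close> vanishes on the open cube and by continuity on its closure\<close>
  define S where "S = box 0 1 \<inter> {u. h u \<noteq> 0}"
  have "open S" unfolding S_def
    by (intro open_Int open_box open_Collect_neq h) auto
  have "S = {}"
  proof (rule ccontr)
    assume "S \<noteq> {}"
    have "AE u in lborel. u \<notin> S"
      using AE by eventually_elim (use box_subset_unit_cube in \<open>auto simp: S_def indicator_def\<close>)
    then have "S \<in> null_sets lborel"
      using \<open>open S\<close> by (subst (asm) AE_iff_null [where P = "\<lambda>u. u \<notin> S"]) auto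
    then have "negligible S" by (simp add: negligible_iff_null_sets null_sets_completionI)
    then show False using open_not_negligible [OF \<open>open S\<close>] \<open>S \<noteq> {}\<close> by blast
  qed
  then have "box 0 1 \<subseteq> {u. h u = 0}" by (auto simp: S_def)
  moreover have "closed {u. h u = 0}" by (intro closed_Collect_eq h continuous_intros)
  ultimately have "closure (box 0 1) \<subseteq> {u. h u = 0}" by (rule closure_minimal)
  moreover have "box (0::real^'n) 1 \<noteq> {}" by (auto simp: interval_ne_empty_cart)
  ultimately have cube0: "h v = 0" if "v \<in> cbox 0 1" for v
    using that closure_box by blast
  define x where "x = (\<chi> i. \<lfloor>u $ i\<rfloor>)"
  have "h (u - rvec x) = 0"
    using unit_cube_tile [of u x] unit_cube_subset by (intro cube0) (auto simp: x_def)
  then show ?thesis using periodic [of "u - rvec x" x] by simp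
qed

section \<open>Unimodular lattices\<close>

definition cvec :: "real^'n \<Rightarrow> complex^'n" where
  "cvec u = (\<chi> i. of_real (u $ i))"

lemma cvec_add: "cvec (u + v) = cvec u + cvec v"
  by (simp add: cvec_def vec_eq_iff)

lemma cvec_diff: "cvec (u - v) = cvec u - cvec v"
  by (simp add: cvec_def vec_eq_iff)

lemma cvec_vec_of_int [simp]: "cvec (vec_of_int x) = vec_of_int x"
  by (simp add: cvec_def vec_of_int_def vec_eq_iff)

lemma of_rat_eq_of_real: "of_rat r = complex_of_real (of_rat r)"
  by (cases r) (simp add: of_rat_rat)

lemma vec_of_rat_vec_of_int [simp]: "vec_of_rat (vec_of_int x) = vec_of_int x"
  by (simp add: vec_of_rat_def vec_of_int_def vec_eq_iff)

lemma vec_of_rat_add: "vec_of_rat (x + y) = vec_of_rat x + vec_of_rat y"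
  by (simp add: vec_of_rat_def vec_eq_iff of_rat_add)

lemma vec_of_int_axis: "vec_of_int (axis j 1) = axis j 1"
  by (simp add: vec_of_int_def vec_eq_iff axis_def)

lemma inj_vec_of_int: "inj (vec_of_int :: int^'n \<Rightarrow> ('a::ring_char_0)^'n)"
  by (auto simp: inj_def vec_of_int_def vec_eq_iff)

context fixes \<beta> :: "int^'n \<Rightarrow> int^'n \<Rightarrow> int" begin

lemma bil_add_left: "bil \<beta> (x + y) z = bil \<beta> x z + bil \<beta> y z"
  by (simp add: bil_def algebra_simps sum.distrib)

lemma bil_add_right: "bil \<beta> z (x + y) = bil \<beta> z x + bil \<beta> z y"
  by (simp add: bil_def algebra_simps sum.distrib)

lemma bil_scale_left: "bil \<beta> (c *s x) z = c * bil \<beta> x z"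
  by (simp add: bil_def sum_distrib_left mult_ac)

lemma bil_scale_right: "bil \<beta> z (c *s x) = c * bil \<beta> z x"
  by (simp add: bil_def sum_distrib_left mult_ac)

lemma bil_0_left [simp]: "bil \<beta> 0 z = 0"
  by (simp add: bil_def)

lemma bil_0_right [simp]: "bil \<beta> z 0 = 0"
  by (simp add: bil_def)

lemma bil_minus_left: "bil \<beta> (- x) z = - bil \<beta> x z"
  by (simp add: bil_def sum_negf)

lemma bil_minus_right: "bil \<beta> z (- x) = - bil \<beta> z x"
  by (simp add: bil_def sum_negf)

lemma bil_diff_left: "bil \<beta> (x - y) z = bil \<beta> x z - bil \<beta> y z"
  using bil_add_left [of x "- y" z] by (simp add: bil_minus_left)

lemma bil_diff_right: "bil \<beta> z (x - y) = bil \<beta> z x - bil \<beta> z y"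
  using bil_add_right [of z x "- y"] by (simp add: bil_minus_right)

lemma bil_sum_right: "bil \<beta> z (\<Sum>i\<in>I. f i) = (\<Sum>i\<in>I. bil \<beta> z (f i))"
  by (induction I rule: infinite_finite_induct) (auto simp: bil_add_right)

lemma bil_axis_expand: "bil \<beta> x y = (\<Sum>j\<in>UNIV. y $ j * bil \<beta> x (axis j 1))"
proof -
  have "bil \<beta> x (\<Sum>j\<in>UNIV. y $ j *s axis j 1) = (\<Sum>j\<in>UNIV. y $ j * bil \<beta> x (axis j 1))"
    by (simp add: bil_sum_right bil_scale_right)
  then show ?thesis by (simp only: basis_expansion)
qed

lemma bil_cvec: "bil \<beta> (cvec u) (cvec v) = of_real (bil \<beta> u v)"
  by (simp add: bil_def cvec_def)

lemma quad_cvec: "quad \<beta> (cvec u) = of_real (quad \<beta> u)"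
  by (simp add: quad_def bil_cvec)

lemma bil_vec_of_rat: "bil \<beta> (vec_of_rat r) (vec_of_rat s) = of_rat (bil \<beta> r s)"
  by (simp add: bil_def vec_of_rat_def of_rat_sum of_rat_mult)

lemma quad_vec_of_rat: "quad \<beta> (vec_of_rat r) = of_rat (quad \<beta> r)"
  by (simp add: quad_def bil_vec_of_rat of_rat_divide)

lemma quad_0 [simp]: "quad \<beta> 0 = 0"
  by (simp add: quad_def)

lemma quad_minus [simp]: "quad \<beta> (- x) = quad \<beta> x"
  by (simp add: quad_def bil_minus_left bil_minus_right)

lemma quad_scale: "quad \<beta> (c *s x) = c\<^sup>2 * quad \<beta> x"
  by (simp add: quad_def bil_scale_left bil_scale_right power2_eq_square)

lemma continuous_on_bil [continuous_intros]:
  fixes f g :: "'a::topological_space \<Rightarrow> ('b::real_normed_field)^'n"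
  shows "continuous_on A f \<Longrightarrow> continuous_on A g \<Longrightarrow> continuous_on A (\<lambda>u. bil \<beta> (f u) (g u))"
  unfolding bil_def by (intro continuous_intros)

lemma continuous_on_quad [continuous_intros]:
  fixes f :: "'a::topological_space \<Rightarrow> ('b::real_normed_field)^'n"
  shows "continuous_on A f \<Longrightarrow> continuous_on A (\<lambda>u. quad \<beta> (f u))"
  unfolding quad_def by (intro continuous_intros) auto

end

lemma continuous_on_cvec [continuous_intros]: "continuous_on A f \<Longrightarrow> continuous_on A (\<lambda>u. cvec (f u))"
  unfolding cvec_def by (intro continuous_intros)

text \<open>
  The standard basis generates \<open>\<int>\<^sup>n\<close> as a group.
\<close>
lemma int_vec_subgroup_induct:
  fixes P :: "int^'n \<Rightarrow> bool"
  assumes "P 0" "\<And>j. P (axis j 1)" and add: "\<And>x y. P x \<Longrightarrow> P y \<Longrightarrow> P (x + y)" and neg: "\<And>x. P x \<Longrightarrow> P (- x)"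
  shows "P x"
proof -
  have nat: "P (int m *s axis j 1)" for m j
  proof (induction m)
    case (Suc m)
    then show ?case using add [OF assms(2) [of j] Suc] by (simp add: vector_sadd_rdistrib)
  qed (simp add: assms)
  have int: "P (k *s axis j 1)" for k j
  proof (cases k rule: int_cases2)
    case (nonpos m)
    then have "k *s axis j 1 = - (int m *s axis j (1::int))" by (simp add: vec_eq_iff)
    then show ?thesis using neg [OF nat [of m j]] by simp
  qed (simp add: nat)
  have "P (\<Sum>j\<in>J. x $ j *s axis j 1)" for J
    by (induction J rule: infinite_finite_induct) (auto intro: assms(1) add int)
  from this [of UNIV] show ?thesis by (simp only: basis_expansion)
qed

lemma rat_vec_denominator:
  fixes r :: "rat^'n"
  obtains N :: int and x :: "int^'n" where "N > 0" "of_int N *s r = vec_of_int x"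
proof -
  define b where "b i = snd (quotient_of (r $ i))" for i
  define a where "a i = fst (quotient_of (r $ i))" for i
  have b: "b i > 0" "r $ i = of_int (a i) / of_int (b i)" for i
    using quotient_of_denom_pos' quotient_of_div [of "r $ i" "a i" "b i"] by (auto simp: a_def b_def)
  show thesis
  proof (rule that)
    show "(\<Prod>i\<in>UNIV. b i) > 0" by (intro prod_pos) (auto simp: b)
    have "of_int (\<Prod>j\<in>UNIV. b j) * r $ i = of_int (a i * (\<Prod>j\<in>UNIV - {i}. b j))" for i
      using b(1) [of i] by (subst prod.remove [of UNIV i]) (simp_all add: b(2))
    then show "of_int (\<Prod>i\<in>UNIV. b i) *s r = vec_of_int (\<chi> i. a i * (\<Prod>j\<in>UNIV - {i}. b j))"
      by (simp add: vec_eq_iff vec_of_int_def)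
  qed
qed

locale unimodular_lattice =
  fixes \<beta> :: "int^'n \<Rightarrow> int^'n \<Rightarrow> int"
  assumes integral: "integral_lattice \<beta>" and posdef: "positive_definite \<beta>" and unimod: "unimodular \<beta>"
begin

lemma bil_commute: "bil \<beta> x y = bil \<beta> y x"
proof -
  have "\<beta> (axis i 1) (axis j 1) = \<beta> (axis j 1) (axis i 1)" for i j
    using integral by (auto simp: integral_lattice_def)
  then show ?thesis unfolding bil_def by (subst sum.swap) (simp add: mult_ac)
qed

lemma bil_int: "bil \<beta> (vec_of_int x) (vec_of_int y) = of_int (\<beta> x y)"
  by (rule bil_vec_of_int [OF integral])

lemma quad_add: "quad \<beta> (x + y) = quad \<beta> x + quad \<beta> y + bil \<beta> x y"
  using bil_commute [of y x] by (simp add: quad_def bil_add_left bil_add_right field_simps)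

lemma quad_diff: "quad \<beta> (x - y) = quad \<beta> x + quad \<beta> y - bil \<beta> x y"
  using quad_add [of x "- y"] by (simp add: bil_minus_right)

lemma bil_pos_rat:
  fixes r :: "rat^'n"
  assumes "r \<noteq> 0"
  shows "bil \<beta> r r > 0"
proof -
  obtain N and x :: "int^'n" where N: "N > 0" "of_int N *s r = vec_of_int x"
    by (rule rat_vec_denominator)
  have "x \<noteq> 0"
  proof
    assume "x = 0"
    then have "of_int N *s r = 0" using N(2) by simp
    then show False using N(1) assms by (auto simp: vec_eq_iff)
  qed
  then have "0 < (of_int (\<beta> x x) :: rat)" using posdef by (auto simp: positive_definite_def)
  also have "\<dots> = (of_int N)\<^sup>2 * bil \<beta> r r"
    by (simp add: power2_eq_square bil_scale_left bil_scale_right flip: bil_int N(2))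
  finally show ?thesis using N(1) by (simp add: zero_less_mult_iff)
qed

text \<open>
  A positive definite form over the rationals is nondegenerate, so every functional is represented by a
  vector.
\<close>
lemma solve_rat:
  fixes k :: "rat^'n"
  obtains r :: "rat^'n" where "\<And>j. bil \<beta> r (axis j 1) = k $ j"
proof -
  \<comment> \<open>the Gram map, injective by definiteness\<close>
  define L where "L = (\<lambda>r :: rat^'n. \<chi> j. bil \<beta> r (axis j 1))"
  have lin: "Vector_Spaces.linear (*s) (*s) L"
    by unfold_locales (auto simp: L_def vec_eq_iff bil_add_left bil_scale_left algebra_simps)
  have "inj L"
  proof (rule injI)
    fix r s assume "L r = L s"
    then have "bil \<beta> (r - s) (axis j 1) = 0" for j
      by (simp add: L_def vec_eq_iff bil_diff_left)
    then have "bil \<beta> (r - s) (r - s) = 0" using bil_axis_expand [of \<beta> "r - s" "r - s"] by simp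
    then show "r = s" using bil_pos_rat [of "r - s"] by fastforce
  qed
  then have "surj L" using vec.linear_inj_imp_surj [OF lin] by simp
  then obtain r where "L r = k" by (metis surjE)
  then show thesis by (intro that [of r]) (auto simp: L_def vec_eq_iff)
qed

text \<open>
  The rational vector that represents an integral functional lies in the dual lattice, which is the lattice
  itself.
\<close>
lemma dual_vector:
  fixes k :: "int^'n"
  obtains x :: "int^'n" where "\<And>u :: ('a::comm_ring_1)^'n. bil \<beta> (vec_of_int x) u = (\<Sum>j\<in>UNIV. of_int (k $ j) * u $ j)"
proof -
  obtain r :: "rat^'n" where r: "\<And>j. bil \<beta> r (axis j 1) = vec_of_int k $ j"
    using solve_rat [of "vec_of_int k"] by blast
  have "r \<in> dual_lattice \<beta>"
    unfolding dual_lattice_def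
  proof (intro CollectI allI)
    fix x :: "int^'n"
    have "bil \<beta> r (vec_of_int x) = (\<Sum>j\<in>UNIV. of_int (x $ j) * of_int (k $ j))"
      unfolding bil_axis_expand [of \<beta> r "vec_of_int x"] r by (simp add: vec_of_int_def)
    then show "bil \<beta> r (vec_of_int x) \<in> \<int>" by auto
  qed
  then obtain x where x: "r = vec_of_int x" using unimod by (auto simp: unimodular_def)
  have \<beta>: "\<beta> x (axis j 1) = k $ j" for j
  proof -
    have "(of_int (\<beta> x (axis j 1)) :: rat) = of_int (k $ j)"
    proof -
      have "(of_int (\<beta> x (axis j 1)) :: rat) = bil \<beta> r (axis j 1)"
        by (simp add: x vec_of_int_axis flip: bil_int)
      then show ?thesis using r [of j] by (simp add: vec_of_int_def)
    qed
    then show ?thesis by simp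
  qed
  show thesis
  proof (rule that)
    fix u :: "'a^'n"
    have "bil \<beta> (vec_of_int x) (axis j (1::'a)) = of_int (k $ j)" for j
      using bil_int [of x "axis j 1"] by (simp add: vec_of_int_axis \<beta>)
    then show "bil \<beta> (vec_of_int x) u = (\<Sum>j\<in>UNIV. of_int (k $ j) * u $ j)"
      by (subst bil_axis_expand) (simp add: mult.commute)
  qed
qed

text \<open>
  Approximate \<open>u\<close> by rational vectors. This gives semidefiniteness only; definiteness over the reals will
  follow from the existence of a dual basis.
\<close>
lemma bil_nonneg_real:
  fixes u :: "real^'n"
  shows "bil \<beta> u u \<ge> 0"
proof -
  define w where "w N = (\<chi> i. of_int \<lfloor>real (Suc N) * u $ i\<rfloor> / real (Suc N))" for N
  have "(\<lambda>N. of_int \<lfloor>real (Suc N) * c\<rfloor> / real (Suc N)) \<longlonglongrightarrow> c" for c :: real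
  proof (rule tendsto_sandwich)
    have "c - 1 / real (Suc N) \<le> of_int \<lfloor>real (Suc N) * c\<rfloor> / real (Suc N)" for N
    proof -
      have "real (Suc N) * c - 1 \<le> of_int \<lfloor>real (Suc N) * c\<rfloor>" by linarith
      moreover have "c - 1 / S \<le> y / S" if "S * c - 1 \<le> y" "S > 0" for S y :: real
        using divide_right_mono [OF that(1), of S] that(2) by (simp add: diff_divide_distrib)
      ultimately show ?thesis by simp
    qed
    then show "\<forall>\<^sub>F N in sequentially. c - 1 / real (Suc N) \<le> of_int \<lfloor>real (Suc N) * c\<rfloor> / real (Suc N)"
      by simp
    have "y / S \<le> c" if "y \<le> S * c" "S > 0" for S y :: real
      using that by (simp add: field_simps)
    then show "\<forall>\<^sub>F N in sequentially. of_int \<lfloor>real (Suc N) * c\<rfloor> / real (Suc N) \<le> c"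
      by simp
    show "(\<lambda>N. c - 1 / real (Suc N)) \<longlonglongrightarrow> c"
      using tendsto_diff [OF tendsto_const LIMSEQ_inverse_real_of_nat, of c] by (simp add: inverse_eq_divide)
  qed simp
  then have "w \<longlonglongrightarrow> u" unfolding w_def by (intro vec_tendstoI) simp
  moreover have "isCont (\<lambda>u :: real^'n. bil \<beta> u u) u"
    using continuous_on_bil [of UNIV "\<lambda>u :: real^'n. u" "\<lambda>u. u" \<beta>] by (simp add: continuous_on_eq_continuous_at)
  ultimately have lim: "(\<lambda>N. bil \<beta> (w N) (w N)) \<longlonglongrightarrow> bil \<beta> u u"
    by (rule isCont_tendsto_compose [rotated])
  have "bil \<beta> (w N) (w N) \<ge> 0" for N
  proof -
    define y where "y = (\<chi> i. \<lfloor>real (Suc N) * u $ i\<rfloor>)"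
    have "w N = (1 / real (Suc N)) *s vec_of_int y" by (simp add: w_def y_def vec_of_int_def vec_eq_iff)
    then have "bil \<beta> (w N) (w N) = (1 / real (Suc N))\<^sup>2 * of_int (\<beta> y y)"
      by (simp only: bil_scale_left bil_scale_right bil_int) (simp add: power2_eq_square)
    moreover have "\<beta> y y \<ge> 0"
    proof (cases "y = 0")
      case True
      then have "(of_int (\<beta> y y) :: real) = 0" by (simp flip: bil_int)
      then show ?thesis by simp
    next
      case False
      then show ?thesis using posdef by (auto simp: positive_definite_def intro: less_imp_le)
    qed
    ultimately show ?thesis by simp
  qed
  then show ?thesis using LIMSEQ_le_const [OF lim] by auto
qed

lemma quad_nonneg_real: "quad \<beta> (u :: real^'n) \<ge> 0"
  using bil_nonneg_real by (simp add: quad_def)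

text \<open>
  The coordinates of \<open>u\<close> are the values at \<open>u\<close> of the pairing with lattice vectors; so the
  Cauchy-Schwarz inequality bounds their squares by multiples of \<open>\<beta>(u)\<close>.
\<close>
lemma quad_lower_bound:
  obtains \<delta> where "\<delta> > 0" "\<And>u :: real^'n. \<delta> * (norm u)\<^sup>2 \<le> quad \<beta> u"
proof -
  have "\<exists>f. \<forall>u :: real^'n. bil \<beta> (vec_of_int f) u = u $ i" for i
  proof -
    obtain f :: "int^'n" where f: "\<And>u :: real^'n. bil \<beta> (vec_of_int f) u = (\<Sum>j\<in>UNIV. of_int (axis i 1 $ j) * u $ j)"
      using dual_vector [of "axis i 1", where 'a = real] by blast
    have "(\<Sum>j\<in>UNIV. of_int (axis i 1 $ j) * u $ j) = u $ i" for u :: "real^'n"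
    proof -
      have "(\<Sum>j\<in>UNIV. of_int (axis i 1 $ j) * u $ j) = (\<Sum>j\<in>UNIV. if j = i then u $ i else 0)"
        by (intro sum.cong) (auto simp: axis_def)
      then show ?thesis by simp
    qed
    with f show ?thesis by auto
  qed
  then obtain f where f: "\<And>i. \<And>u :: real^'n. bil \<beta> (vec_of_int (f i)) u = u $ i" by metis
  have CS: "(u $ i)\<^sup>2 \<le> of_int (\<beta> (f i) (f i)) * bil \<beta> u u" and pos: "\<beta> (f i) (f i) > 0" for u :: "real^'n" and i
  proof -
    define p where "p = (of_int (\<beta> (f i) (f i)) :: real)"
    have "f i \<noteq> 0" using f [of i "axis i 1"] by (auto simp: axis_def)
    then show pos: "\<beta> (f i) (f i) > 0" using posdef by (auto simp: positive_definite_def)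
    define a :: "real^'n" where "a = vec_of_int (f i)"
    have a: "bil \<beta> a a = p" "bil \<beta> a u = u $ i" "bil \<beta> u a = u $ i"
      using f [of i u] bil_commute [of u a] by (simp_all add: a_def p_def bil_int)
    \<comment> \<open>the Cauchy-Schwarz inequality from the positivity of \<open>\<beta>\<close> at this vector\<close>
    define w where "w = p *s u - (u $ i) *s a"
    have "0 \<le> bil \<beta> w w" by (rule bil_nonneg_real)
    also have "bil \<beta> w w = p * (p * bil \<beta> u u - (u $ i)\<^sup>2)"
      by (simp add: w_def bil_diff_left bil_diff_right bil_scale_left bil_scale_right a algebra_simps power2_eq_square)
    finally show "(u $ i)\<^sup>2 \<le> of_int (\<beta> (f i) (f i)) * bil \<beta> u u"
      using pos by (simp add: p_def zero_le_mult_iff)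
  qed
  define M where "M = (\<Sum>i\<in>UNIV. (of_int (\<beta> (f i) (f i)) :: real))"
  have M: "M > 0" unfolding M_def using pos by (intro sum_pos) auto
  show thesis
  proof (rule that)
    show "1 / (2 * M) > 0" using M by simp
    fix u :: "real^'n"
    have "(norm u)\<^sup>2 = (\<Sum>i\<in>UNIV. (u $ i)\<^sup>2)"
      unfolding power2_norm_eq_inner inner_vec_def by (simp add: power2_eq_square)
    also have "\<dots> \<le> (\<Sum>i\<in>UNIV. of_int (\<beta> (f i) (f i)) * bil \<beta> u u)"
      by (intro sum_mono CS)
    also have "\<dots> = M * bil \<beta> u u" by (simp add: M_def sum_distrib_right)
    finally show "1 / (2 * M) * (norm u)\<^sup>2 \<le> quad \<beta> u"
      using M by (simp add: quad_def field_simps)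
  qed
qed

text \<open>
  Modulo \<open>\<int>\<close> the form \<open>x \<mapsto> \<beta>(x)\<close> is additive, as \<open>\<beta>(x, y)\<close> is integral; hence a vector with the right
  pairings with the basis has the right pairings with all lattice vectors.
\<close>
lemma shadow_nonempty: "\<exists>r. r \<in> shadow \<beta>"
proof -
  obtain r :: "rat^'n" where r: "\<And>j. bil \<beta> r (axis j 1) = (\<chi> j. of_int (\<beta> (axis j 1) (axis j 1)) / 2) $ j"
    using solve_rat by blast
  have "bil \<beta> r (vec_of_int x) - quad \<beta> (vec_of_int x) \<in> \<int>" for x
  proof (induction x rule: int_vec_subgroup_induct)
    case (2 j)
    have q: "quad \<beta> (vec_of_int (axis j 1)) = (of_int (\<beta> (axis j 1) (axis j 1)) / 2 :: rat)"
      by (simp add: quad_def bil_int)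
    have b: "bil \<beta> r (vec_of_int (axis j 1)) = of_int (\<beta> (axis j 1) (axis j 1)) / 2"
      using r [of j] by (simp only: vec_of_int_axis vec_lambda_beta)
    show ?case by (simp only: q b) simp
  next
    case (3 x y)
    have "bil \<beta> r (vec_of_int (x + y)) - quad \<beta> (vec_of_int (x + y)) =
       (bil \<beta> r (vec_of_int x) - quad \<beta> (vec_of_int x)) + (bil \<beta> r (vec_of_int y) - quad \<beta> (vec_of_int y))
        - of_int (\<beta> x y)"
      by (simp add: vec_of_int_add bil_add_right quad_add bil_int)
    then show ?case using 3 by auto
  next
    case (4 x)
    have "bil \<beta> r (vec_of_int (- x)) - quad \<beta> (vec_of_int (- x)) =
       - (bil \<beta> r (vec_of_int x) - quad \<beta> (vec_of_int x)) - of_int (\<beta> x x)"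
      by (simp add: vec_of_int_minus bil_minus_right quad_def bil_minus_left bil_int)
    then show ?case using 4 by (metis Ints_diff Ints_minus Ints_of_int)
  qed auto
  then show ?thesis by (auto simp: shadow_def)
qed

definition r0 :: "rat^'n" where "r0 = (SOME r. r \<in> shadow \<beta>)"

lemma r0_shadow: "r0 \<in> shadow \<beta>"
  unfolding r0_def using shadow_nonempty by (rule someI_ex)

text \<open>
  Differences of elements of the shadow pair integrally with the lattice, and so lie in it.
\<close>
lemma shadow_eq: "shadow \<beta> = range (\<lambda>x. r0 + vec_of_int x)"
proof (intro equalityI subsetI)
  fix r assume r: "r \<in> shadow \<beta>"
  have "r - r0 \<in> dual_lattice \<beta>"
    unfolding dual_lattice_def
  proof (intro CollectI allI)
    fix x
    have "bil \<beta> (r - r0) (vec_of_int x) = (bil \<beta> r (vec_of_int x) - quad \<beta> (vec_of_int x))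
       - (bil \<beta> r0 (vec_of_int x) - quad \<beta> (vec_of_int x))"
      by (simp add: bil_diff_left)
    then show "bil \<beta> (r - r0) (vec_of_int x) \<in> \<int>"
      using r r0_shadow unfolding shadow_def by (metis (lifting) Ints_diff mem_Collect_eq)
  qed
  then obtain x where "r - r0 = vec_of_int x" using unimod by (auto simp: unimodular_def)
  then have "r = r0 + vec_of_int x" by (simp add: algebra_simps)
  then show "r \<in> range (\<lambda>x. r0 + vec_of_int x)" by blast
next
  fix r assume "r \<in> range (\<lambda>x. r0 + vec_of_int x)"
  then obtain y where r: "r = r0 + vec_of_int y" by blast
  have r0x: "bil \<beta> r0 (vec_of_int x) - quad \<beta> (vec_of_int x) \<in> \<int>" for x
    using r0_shadow by (auto simp: shadow_def)
  have eq: "bil \<beta> r (vec_of_int x) - quad \<beta> (vec_of_int x) =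
    (bil \<beta> r0 (vec_of_int x) - quad \<beta> (vec_of_int x)) + of_int (\<beta> y x)" for x
    by (simp add: r bil_add_left bil_int)
  show "r \<in> shadow \<beta>"
    unfolding shadow_def by (intro CollectI allI) (simp only: eq Ints_add r0x Ints_of_int)
qed

lemma inj_shadow: "inj (\<lambda>x. r0 + (vec_of_int x :: rat^'n))"
  using inj_vec_of_int [where 'a = rat] by (auto simp: inj_def)

definition \<rho> :: "complex^'n" where "\<rho> = vec_of_rat r0"

text \<open>
  The character \<open>x \<mapsto> (-1)\<^sup>\<beta>\<^sup>(\<^sup>x\<^sup>,\<^sup>x\<^sup>)\<close> of the lattice.
\<close>
definition sgn_lat :: "int^'n \<Rightarrow> complex" where "sgn_lat x = ee (quad \<beta> (vec_of_int x))"

lemma sgn_lat_sq [simp]: "sgn_lat x * sgn_lat x = 1"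
  unfolding sgn_lat_def ee_add [symmetric] by (rule ee_Ints) (simp add: quad_def bil_int)

lemma sgn_lat_nonzero [simp]: "sgn_lat x \<noteq> 0"
  by (simp add: sgn_lat_def)

lemma norm_sgn_lat [simp]: "norm (sgn_lat x) = 1"
proof -
  have "quad \<beta> (vec_of_int x) = complex_of_real (of_int (\<beta> x x) / 2)" by (simp add: quad_def bil_int)
  then show ?thesis by (simp only: sgn_lat_def norm_ee) simp
qed

lemma sgn_lat_0 [simp]: "sgn_lat 0 = 1"
  by (simp add: sgn_lat_def)

lemma sgn_lat_add: "sgn_lat (x + y) = sgn_lat x * sgn_lat y"
  unfolding sgn_lat_def ee_add [symmetric] by (rule ee_eqI) (simp add: vec_of_int_add quad_add bil_int)

lemma bil_rho: "bil \<beta> \<rho> (vec_of_int x) - quad \<beta> (vec_of_int x) \<in> \<int>"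
proof -
  have "bil \<beta> r0 (vec_of_int x) - quad \<beta> (vec_of_int x) \<in> \<int>"
    using r0_shadow by (auto simp: shadow_def)
  then obtain n where "bil \<beta> r0 (vec_of_int x) - quad \<beta> (vec_of_int x) = of_int n" by (elim Ints_cases)
  then have "of_rat (bil \<beta> r0 (vec_of_int x)) - of_rat (quad \<beta> (vec_of_int x)) = (of_int n :: complex)"
    by (simp flip: of_rat_diff)
  then have "bil \<beta> \<rho> (vec_of_rat (vec_of_int x)) - quad \<beta> (vec_of_rat (vec_of_int x)) = of_int n"
    by (simp only: \<rho>_def bil_vec_of_rat quad_vec_of_rat)
  then show ?thesis by simp
qed

lemma ee_bil_rho: "ee (bil \<beta> (\<rho> + vec_of_int y) (vec_of_int x)) = sgn_lat x"
  unfolding sgn_lat_def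
proof (rule ee_eqI)
  have "bil \<beta> (\<rho> + vec_of_int y) (vec_of_int x) - quad \<beta> (vec_of_int x)
      = (bil \<beta> \<rho> (vec_of_int x) - quad \<beta> (vec_of_int x)) + of_int (\<beta> y x)"
    by (simp add: bil_add_left bil_int)
  then show "bil \<beta> (\<rho> + vec_of_int y) (vec_of_int x) - quad \<beta> (vec_of_int x) \<in> \<int>"
    using bil_rho [of x] by (simp only: Ints_add Ints_of_int)
qed

text \<open>
  The multiplier of theta under \<open>\<tau> \<mapsto> \<tau> + 1\<close>.
\<close>
definition tc :: complex where "tc = ee (quad \<beta> \<rho>)"

text \<open>
  All vectors \<open>r\<close> of the shadow have the same value \<open>\<beta>(r)\<close> modulo 1.
\<close>
lemma ee_quad_rho: "ee (quad \<beta> (\<rho> + vec_of_int x)) = tc"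
  using ee_bil_rho [of 0 x] sgn_lat_sq [of x] by (simp add: quad_add ee_add tc_def sgn_lat_def)

lemma tc_nonzero [simp]: "tc \<noteq> 0"
  by (simp add: tc_def)

lemma quad_rho_real: "\<exists>c :: real. quad \<beta> (\<rho> + vec_of_int x) = of_real c"
proof -
  have "\<rho> + vec_of_int x = cvec (vec_of_rat r0 + vec_of_int x)"
    by (simp add: \<rho>_def cvec_def vec_of_rat_def vec_of_int_def vec_eq_iff of_rat_eq_of_real)
  then show ?thesis by (auto simp: quad_cvec)
qed

lemma norm_tc: "norm tc = 1"
  using quad_rho_real [of 0] by (auto simp: tc_def norm_ee)

text \<open>
  A generator of the one-dimensional space \<open>W\<close>, normalized at the chosen base point of the shadow.
\<close>
definition char_fun :: "rat^'n \<Rightarrow> complex" where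
  "char_fun r = (if r \<in> shadow \<beta> then ee (quad \<beta> (vec_of_rat (r - r0))) else 0)"

lemma char_fun_shift: "char_fun (r0 + vec_of_int x) = sgn_lat x"
  by (auto simp: char_fun_def shadow_eq sgn_lat_def)

lemma W_spaceD:
  assumes "l \<in> W_space \<beta>"
  shows "l = (\<lambda>r. l r0 * char_fun r)"
proof
  fix r show "l r = l r0 * char_fun r"
  proof (cases "r \<in> shadow \<beta>")
    case True
    then obtain x where r: "r = r0 + vec_of_int x" by (auto simp: shadow_eq)
    have "l (r0 + vec_of_int x) = ee (quad \<beta> (vec_of_int x)) * l r0"
      using assms r0_shadow by (simp add: W_space_def)
    then show ?thesis unfolding r char_fun_shift by (simp add: sgn_lat_def)
  qed (use assms in \<open>simp_all add: W_space_def char_fun_def\<close>)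
qed

lemma char_fun_W_space: "char_fun \<in> W_space \<beta>"
  unfolding W_space_def
proof (intro CollectI conjI allI ballI impI)
  fix r x assume "r \<in> shadow \<beta>"
  then obtain y where r: "r = r0 + vec_of_int y" by (auto simp: shadow_eq)
  have "char_fun (r + vec_of_int x) = sgn_lat (y + x)"
    using char_fun_shift [of "y + x"] by (simp add: r vec_of_int_add add.assoc)
  then show "char_fun (r + vec_of_int x) = ee (quad \<beta> (vec_of_int x)) * char_fun r"
    unfolding r char_fun_shift sgn_lat_add by (simp add: sgn_lat_def mult.commute)
qed (simp add: char_fun_def)

lemma dim_W_space: "fun_space.dim (W_space \<beta>) = 1"
proof -
  have nz: "char_fun \<noteq> 0"
    using char_fun_shift [of 0] by (auto simp: fun_eq_iff intro!: exI [of _ r0])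
  have "W_space \<beta> \<subseteq> fun_space.span {char_fun}"
    using W_spaceD by (auto simp: fun_space.span_singleton)
  moreover have "fun_space.independent {char_fun}"
    using nz by (simp add: fun_space.dependent_single)
  ultimately show ?thesis
    using fun_space.dim_unique [of "{char_fun}" "W_space \<beta>" 1] char_fun_W_space by simp
qed

end

section \<open>Sums of Gaussians over the lattice\<close>

lemma gauss_int_bounded:
  fixes \<epsilon> :: real
  assumes "\<epsilon> > 0"
  obtains B where "\<And>N::nat. (\<Sum>k\<in>{- int N..int N}. exp (- \<epsilon> * (of_int k)\<^sup>2)) \<le> B"
proof
  fix N :: nat
  define r where "r = exp (- \<epsilon>)"
  have r: "0 < r" "r < 1" using assms by (auto simp: r_def)
  let ?g = "\<lambda>k::int. exp (- \<epsilon> * (of_int k)\<^sup>2)"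
  have half: "(\<Sum>k\<le>N. ?g (int k)) \<le> 1 / (1 - r)"
  proof -
    have "?g (int k) \<le> r ^ k" for k
    proof -
      have "real k \<le> (real k)\<^sup>2" by (cases k) (auto simp: power2_eq_square)
      then have "?g (int k) \<le> exp (real k * (- \<epsilon>))" using assms by simp
      then show ?thesis by (simp add: r_def exp_of_nat_mult [symmetric] mult.commute)
    qed
    then have "(\<Sum>k\<le>N. ?g (int k)) \<le> (\<Sum>k\<le>N. r ^ k)" by (rule sum_mono)
    also have "\<dots> \<le> (\<Sum>k. r ^ k)"
      using r by (intro sum_le_suminf summable_geometric) auto
    also have "\<dots> = 1 / (1 - r)" using r by (intro suminf_geometric) auto
    finally show ?thesis .
  qed
  have "{- int N..int N} \<subseteq> int ` {..N} \<union> (\<lambda>k. - int k) ` {..N}"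
  proof
    fix k assume "k \<in> {- int N..int N}"
    then show "k \<in> int ` {..N} \<union> (\<lambda>k. - int k) ` {..N}"
      by (cases k rule: int_cases2) auto
  qed
  then have "(\<Sum>k\<in>{- int N..int N}. ?g k) \<le> (\<Sum>k\<in>int ` {..N} \<union> (\<lambda>k. - int k) ` {..N}. ?g k)"
    by (intro sum_mono2) auto
  also have "\<dots> \<le> (\<Sum>k\<in>int ` {..N}. ?g k) + (\<Sum>k\<in>(\<lambda>k. - int k) ` {..N}. ?g k)"
    by (subst sum.union_inter [symmetric]) (auto intro!: sum_nonneg)
  also have "\<dots> = 2 * (\<Sum>k\<le>N. ?g (int k))"
    by (subst (1 2) sum.reindex) (auto simp: inj_on_def)
  finally show "(\<Sum>k\<in>{- int N..int N}. ?g k) \<le> 2 * (1 / (1 - r))"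
    using half by linarith
qed

lemma norm_rvec_sq: "(norm (rvec x))\<^sup>2 = (\<Sum>i\<in>UNIV. (of_int (x $ i))\<^sup>2)"
  unfolding power2_norm_eq_inner inner_vec_def by (simp add: power2_eq_square vec_of_int_def)

text \<open>
  On a box the sum factors into one-dimensional sums, which are bounded uniformly.
\<close>
lemma gauss_lattice_summable:
  fixes \<epsilon> :: real
  assumes "\<epsilon> > 0"
  shows "(\<lambda>x :: int^'n. exp (- \<epsilon> * (norm (rvec x))\<^sup>2)) summable_on UNIV"
proof -
  let ?g = "\<lambda>k::int. exp (- \<epsilon> * (of_int k)\<^sup>2)"
  obtain B where B: "\<And>N::nat. (\<Sum>k\<in>{- int N..int N}. ?g k) \<le> B"
    using gauss_int_bounded [OF assms] by blast
  have prod: "exp (- \<epsilon> * (norm (rvec x))\<^sup>2) = (\<Prod>i\<in>UNIV. ?g (x $ i))" for x :: "int^'n"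
    unfolding norm_rvec_sq sum_distrib_left by (rule exp_sum) simp
  have "sum (\<lambda>x :: int^'n. exp (- \<epsilon> * (norm (rvec x))\<^sup>2)) F \<le> B ^ CARD('n)" if "finite F" for F
  proof -
    have "finite ((\<lambda>(x, i). nat \<bar>x $ i\<bar>) ` (F \<times> UNIV))" using that by simp
    then obtain N where N: "\<And>x i. x \<in> F \<Longrightarrow> nat \<bar>x $ i\<bar> \<le> N"
      unfolding finite_nat_set_iff_bounded_le by (auto simp: Ball_def)
    define P where "P = PiE (UNIV :: 'n set) (\<lambda>_. {- int N..int N})"
    have "F \<subseteq> vec_lambda ` P"
    proof
      fix x assume x: "x \<in> F"
      have "x $ i \<in> {- int N..int N}" for i using N [OF x, of i] by auto
      then have "vec_nth x \<in> P" by (auto simp: P_def PiE_def)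
      then show "x \<in> vec_lambda ` P" by (metis imageI vec_nth_inverse)
    qed
    moreover have "finite P" unfolding P_def by (intro finite_PiE) auto
    ultimately have "(\<Sum>x\<in>F. \<Prod>i\<in>UNIV. ?g (x $ i)) \<le> (\<Sum>x\<in>vec_lambda ` P. \<Prod>i\<in>UNIV. ?g (x $ i))"
      by (intro sum_mono2) (auto intro: prod_nonneg)
    also have "\<dots> = (\<Sum>f\<in>P. \<Prod>i\<in>UNIV. ?g (f i))"
      by (subst sum.reindex) (auto simp: inj_on_def)
    also have "\<dots> = (\<Prod>i\<in>(UNIV :: 'n set). \<Sum>k\<in>{- int N..int N}. ?g k)"
      unfolding P_def by (rule prod_sum_PiE [symmetric]) auto
    also have "\<dots> \<le> (\<Prod>i\<in>(UNIV :: 'n set). B)"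
      by (intro prod_mono conjI sum_nonneg B) auto
    finally show ?thesis unfolding prod by simp
  qed
  then show ?thesis
    by (intro nonneg_bdd_above_summable_on bdd_aboveI [of _ "B ^ CARD('n)"]) auto
qed

lemma norm_summable_enum_has_sum:
  fixes f :: "int^'n \<Rightarrow> complex"
  assumes "summable (\<lambda>k. norm (f (int_vec_enum k)))"
  shows "(f has_sum (\<Sum>k. f (int_vec_enum k))) UNIV"
proof -
  have "((\<lambda>k. f (int_vec_enum k)) has_sum (\<Sum>k. f (int_vec_enum k))) UNIV"
    by (rule norm_summable_imp_has_sum [OF assms summable_sums [OF summable_norm_cancel [OF assms]]])
  then show ?thesis
    using has_sum_reindex_bij_betw [OF bij_int_vec_enum, of f] by simp
qed

lemma summable_on_dominated:
  fixes f :: "int^'n \<Rightarrow> complex"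
  assumes "g summable_on UNIV" "\<And>x. norm (f x) \<le> g x"
  shows "f summable_on UNIV"
  using summable_on_comparison_test [of g UNIV "\<lambda>x. norm (f x)"] assms
  by (simp add: summable_on_iff_abs_summable_on_complex)

lemma linear_exp_bound:
  fixes c y :: real
  assumes "c > 0" "y \<ge> 0"
  shows "y * exp (- c * y) \<le> 1 / c"
proof -
  have "c * y \<le> exp (c * y)" using exp_ge_add_one_self [of "c * y"] by linarith
  then show ?thesis using assms by (simp add: exp_minus field_simps)
qed

text \<open>
  A form of the parallelogram law, used to compare a Gaussian at the shifted lattice with one at the
  lattice.
\<close>
lemma norm_sq_translate:
  fixes a x :: "'a::real_inner"
  shows "(norm (a + x))\<^sup>2 \<ge> (norm x)\<^sup>2 / 2 - (norm a)\<^sup>2"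
proof -
  have "(norm x)\<^sup>2 + (norm (x + 2 *\<^sub>R a))\<^sup>2 = 2 * (norm (a + x))\<^sup>2 + 2 * (norm a)\<^sup>2"
    by (simp add: power2_norm_eq_inner algebra_simps inner_commute)
  moreover have "0 \<le> (norm (x + 2 *\<^sub>R a))\<^sup>2" by simp
  ultimately show ?thesis by linarith
qed

section \<open>Theta functions\<close>

context unimodular_lattice begin

text \<open>
  The element of the shadow with lattice coordinate \<open>x\<close>, as a real vector.
\<close>
definition sv :: "int^'n \<Rightarrow> real^'n" where "sv x = vec_of_rat r0 + vec_of_int x"

lemma cvec_sv: "cvec (sv x) = \<rho> + vec_of_int x"
  by (simp add: sv_def \<rho>_def cvec_def vec_of_rat_def vec_of_int_def vec_eq_iff of_rat_eq_of_real)

lemma sv_add: "sv (x + y) = sv x + vec_of_int y"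
  by (simp add: sv_def vec_of_int_add)

definition thterm :: "int^'n \<Rightarrow> complex \<Rightarrow> complex^'n \<Rightarrow> complex" where
  "thterm x \<tau> z = sgn_lat x * ee (quad \<beta> (cvec (sv x)) * \<tau> + bil \<beta> (cvec (sv x)) z)"

text \<open>
  The theta function of the generator of \<open>W\<close>, as a sum over the lattice instead of the shadow.
\<close>
definition th :: "complex \<Rightarrow> complex^'n \<Rightarrow> complex" where
  "th \<tau> z = (\<Sum>\<^sub>\<infinity>x\<in>UNIV. thterm x \<tau> z)"

definition bil_bound :: real where
  "bil_bound = (\<Sum>i\<in>UNIV. \<Sum>j\<in>UNIV. \<bar>of_int (\<beta> (axis i 1) (axis j 1))\<bar>)"

lemma bil_bound_nonneg: "0 \<le> bil_bound"
  unfolding bil_bound_def by (intro sum_nonneg) auto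

lemma norm_bil_le:
  fixes u v :: "('a::real_normed_field)^'n"
  shows "norm (bil \<beta> u v) \<le> bil_bound * norm u * norm v"
proof -
  have "norm (bil \<beta> u v) \<le> (\<Sum>i\<in>UNIV. \<Sum>j\<in>UNIV. norm (u $ i * v $ j * of_int (\<beta> (axis i 1) (axis j 1))))"
    unfolding bil_def by (intro order_trans [OF norm_sum] sum_mono) auto
  also have "\<dots> \<le> (\<Sum>i\<in>UNIV. \<Sum>j\<in>UNIV. norm u * norm v * \<bar>of_int (\<beta> (axis i 1) (axis j 1))\<bar>)"
  proof (intro sum_mono)
    fix i j
    have "norm (u $ i) * norm (v $ j) \<le> norm u * norm v"
      using Finite_Cartesian_Product.norm_nth_le [of u i] Finite_Cartesian_Product.norm_nth_le [of v j]
      by (intro mult_mono) auto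
    then show "norm (u $ i * v $ j * of_int (\<beta> (axis i 1) (axis j 1))) \<le> norm u * norm v * \<bar>of_int (\<beta> (axis i 1) (axis j 1))\<bar>"
      unfolding norm_mult norm_of_int by (rule mult_right_mono) simp
  qed
  finally show ?thesis by (simp add: bil_bound_def sum_distrib_left mult_ac)
qed

lemma Im_bil_cvec: "Im (bil \<beta> (cvec u) (z :: complex^'n)) = bil \<beta> u (\<chi> i. Im (z $ i))"
  by (simp add: bil_def cvec_def Im_sum)

lemma norm_Im_vec: "norm (\<chi> i. Im ((z :: complex^'n) $ i)) \<le> norm z"
  by (rule norm_le_componentwise_cart) (simp add: abs_Im_le_cmod)

lemma norm_thterm:
  "norm (thterm x \<tau> z) = exp (- (2 * pi * (quad \<beta> (sv x) * Im \<tau> + bil \<beta> (sv x) (\<chi> i. Im (z $ i)))))"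
  by (simp add: thterm_def norm_mult norm_ee quad_cvec Im_bil_cvec)

text \<open>
  Locally uniformly in \<open>(\<tau>, z)\<close> a Gaussian over the lattice dominates the terms, even after the
  multiplication with the factors that come from differentiation.
\<close>
lemma thterm_bound:
  assumes "v0 > 0" "R \<ge> 0"
  shows "\<exists>\<epsilon>>0. \<exists>M\<ge>0. \<forall>x \<tau> z. Im \<tau> \<ge> v0 \<longrightarrow> norm z \<le> R \<longrightarrow>
       (1 + norm (quad \<beta> (sv x)) + norm (sv x)) * norm (thterm x \<tau> z) \<le> M * exp (- \<epsilon> * (norm (rvec x))\<^sup>2)"
proof -
  obtain \<delta> where \<delta>: "\<delta> > 0" "\<And>u :: real^'n. \<delta> * (norm u)\<^sup>2 \<le> quad \<beta> u" by (rule quad_lower_bound) blast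
  define c where "c = pi * \<delta> * v0"
  have c: "c > 0" using \<delta> assms by (simp add: c_def)
  define K where "K = bil_bound"
  have K: "K \<ge> 0" by (simp add: K_def bil_bound_nonneg)
  define A where "A = pi * K\<^sup>2 * R\<^sup>2 / (\<delta> * v0)"
  define L where "L = (2 + K) * (1 + 4 / c)"
  define a where "a = (vec_of_rat r0 :: real^'n)"
  have L: "L \<ge> 0" using K c by (simp add: L_def)
  have "c / 4 > 0 \<and> L * exp A * exp (c / 2 * (norm a)\<^sup>2) \<ge> 0 \<and> (\<forall>x \<tau> z. Im \<tau> \<ge> v0 \<longrightarrow> norm z \<le> R \<longrightarrow>
       (1 + norm (quad \<beta> (sv x)) + norm (sv x)) * norm (thterm x \<tau> z) \<le>
         L * exp A * exp (c / 2 * (norm a)\<^sup>2) * exp (- (c / 4) * (norm (rvec x))\<^sup>2))"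
  proof (intro conjI allI impI)
    show "c / 4 > 0" using c by simp
    show "L * exp A * exp (c / 2 * (norm a)\<^sup>2) \<ge> 0" using L by simp
    fix x \<tau> and z :: "complex^'n" assume \<tau>: "Im \<tau> \<ge> v0" and z: "norm z \<le> R"
    define y where "y = norm (sv x)"
    have y0: "y \<ge> 0" by (simp add: y_def)
    have "\<bar>bil \<beta> (sv x) (\<chi> i. Im (z $ i))\<bar> \<le> K * y * R"
    proof -
      have "norm (bil \<beta> (sv x) (\<chi> i. Im (z $ i))) \<le> K * y * norm (\<chi> i. Im (z $ i))"
        unfolding K_def y_def by (rule norm_bil_le)
      also have "\<dots> \<le> K * y * R"
        using norm_Im_vec [of z] z K y0 by (intro mult_left_mono) auto
      finally show ?thesis by simp
    qed
    moreover have "\<delta> * y\<^sup>2 * v0 \<le> quad \<beta> (sv x) * Im \<tau>"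
      using \<delta> \<tau> assms by (intro mult_mono) (auto simp: y_def quad_nonneg_real)
    ultimately have "- (quad \<beta> (sv x) * Im \<tau> + bil \<beta> (sv x) (\<chi> i. Im (z $ i))) \<le> K * y * R - \<delta> * y\<^sup>2 * v0"
      by linarith
    then have "2 * pi * - (quad \<beta> (sv x) * Im \<tau> + bil \<beta> (sv x) (\<chi> i. Im (z $ i))) \<le> 2 * pi * (K * y * R - \<delta> * y\<^sup>2 * v0)"
      by (intro mult_left_mono) auto
    also have "\<dots> \<le> A - c * y\<^sup>2"
    proof -
      have "0 \<le> (K * R - \<delta> * v0 * y)\<^sup>2 * (pi / (\<delta> * v0))"
        using \<delta> assms by (intro mult_nonneg_nonneg) auto
      also have "\<dots> = A - c * y\<^sup>2 - 2 * pi * (K * y * R - \<delta> * y\<^sup>2 * v0)"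
        using \<delta>(1) assms(1) by (simp add: A_def c_def power2_eq_square field_simps)
      finally show ?thesis by simp
    qed
    finally have t: "norm (thterm x \<tau> z) \<le> exp (A - c * y\<^sup>2)"
      unfolding norm_thterm by (simp add: algebra_simps)
    have q: "norm (quad \<beta> (sv x)) \<le> K * y\<^sup>2"
      using norm_bil_le [of "sv x" "sv x"] K by (simp add: quad_def K_def y_def power2_eq_square)
    have "1 + norm (quad \<beta> (sv x)) + y \<le> (2 + K) * (1 + y\<^sup>2)"
    proof -
      have "2 * y \<le> 1 + y\<^sup>2" using sum_squares_ge_zero [of "y - 1" 0] by (simp add: power2_eq_square algebra_simps)
      then have "y \<le> 1 + y\<^sup>2" using y0 by linarith
      moreover have "0 \<le> K * 1 + y\<^sup>2" using K by simp
      ultimately show ?thesis using q by (simp add: algebra_simps)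
    qed
    moreover have "(1 + y\<^sup>2) * exp (- c * y\<^sup>2) \<le> (1 + 4 / c) * exp (- (c / 2) * y\<^sup>2)"
    proof -
      have "y\<^sup>2 * exp (- (c / 2) * y\<^sup>2) \<le> 1 / (c / 2)"
        using c by (intro linear_exp_bound) auto
      moreover have "exp (- (c / 2) * y\<^sup>2) \<le> 1" using c by simp
      moreover have "1 + 1 / (c / 2) \<le> 1 + 4 / c" using c by (simp add: field_simps)
      ultimately have "(1 + y\<^sup>2) * exp (- (c / 2) * y\<^sup>2) \<le> 1 + 4 / c"
        unfolding distrib_right by linarith
      then have "(1 + y\<^sup>2) * exp (- (c / 2) * y\<^sup>2) * exp (- (c / 2) * y\<^sup>2) \<le> (1 + 4 / c) * exp (- (c / 2) * y\<^sup>2)"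
        by (rule mult_right_mono) simp
      moreover have "exp (- c * y\<^sup>2) = exp (- (c / 2) * y\<^sup>2) * exp (- (c / 2) * y\<^sup>2)"
        by (simp flip: exp_add)
      ultimately show ?thesis by simp
    qed
    ultimately have "(1 + norm (quad \<beta> (sv x)) + y) * exp (- c * y\<^sup>2) \<le> L * exp (- (c / 2) * y\<^sup>2)"
    proof -
      assume 1: "1 + norm (quad \<beta> (sv x)) + y \<le> (2 + K) * (1 + y\<^sup>2)"
        and 2: "(1 + y\<^sup>2) * exp (- c * y\<^sup>2) \<le> (1 + 4 / c) * exp (- (c / 2) * y\<^sup>2)"
      have "(1 + norm (quad \<beta> (sv x)) + y) * exp (- c * y\<^sup>2) \<le> (2 + K) * (1 + y\<^sup>2) * exp (- c * y\<^sup>2)"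
        by (rule mult_right_mono [OF 1]) simp
      also have "\<dots> = (2 + K) * ((1 + y\<^sup>2) * exp (- c * y\<^sup>2))" by (rule mult.assoc)
      also have "\<dots> \<le> (2 + K) * ((1 + 4 / c) * exp (- (c / 2) * y\<^sup>2))"
        by (rule mult_left_mono [OF 2]) (use K in simp)
      finally show ?thesis by (simp only: L_def mult.assoc)
    qed
    also have "exp (- (c / 2) * y\<^sup>2) \<le> exp (c / 2 * (norm a)\<^sup>2) * exp (- (c / 4) * (norm (rvec x))\<^sup>2)"
    proof -
      have "(norm (rvec x))\<^sup>2 / 2 - (norm a)\<^sup>2 \<le> y\<^sup>2"
        unfolding y_def sv_def a_def by (rule norm_sq_translate)
      then have "c / 2 * ((norm (rvec x))\<^sup>2 / 2 - (norm a)\<^sup>2) \<le> c / 2 * y\<^sup>2"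
        using c by (intro mult_left_mono) auto
      then show ?thesis by (simp add: algebra_simps flip: exp_add)
    qed
    finally have "(1 + norm (quad \<beta> (sv x)) + y) * exp (- c * y\<^sup>2) \<le> L * (exp (c / 2 * (norm a)\<^sup>2) * exp (- (c / 4) * (norm (rvec x))\<^sup>2))"
      using L by (simp add: mult_left_mono)
    then have "exp A * ((1 + norm (quad \<beta> (sv x)) + y) * exp (- c * y\<^sup>2)) \<le> exp A * (L * (exp (c / 2 * (norm a)\<^sup>2) * exp (- (c / 4) * (norm (rvec x))\<^sup>2)))"
      by (rule mult_left_mono) simp
    moreover have "(1 + norm (quad \<beta> (sv x)) + y) * norm (thterm x \<tau> z) \<le> (1 + norm (quad \<beta> (sv x)) + y) * (exp A * exp (- c * y\<^sup>2))"
      using t y0 by (intro mult_left_mono) (auto simp: exp_diff exp_minus divide_inverse)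
    ultimately show "(1 + norm (quad \<beta> (sv x)) + norm (sv x)) * norm (thterm x \<tau> z) \<le>
        L * exp A * exp (c / 2 * (norm a)\<^sup>2) * exp (- (c / 4) * (norm (rvec x))\<^sup>2)"
      unfolding y_def [symmetric] by (simp only: mult_ac)
  qed
  then show ?thesis by blast
qed

lemma thterm_summable:
  assumes "\<tau> \<in> upper_half_plane"
  shows "(\<lambda>x. thterm x \<tau> z) summable_on UNIV"
proof -
  have v: "Im \<tau> > 0" using assms by (simp add: upper_half_plane_def)
  obtain M \<epsilon> where M: "\<epsilon> > 0" "\<forall>x \<tau>' z'. Im \<tau>' \<ge> Im \<tau> \<longrightarrow> norm z' \<le> norm z \<longrightarrow> (1 + norm (quad \<beta> (sv x)) + norm (sv x)) * norm (thterm x \<tau>' z') \<le> M * exp (- \<epsilon> * (norm (rvec x))\<^sup>2)"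
    using thterm_bound [OF v norm_ge_zero [of z]] by blast
  show ?thesis
  proof (rule summable_on_dominated)
    show "(\<lambda>x. M * exp (- \<epsilon> * (norm (rvec x :: real^'n))\<^sup>2)) summable_on UNIV"
      by (intro summable_on_cmult_right gauss_lattice_summable M)
    show "norm (thterm x \<tau> z) \<le> M * exp (- \<epsilon> * (norm (rvec x))\<^sup>2)" for x
    proof -
      have "1 * norm (thterm x \<tau> z) \<le> (1 + norm (quad \<beta> (sv x)) + norm (sv x)) * norm (thterm x \<tau> z)"
        by (rule mult_right_mono) auto
      then show ?thesis using M(2) [rule_format, of \<tau> z x] by simp
    qed
  qed
qed

lemma th_has_sum:
  assumes "\<tau> \<in> upper_half_plane"
  shows "((\<lambda>x. thterm x \<tau> z) has_sum th \<tau> z) UNIV"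
  unfolding th_def using thterm_summable [OF assms] by (rule has_sum_infsum)

lemma theta_eq_th:
  assumes "l \<in> W_space \<beta>" "\<tau> \<in> upper_half_plane"
  shows "theta \<beta> l (\<tau>, z) = l r0 * th \<tau> z"
proof -
  have "theta \<beta> l (\<tau>, z) = (\<Sum>\<^sub>\<infinity>r\<in>shadow \<beta>. l r * ee (of_rat (quad \<beta> r) * \<tau>) * ee (bil \<beta> (vec_of_rat r) z))"
    using assms by (simp add: theta_def)
  also have "\<dots> = (\<Sum>\<^sub>\<infinity>x\<in>UNIV. l (r0 + vec_of_int x) * ee (of_rat (quad \<beta> (r0 + vec_of_int x)) * \<tau>) * ee (bil \<beta> (vec_of_rat (r0 + vec_of_int x)) z))"
    unfolding shadow_eq by (subst infsum_reindex [OF inj_shadow]) (simp add: o_def)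
  also have "\<dots> = (\<Sum>\<^sub>\<infinity>x\<in>UNIV. l r0 * thterm x \<tau> z)"
  proof (rule infsum_cong)
    fix x
    have "vec_of_rat (r0 + vec_of_int x) = cvec (sv x)"
      by (simp add: cvec_sv \<rho>_def vec_of_rat_add)
    moreover have "of_rat (quad \<beta> (r0 + vec_of_int x)) = quad \<beta> (cvec (sv x))"
      using calculation by (simp flip: quad_vec_of_rat)
    moreover have "l (r0 + vec_of_int x) = l r0 * sgn_lat x"
      using W_spaceD [OF assms(1)] char_fun_shift by metis
    ultimately show "l (r0 + vec_of_int x) * ee (of_rat (quad \<beta> (r0 + vec_of_int x)) * \<tau>) * ee (bil \<beta> (vec_of_rat (r0 + vec_of_int x)) z) = l r0 * thterm x \<tau> z"
      by (simp add: thterm_def ee_add mult_ac)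
  qed
  also have "\<dots> = l r0 * th \<tau> z"
    unfolding th_def by (rule infsum_cmult_right) (use thterm_summable [OF assms(2)] in auto)
  finally show ?thesis .
qed

text \<open>
  The series of derivatives converges locally uniformly by the Gaussian bound, so the series can be
  differentiated termwise, jointly in both variables. The derivative is kept as a series since the one for
  the lattice \<open>\<int>\<close> is evaluated later.
\<close>
lemma th_has_derivative:
  assumes "\<tau> \<in> upper_half_plane"
  obtains D where "((\<lambda>p. th (fst p) (snd p)) has_derivative D) (at (\<tau>, z))"
    "\<And>h. ((\<lambda>x. 2 * of_real pi * \<i> * (quad \<beta> (cvec (sv x)) * fst h + bil \<beta> (cvec (sv x)) (snd h)) * thterm x \<tau> z) has_sum D h) UNIV"
proof -
  define v0 where "v0 = Im \<tau> / 2"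
  define R where "R = norm z + 1"
  have v0: "v0 > 0" using assms by (simp add: v0_def upper_half_plane_def)
  have R: "R \<ge> 0" by (simp add: R_def)
  obtain M \<epsilon> where \<epsilon>: "\<epsilon> > 0" "M \<ge> 0" and M: "\<forall>x \<tau> z. Im \<tau> \<ge> v0 \<longrightarrow> norm z \<le> R \<longrightarrow>
       (1 + norm (quad \<beta> (sv x)) + norm (sv x)) * norm (thterm x \<tau> z) \<le> M * exp (- \<epsilon> * (norm (rvec x))\<^sup>2)"
    using thterm_bound [OF v0 R] by blast
  define S where "S = {\<tau>. Im \<tau> > v0} \<times> ball (0 :: complex^'n) R"
  have S: "convex S" "open S"
    unfolding S_def
    by (intro convex_Times convex_halfspace_Im_gt convex_ball open_Times open_halfspace_Im_gt open_ball)+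
  have "(\<tau>, z) \<in> S" using v0 by (auto simp: S_def v0_def R_def)
  note S = S this
  have S_uhp: "fst p \<in> upper_half_plane" if "p \<in> S" for p
    using that v0 by (auto simp: S_def upper_half_plane_def)
  let ?e = "int_vec_enum :: nat \<Rightarrow> int^'n"
  define Dx where "Dx = (\<lambda>x (p :: complex \<times> (complex^'n)) h. 2 * of_real pi * \<i> * (quad \<beta> (cvec (sv x)) * fst h + bil \<beta> (cvec (sv x)) (snd h)) * thterm x (fst p) (snd p))"
  have der: "((\<lambda>p. thterm x (fst p) (snd p)) has_derivative Dx x p) (at p within S)" for x p
  proof -
    define lf where "lf = (\<lambda>p :: complex \<times> (complex^'n). quad \<beta> (cvec (sv x)) * fst p + bil \<beta> (cvec (sv x)) (snd p))"
    have "linear lf"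
    proof (rule linearI)
      fix a b show "lf (a + b) = lf a + lf b" by (simp add: lf_def bil_add_right algebra_simps)
      fix c and a :: "complex \<times> (complex^'n)"
      have "c *\<^sub>R snd a = complex_of_real c *s snd a"
        by (simp add: vec_eq_iff) (simp add: scaleR_conv_of_real)
      then show "lf (c *\<^sub>R a) = c *\<^sub>R lf a"
        by (simp add: lf_def bil_scale_right scaleR_conv_of_real algebra_simps)
    qed
    then have "(lf has_derivative lf) (at p within S)"
      by (intro bounded_linear_imp_has_derivative) (simp add: linear_conv_bounded_linear)
    moreover have "(ee has_derivative (\<lambda>h. 2 * of_real pi * \<i> * ee (lf p) * h)) (at (lf p) within lf ` S)"
      using ee_has_field_derivative by (simp add: has_field_derivative_def)
    ultimately have "((\<lambda>p. ee (lf p)) has_derivative (\<lambda>h. 2 * of_real pi * \<i> * ee (lf p) * lf h)) (at p within S)"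
      using diff_chain_within [of lf lf p S ee] by (simp add: o_def)
    then have "((\<lambda>p. sgn_lat x * ee (lf p)) has_derivative (\<lambda>h. sgn_lat x * (2 * of_real pi * \<i> * ee (lf p) * lf h))) (at p within S)"
      by (rule has_derivative_mult_right)
    moreover have "(\<lambda>p. thterm x (fst p) (snd p)) = (\<lambda>p. sgn_lat x * ee (lf p))"
      by (simp only: thterm_def lf_def)
    moreover have "Dx x p = (\<lambda>h. sgn_lat x * (2 * of_real pi * \<i> * ee (lf p) * lf h))"
      unfolding Dx_def thterm_def lf_def by (rule ext) (simp only: mult_ac)
    ultimately show ?thesis by (simp only:)
  qed
  define b where "b = (\<lambda>k. 2 * pi * (1 + bil_bound) * (M * exp (- \<epsilon> * (norm (rvec (?e k)))\<^sup>2)))"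
  have b: "summable b"
    unfolding b_def
    by (intro summable_mult summable_on_imp_summable_enum [of "\<lambda>x. exp (- \<epsilon> * (norm (rvec x))\<^sup>2)"] gauss_lattice_summable \<epsilon>)
  have Dx_le: "norm (Dx (?e k) p h) \<le> b k * norm h" if "p \<in> S" for k p h
  proof -
    let ?x = "?e k"
    have "norm (quad \<beta> (cvec (sv ?x)) * fst h + bil \<beta> (cvec (sv ?x)) (snd h))
        \<le> norm (quad \<beta> (sv ?x)) * norm h + bil_bound * norm (sv ?x) * norm h"
    proof (intro norm_triangle_mono)
      show "norm (quad \<beta> (cvec (sv ?x)) * fst h) \<le> norm (quad \<beta> (sv ?x)) * norm h"
        unfolding norm_mult quad_cvec norm_of_real by (intro mult_mono) (use norm_fst_le [of "fst h" "snd h"] in auto)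
      have "norm (bil \<beta> (cvec (sv ?x)) (snd h)) \<le> bil_bound * norm (cvec (sv ?x)) * norm (snd h)"
        by (rule norm_bil_le)
      also have "\<dots> \<le> bil_bound * norm (sv ?x) * norm h"
      proof (intro mult_mono order_refl)
        show "norm (snd h) \<le> norm h" using norm_snd_le [of "snd h" "fst h"] by simp
        show "norm (cvec (sv ?x)) \<le> norm (sv ?x)"
          by (rule norm_le_componentwise_cart) (simp add: cvec_def)
      qed (auto simp: bil_bound_nonneg)
      finally show "norm (bil \<beta> (cvec (sv ?x)) (snd h)) \<le> bil_bound * norm (sv ?x) * norm h" .
    qed
    also have "\<dots> \<le> ((1 + bil_bound) * (1 + norm (quad \<beta> (sv ?x)) + norm (sv ?x))) * norm h"
      unfolding distrib_right [symmetric]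
      using bil_bound_nonneg by (intro mult_right_mono) (auto simp: algebra_simps)
    finally have "norm (Dx ?x p h) \<le> 2 * pi * (((1 + bil_bound) * (1 + norm (quad \<beta> (sv ?x)) + norm (sv ?x))) * norm h) * norm (thterm ?x (fst p) (snd p))"
    proof -
      assume le: "norm (quad \<beta> (cvec (sv ?x)) * fst h + bil \<beta> (cvec (sv ?x)) (snd h))
         \<le> ((1 + bil_bound) * (1 + norm (quad \<beta> (sv ?x)) + norm (sv ?x))) * norm h"
      have "norm (Dx ?x p h) = 2 * pi * norm (quad \<beta> (cvec (sv ?x)) * fst h + bil \<beta> (cvec (sv ?x)) (snd h)) * norm (thterm ?x (fst p) (snd p))"
        by (simp add: Dx_def norm_mult)
      also have "\<dots> \<le> 2 * pi * (((1 + bil_bound) * (1 + norm (quad \<beta> (sv ?x)) + norm (sv ?x))) * norm h) * norm (thterm ?x (fst p) (snd p))"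
        by (intro mult_right_mono mult_left_mono le) auto
      finally show ?thesis .
    qed
    also have "\<dots> = 2 * pi * (1 + bil_bound) * ((1 + norm (quad \<beta> (sv ?x)) + norm (sv ?x)) * norm (thterm ?x (fst p) (snd p))) * norm h"
      by (simp only: mult_ac)
    also have "\<dots> \<le> 2 * pi * (1 + bil_bound) * (M * exp (- \<epsilon> * (norm (rvec ?x))\<^sup>2)) * norm h"
      using that bil_bound_nonneg by (intro mult_right_mono mult_left_mono M [rule_format]) (auto simp: S_def)
    finally show ?thesis by (simp add: b_def)
  qed
  have Dx_summable: "summable (\<lambda>k. norm (Dx (?e k) p h))" if "p \<in> S" for p h
    by (rule summable_comparison_test' [OF summable_mult2 [OF b, of "norm h"], of 0])
       (use Dx_le [OF that] in simp)
  define g' where "g' = (\<lambda>p h. \<Sum>k. Dx (?e k) p h)"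
  have "\<exists>g. \<forall>p\<in>S. (\<lambda>k. thterm (?e k) (fst p) (snd p)) sums g p \<and> (g has_derivative g' p) (at p within S)"
  proof (rule has_derivative_series [OF S(1) der _ S(3)])
    fix e :: real assume e: "e > 0"
    have "(\<lambda>n. (\<Sum>k. b k) - (\<Sum>k<n. b k)) \<longlonglongrightarrow> (\<Sum>k. b k) - (\<Sum>k. b k)"
      by (intro tendsto_intros summable_LIMSEQ b)
    then have "\<forall>\<^sub>F n in sequentially. (\<Sum>k. b k) - (\<Sum>k<n. b k) < e"
      using e by (intro order_tendstoD(2) [of _ 0]) auto
    then show "\<forall>\<^sub>F n in sequentially. \<forall>p\<in>S. \<forall>h. norm ((\<Sum>k<n. Dx (?e k) p h) - g' p h) \<le> e * norm h"
    proof eventually_elim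
      case (elim n)
      show ?case
      proof (intro ballI allI)
        fix p h assume p: "p \<in> S"
        have sm: "summable (\<lambda>k. Dx (?e k) p h)" by (rule summable_norm_cancel [OF Dx_summable [OF p]])
        have "g' p h - (\<Sum>k<n. Dx (?e k) p h) = (\<Sum>k. Dx (?e (k + n)) p h)"
          unfolding g'_def by (rule suminf_minus_initial_segment [OF sm, symmetric])
        also have "norm \<dots> \<le> (\<Sum>k. b (k + n) * norm h)"
          by (rule norm_suminf_le [OF Dx_le [OF p]]) (intro summable_mult2, simp add: summable_iff_shift b)
        also have "\<dots> = (\<Sum>k. b (k + n)) * norm h"
          by (rule suminf_mult2 [symmetric]) (simp add: summable_iff_shift b)
        also have "\<dots> \<le> e * norm h"
          using elim by (intro mult_right_mono) (auto simp: suminf_minus_initial_segment [OF b])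
        finally show "norm ((\<Sum>k<n. Dx (?e k) p h) - g' p h) \<le> e * norm h"
          by (simp add: norm_minus_commute)
      qed
    qed
  next
    show "(\<lambda>k. thterm (?e k) (fst (\<tau>, z)) (snd (\<tau>, z))) sums th \<tau> z"
      using has_sum_imp_sums_enum [OF th_has_sum [OF assms]] by simp
  qed
  then obtain g where g: "\<And>p. p \<in> S \<Longrightarrow> (\<lambda>k. thterm (?e k) (fst p) (snd p)) sums g p"
    "\<And>p. p \<in> S \<Longrightarrow> (g has_derivative g' p) (at p within S)" by blast
  have g_eq: "g p = th (fst p) (snd p)" if "p \<in> S" for p
    using g(1) [OF that] has_sum_imp_sums_enum [OF th_has_sum [OF S_uhp [OF that]]] by (rule sums_unique2)
  show thesis
  proof (rule that)
    have "(g has_derivative g' (\<tau>, z)) (at (\<tau>, z))"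
      using g(2) [OF S(3)] at_within_open [OF S(3,2)] by simp
    then show "((\<lambda>p. th (fst p) (snd p)) has_derivative g' (\<tau>, z)) (at (\<tau>, z))"
      by (rule has_derivative_transform_within_open [OF _ S(2,3)]) (simp add: g_eq)
    show "((\<lambda>x. 2 * of_real pi * \<i> * (quad \<beta> (cvec (sv x)) * fst h + bil \<beta> (cvec (sv x)) (snd h)) * thterm x \<tau> z) has_sum g' (\<tau>, z) h) UNIV" for h
      using norm_summable_enum_has_sum [OF Dx_summable [OF S(3), of h]] unfolding g'_def Dx_def by simp
  qed
qed

lemma th_complex_linear_derivative:
  assumes "\<tau> \<in> upper_half_plane"
  shows "\<exists>D. ((\<lambda>p. th (fst p) (snd p)) has_derivative D) (at (\<tau>, z)) \<and> (\<forall>c v. D (c * fst v, c *s snd v) = c * D v)"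
proof -
  obtain D where D: "((\<lambda>p. th (fst p) (snd p)) has_derivative D) (at (\<tau>, z))"
    "\<And>h. ((\<lambda>x. 2 * of_real pi * \<i> * (quad \<beta> (cvec (sv x)) * fst h + bil \<beta> (cvec (sv x)) (snd h)) * thterm x \<tau> z) has_sum D h) UNIV"
    using th_has_derivative [OF assms] by blast
  show ?thesis
  proof (intro exI [of _ D] conjI D(1) allI)
    fix c v
    have "((\<lambda>x. c * (2 * of_real pi * \<i> * (quad \<beta> (cvec (sv x)) * fst v + bil \<beta> (cvec (sv x)) (snd v)) * thterm x \<tau> z)) has_sum c * D v) UNIV"
      by (intro has_sum_cmult_right D(2))
    also have "(\<lambda>x. c * (2 * of_real pi * \<i> * (quad \<beta> (cvec (sv x)) * fst v + bil \<beta> (cvec (sv x)) (snd v)) * thterm x \<tau> z))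
       = (\<lambda>x. 2 * of_real pi * \<i> * (quad \<beta> (cvec (sv x)) * fst (c * fst v, c *s snd v) + bil \<beta> (cvec (sv x)) (snd (c * fst v, c *s snd v))) * thterm x \<tau> z)"
      by (simp add: bil_scale_right algebra_simps)
    finally show "D (c * fst v, c *s snd v) = c * D v"
      by (rule has_sum_unique [OF D(2)])
  qed
qed

end

lemma upper_half_plane_inverse: "\<tau> \<in> upper_half_plane \<Longrightarrow> - 1 / \<tau> \<in> upper_half_plane"
proof -
  assume \<tau>: "\<tau> \<in> upper_half_plane"
  then have "\<tau> \<noteq> 0" by (auto simp: upper_half_plane_def)
  then have "0 < (Re \<tau>)\<^sup>2 + (Im \<tau>)\<^sup>2" by (simp add: complex_eq_iff sum_power2_gt_zero_iff)
  moreover have "Im (- 1 / \<tau>) = Im \<tau> / ((Re \<tau>)\<^sup>2 + (Im \<tau>)\<^sup>2)" by (simp add: Im_divide)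
  ultimately show ?thesis using \<tau> by (simp add: upper_half_plane_def)
qed

context unimodular_lattice begin

lemma thterm_T: "thterm x (\<tau> + 1) z = tc * thterm x \<tau> z"
  using ee_quad_rho [of x] by (simp add: thterm_def cvec_sv distrib_left ee_add)

lemma thterm_translate: "thterm x \<tau> (z + vec_of_int y) = sgn_lat y * thterm x \<tau> z"
  using ee_bil_rho [of x y] by (simp add: thterm_def cvec_sv bil_add_right ee_add)

text \<open>
  Completing the square: the translation by \<open>y\<tau>\<close> shifts the summation index.
\<close>
lemma thterm_quasi:
  "thterm x \<tau> (z + \<tau> *s vec_of_int y) * ee (\<tau> * quad \<beta> (vec_of_int y) + bil \<beta> (vec_of_int y) z)
     = sgn_lat y * thterm (x + y) \<tau> z"
proof -
  have "quad \<beta> (cvec (sv x)) * \<tau> + bil \<beta> (cvec (sv x)) (z + \<tau> *s vec_of_int y)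
        + (\<tau> * quad \<beta> (vec_of_int y) + bil \<beta> (vec_of_int y) z)
      = quad \<beta> (cvec (sv (x + y))) * \<tau> + bil \<beta> (cvec (sv (x + y))) z"
    using bil_commute [of "cvec (sv x)" "vec_of_int y"]
    by (simp add: sv_add cvec_add bil_add_left bil_add_right bil_scale_right quad_add algebra_simps)
  then show ?thesis
    by (simp add: thterm_def sgn_lat_add mult.assoc flip: ee_add)
qed

lemma th_T: "\<tau> \<in> upper_half_plane \<Longrightarrow> th (\<tau> + 1) z = tc * th \<tau> z"
  unfolding th_def thterm_T by (intro infsum_cmult_right thterm_summable)

lemma th_translate: "\<tau> \<in> upper_half_plane \<Longrightarrow> th \<tau> (z + vec_of_int y) = sgn_lat y * th \<tau> z"
  unfolding th_def thterm_translate by (intro infsum_cmult_right thterm_summable)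

lemma th_quasi:
  assumes "\<tau> \<in> upper_half_plane"
  shows "th \<tau> (z + \<tau> *s vec_of_int y) * ee (\<tau> * quad \<beta> (vec_of_int y) + bil \<beta> (vec_of_int y) z) = sgn_lat y * th \<tau> z"
proof -
  have bij: "bij (\<lambda>x :: int^'n. x + y)"
    by (rule bij_betw_byWitness [where f' = "\<lambda>x. x - y"]) auto
  have "((\<lambda>x. thterm (x + y) \<tau> z) has_sum th \<tau> z) UNIV"
    using has_sum_reindex_bij_betw [OF bij, of "\<lambda>x. thterm x \<tau> z"] th_has_sum [OF assms] by simp
  then have "((\<lambda>x. sgn_lat y * thterm (x + y) \<tau> z) has_sum sgn_lat y * th \<tau> z) UNIV"
    by (rule has_sum_cmult_right)
  moreover have "((\<lambda>x. sgn_lat y * thterm (x + y) \<tau> z) has_sum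
     th \<tau> (z + \<tau> *s vec_of_int y) * ee (\<tau> * quad \<beta> (vec_of_int y) + bil \<beta> (vec_of_int y) z)) UNIV"
    unfolding thterm_quasi [symmetric] by (intro has_sum_cmult_left th_has_sum assms)
  ultimately show ?thesis using has_sum_unique by blast
qed

lemma th_elliptic:
  assumes "\<tau> \<in> upper_half_plane"
  shows "th \<tau> (z + \<tau> *s vec_of_int x + vec_of_int y) * ee (\<tau> * quad \<beta> (vec_of_int x) + bil \<beta> (vec_of_int x) z)
     = ee (quad \<beta> (vec_of_int (x + y))) * th \<tau> z"
  using th_quasi [OF assms, of z x]
  by (simp add: th_translate [OF assms] sgn_lat_add mult_ac flip: sgn_lat_def)

lemma bounded_linear_scale_vec: "bounded_linear (\<lambda>c :: complex. c *s (z :: complex^'n))"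
proof -
  have "linear (\<lambda>c :: complex. c *s z)"
    by (rule linearI) (simp_all add: vec_eq_iff algebra_simps)
  then show ?thesis by (simp add: linear_conv_bounded_linear)
qed

text \<open>
  The scaling of a fixed direction is all that is needed to move along an orbit of the modular group.
\<close>
lemma th_compose_holomorphic:
  assumes f: "f holomorphic_on A" and g: "g holomorphic_on A" and A: "open A"
    and fA: "\<And>w. w \<in> A \<Longrightarrow> f w \<in> upper_half_plane"
  shows "(\<lambda>w. th (f w) (g w *s z)) holomorphic_on A"
proof (subst holomorphic_on_open [OF A], intro ballI)
  fix w assume w: "w \<in> A"
  obtain f' g' where f': "(f has_field_derivative f') (at w)" and g': "(g has_field_derivative g') (at w)"
    using f g A w by (meson holomorphic_on_open)
  obtain D where D: "((\<lambda>p. th (fst p) (snd p)) has_derivative D) (at (f w, g w *s z))"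
    "\<forall>c v. D (c * fst v, c *s snd v) = c * D v"
    using th_complex_linear_derivative [OF fA [OF w]] by blast
  have "((\<lambda>w. (f w, g w *s z)) has_derivative (\<lambda>h. (f' * h, (g' * h) *s z))) (at w)"
    using f' g' unfolding has_field_derivative_def
    by (intro has_derivative_Pair bounded_linear.has_derivative [OF bounded_linear_scale_vec])
  from diff_chain_at [OF this D(1)]
  have "((\<lambda>w. th (f w) (g w *s z)) has_derivative (\<lambda>h. D (f' * h, (g' * h) *s z))) (at w)"
    by (simp add: o_def)
  also have "(\<lambda>h. D (f' * h, (g' * h) *s z)) = (\<lambda>h. D (f', g' *s z) * h)"
    using D(2) [rule_format, of _ "(f', g' *s z)"] by (simp add: mult.commute vector_smult_assoc)
  finally show "\<exists>f'. ((\<lambda>w. th (f w) (g w *s z)) has_field_derivative f') (at w)"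
    unfolding has_field_derivative_def by blast
qed

lemma th_continuous:
  assumes "continuous_on A f" "continuous_on A g" "\<And>u. u \<in> A \<Longrightarrow> f u \<in> upper_half_plane"
  shows "continuous_on A (\<lambda>u. th (f u) (g u))"
proof -
  have "continuous_on (upper_half_plane \<times> UNIV) (\<lambda>p :: complex \<times> (complex^'n). th (fst p) (snd p))"
  proof (intro continuous_at_imp_continuous_on ballI)
    fix p :: "complex \<times> (complex^'n)" assume "p \<in> upper_half_plane \<times> UNIV"
    then have "fst p \<in> upper_half_plane" by auto
    then obtain D where "((\<lambda>p. th (fst p) (snd p)) has_derivative D) (at (fst p, snd p))"
      using th_complex_linear_derivative by blast
    then show "isCont (\<lambda>p. th (fst p) (snd p)) p"
      using has_derivative_continuous by fastforce
  qed
  from continuous_on_compose2 [OF this continuous_on_Pair [OF assms(1,2)]] assms(3)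
  show ?thesis by auto
qed

section \<open>Uniqueness of theta expansions\<close>

text \<open>
  The Gram matrix as a map. By unimodularity it is a bijection, so along real translations of \<open>z\<close> the
  theta series is, up to an exponential factor, a Fourier series in which every character occurs exactly once.
\<close>
definition gram :: "int^'n \<Rightarrow> int^'n" where "gram y = (\<chi> j. \<beta> y (axis j 1))"

lemma fchar_gram: "fchar (gram y) u = ee (bil \<beta> (vec_of_int y) (cvec u))"
proof -
  have "bil \<beta> (vec_of_int y) (axis j (1::complex)) = of_int (\<beta> y (axis j 1))" for j
    using bil_int [of y "axis j 1"] by (simp add: vec_of_int_axis)
  then have "bil \<beta> (vec_of_int y) (cvec u) = of_real (\<Sum>j\<in>UNIV. of_int (gram y $ j) * u $ j)"
    by (subst bil_axis_expand) (simp add: gram_def cvec_def mult.commute)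
  then show ?thesis by (simp only: fchar_def)
qed

lemma bij_gram: "bij gram"
proof (rule bijI)
  have "gram (x - y) = gram x - gram y" for x y
  proof -
    have "\<beta> (x - y) w = \<beta> x w - \<beta> y w" for w
    proof -
      have "(of_int (\<beta> (x - y) w) :: rat) = of_int (\<beta> x w - \<beta> y w)"
        by (simp add: vec_of_int_diff bil_diff_left flip: bil_int)
      then show ?thesis by (simp only: of_int_eq_iff)
    qed
    then show ?thesis by (simp add: gram_def vec_eq_iff)
  qed
  moreover have "x = 0" if "gram x = 0" for x
  proof (rule ccontr)
    assume "x \<noteq> 0"
    have e: "bil \<beta> (vec_of_int x) (axis j (1::rat)) = of_int (\<beta> x (axis j 1))" for j
      using bil_int [of x "axis j 1"] by (simp add: vec_of_int_axis)
    have "(of_int (\<beta> x x) :: rat) = bil \<beta> (vec_of_int x) (vec_of_int x)" by (simp add: bil_int)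
    also have "\<dots> = (\<Sum>j\<in>UNIV. vec_of_int x $ j * of_int (\<beta> x (axis j 1)))"
      by (subst bil_axis_expand) (simp only: e)
    also have "\<dots> = 0" using that by (simp add: gram_def vec_eq_iff)
    finally show False using posdef \<open>x \<noteq> 0\<close> by (auto simp: positive_definite_def)
  qed
  ultimately show "inj gram"
    by (metis eq_iff_diff_eq_0 injI)
  show "surj gram"
  proof (rule surjI)
    fix k
    have "\<exists>x. gram x = k"
    proof -
      obtain x :: "int^'n" where x: "\<And>u :: rat^'n. bil \<beta> (vec_of_int x) u = (\<Sum>j\<in>UNIV. of_int (k $ j) * u $ j)"
        using dual_vector [of k, where 'a = rat] by blast
      have "\<beta> x (axis j 1) = k $ j" for j
      proof -
        have "(of_int (\<beta> x (axis j 1)) :: rat) = (\<Sum>i\<in>UNIV. of_int (k $ i) * axis j 1 $ i)"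
          by (simp add: vec_of_int_axis x flip: bil_int)
        also have "\<dots> = (\<Sum>i\<in>UNIV. if i = j then of_int (k $ j) else 0)"
          by (intro sum.cong) (auto simp: axis_def)
        finally show ?thesis by simp
      qed
      then have "gram x = k" by (simp add: gram_def vec_eq_iff)
      then show ?thesis by blast
    qed
    then show "gram (SOME x. gram x = k) = k" by (rule someI_ex)
  qed
qed

lemma thterm_fchar: "thterm y \<tau> (z + cvec u) = thterm y \<tau> z * fchar (gram y) u * ee (bil \<beta> \<rho> (cvec u))"
  by (simp add: thterm_def cvec_sv fchar_gram bil_add_right bil_add_left ee_add mult_ac)

text \<open>
  After division by the factor \<open>e(\<beta>(\<rho>, u))\<close>, which is not periodic, the function \<open>u \<mapsto> F(u)\<close> is given by an
  absolutely convergent Fourier series, and its coefficients are integrals over the cube.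
\<close>
lemma theta_coefficient:
  assumes sm: "\<And>u. ((\<lambda>x. d x * thterm x \<tau> (z + cvec u)) has_sum F u) UNIV"
  shows "(LINT u:unit_cube|lborel. ee (- bil \<beta> \<rho> (cvec u)) * F u * fchar (- gram y) u)
      = of_real (measure lborel (unit_cube :: (real^'n) set)) * (d y * thterm y \<tau> z)"
proof -
  define b where "b k = d (inv gram k) * thterm (inv gram k) \<tau> z" for k
  have inv: "gram (inv gram k) = k" "inv gram (gram y) = y" for k y
    using bij_gram by (simp_all add: bij_def surj_f_inv_f inv_f_f)
  have bij': "bij (inv gram)" by (rule bij_imp_bij_inv [OF bij_gram])
  have s: "((\<lambda>k. b k * fchar k u) has_sum ee (- bil \<beta> \<rho> (cvec u)) * F u) UNIV" for u
  proof -
    have "((\<lambda>x. ee (- bil \<beta> \<rho> (cvec u)) * (d x * thterm x \<tau> (z + cvec u))) has_sum ee (- bil \<beta> \<rho> (cvec u)) * F u) UNIV"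
      by (rule has_sum_cmult_right [OF sm])
    moreover have "ee (- bil \<beta> \<rho> (cvec u)) * (d x * thterm x \<tau> (z + cvec u)) = d x * thterm x \<tau> z * fchar (gram x) u" for x
      by (simp add: thterm_fchar ee_minus)
    ultimately have "((\<lambda>x. d x * thterm x \<tau> z * fchar (gram x) u) has_sum ee (- bil \<beta> \<rho> (cvec u)) * F u) UNIV"
      by simp
    then have "((\<lambda>k. d (inv gram k) * thterm (inv gram k) \<tau> z * fchar (gram (inv gram k)) u) has_sum ee (- bil \<beta> \<rho> (cvec u)) * F u) UNIV"
      by (subst has_sum_reindex_bij_betw [OF bij'])
    then show ?thesis by (simp add: b_def inv)
  qed
  have "b summable_on UNIV" using s [of 0] by (auto simp: fchar_def summable_on_def)
  from fourier_coefficient_series [OF this s, of "gram y"] show ?thesis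
    by (simp add: b_def inv)
qed

lemma theta_expansion_unique:
  assumes "\<And>z. ((\<lambda>x. d x * thterm x \<tau> z) has_sum 0) UNIV"
  shows "d y = 0"
proof -
  have "of_real (measure lborel (unit_cube :: (real^'n) set)) * (d y * thterm y \<tau> 0) = 0"
    using theta_coefficient [of d \<tau> 0 "\<lambda>_. 0" y] assms by simp
  then show ?thesis using measure_unit_cube_pos [where 'n = 'n] by (simp add: thterm_def)
qed

lemma th_not_identically_zero:
  assumes "\<tau> \<in> upper_half_plane"
  obtains z where "th \<tau> z \<noteq> 0"
  using theta_expansion_unique [of "\<lambda>_. 1" \<tau>] th_has_sum [OF assms] by fastforce

section \<open>Gaussian integrals\<close>

text \<open>
  Tiling by cubes reduces the integral to the lattice sum of the same Gaussian.
\<close>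
lemma gauss_integrable:
  assumes "\<epsilon> > 0"
  shows "integrable lborel (\<lambda>u :: real^'n. exp (- \<epsilon> * (norm u)\<^sup>2))"
proof -
  let ?e = "int_vec_enum :: nat \<Rightarrow> int^'n"
  let ?g = "\<lambda>u :: real^'n. exp (- \<epsilon> * (norm u)\<^sup>2)"
  obtain B where B: "\<And>u :: real^'n. u \<in> unit_cube \<Longrightarrow> norm u \<le> B"
    using bounded_subset [OF bounded_cbox unit_cube_subset] unfolding bounded_iff by blast
  define M where "M = exp (\<epsilon> * B\<^sup>2)"
  define F where "F = (\<lambda>k u. indicator unit_cube (u + rvec (?e k)) * ?g u)"
  have [measurable]: "(\<lambda>u. indicator unit_cube (u + rvec x) :: real) \<in> borel_measurable borel" for x
    by measurable
  have emeas: "(\<integral>u. indicator unit_cube (u + rvec x) \<partial>lborel) = measure lborel (unit_cube :: (real^'n) set)"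
    and ind_int: "integrable lborel (\<lambda>u. indicator unit_cube (u + rvec x) :: real)" for x :: "int^'n"
  proof -
    have i: "integrable lborel (indicat_real (unit_cube :: (real^'n) set))"
      using emeasure_unit_cube_finite by (intro integrable_real_indicator) auto
    have "integrable lborel (\<lambda>u :: real^'n. complex_of_real (indicator unit_cube (u + rvec x)))"
      using lborel_translate(2) [of "\<lambda>u. complex_of_real (indicator unit_cube u)" "rvec x"] i by simp
    then show "integrable lborel (\<lambda>u. indicator unit_cube (u + rvec x) :: real)"
      by (simp only: complex_of_real_integrable_eq)
    have "(\<integral>u. complex_of_real (indicator unit_cube (u + rvec x)) \<partial>lborel) = (\<integral>u. complex_of_real (indicator (unit_cube :: (real^'n) set) u) \<partial>lborel)"
      by (rule lborel_translate(1) [of "\<lambda>u. complex_of_real (indicator unit_cube u)"]) simp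
    then show "(\<integral>u. indicator unit_cube (u + rvec x) \<partial>lborel) = measure lborel (unit_cube :: (real^'n) set)"
      using i by (simp only: integral_complex_of_real of_real_eq_iff) simp
  qed
  have F_le: "F k u \<le> M * exp (- (\<epsilon> / 2) * (norm (rvec (?e k)))\<^sup>2) * indicator unit_cube (u + rvec (?e k))" for k u
  proof (cases "u + rvec (?e k) \<in> unit_cube")
    case True
    have "(norm (- rvec (?e k)))\<^sup>2 / 2 - (norm (u + rvec (?e k)))\<^sup>2 \<le> (norm ((u + rvec (?e k)) + - rvec (?e k)))\<^sup>2"
      by (rule norm_sq_translate)
    moreover have "(norm (u + rvec (?e k)))\<^sup>2 \<le> B\<^sup>2" using B [OF True] by (intro power_mono) auto
    ultimately have "(norm (rvec (?e k) :: real^'n))\<^sup>2 / 2 - B\<^sup>2 \<le> (norm u)\<^sup>2" by simp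
    then have "\<epsilon> * ((norm (rvec (?e k) :: real^'n))\<^sup>2 / 2 - B\<^sup>2) \<le> \<epsilon> * (norm u)\<^sup>2"
      using assms by (intro mult_left_mono) auto
    then show ?thesis using True by (simp add: F_def M_def algebra_simps flip: exp_add)
  qed (simp add: F_def)
  have F_nn: "F k u \<ge> 0" for k u by (simp add: F_def)
  have F_int: "integrable lborel (F k)" for k
  proof (rule Bochner_Integration.integrable_bound [OF integrable_mult_right [OF ind_int [of "?e k"], of "M * exp (- (\<epsilon> / 2) * (norm (rvec (?e k)))\<^sup>2)"]])
    show "F k \<in> borel_measurable lborel" unfolding F_def by measurable
    have "norm (F k u) \<le> M * exp (- (\<epsilon> / 2) * (norm (rvec (?e k)))\<^sup>2) * indicator unit_cube (u + rvec (?e k))" for u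
      using F_le [of k u] F_nn [of k u] by (simp only: real_norm_def abs_of_nonneg)
    then show "AE u in lborel. norm (F k u) \<le> norm (M * exp (- (\<epsilon> / 2) * (norm (rvec (?e k)))\<^sup>2) * indicator unit_cube (u + rvec (?e k)))"
      by (intro AE_I2) (metis abs_ge_self order_trans real_norm_def)
  qed
  have sums: "(\<lambda>k. F k u) sums ?g u" for u
  proof -
    obtain k0 where k0: "?e k0 = - (\<chi> i. \<lfloor>u $ i\<rfloor>)"
      using bij_int_vec_enum by (metis bij_pointE)
    have "u + rvec (?e k) \<in> unit_cube \<longleftrightarrow> k = k0" for k
    proof -
      have "u + rvec (?e k) \<in> unit_cube \<longleftrightarrow> - ?e k = (\<chi> i. \<lfloor>u $ i\<rfloor>)"
        using unit_cube_tile [of u "- ?e k"] by (simp add: vec_of_int_minus)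
      also have "\<dots> \<longleftrightarrow> ?e k = ?e k0" by (simp add: k0) (metis minus_minus)
      also have "\<dots> \<longleftrightarrow> k = k0" using bij_int_vec_enum by (auto simp: bij_def inj_def)
      finally show ?thesis .
    qed
    then have "F k u = (if k = k0 then ?g u else 0)" for k by (simp add: F_def indicator_def)
    then show ?thesis using sums_single [of k0 "\<lambda>_. ?g u"] by simp
  qed
  have "integrable lborel (\<lambda>u. \<Sum>k. F k u)"
  proof (rule integrable_suminf [OF F_int])
    show "AE u in lborel. summable (\<lambda>k. norm (F k u))"
      using sums F_nn by (auto simp: sums_iff)
    show "summable (\<lambda>k. \<integral>u. norm (F k u) \<partial>lborel)"
    proof (rule summable_comparison_test')
      show "summable (\<lambda>k. M * exp (- (\<epsilon> / 2) * (norm (rvec (?e k) :: real^'n))\<^sup>2) * measure lborel (unit_cube :: (real^'n) set))"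
        by (intro summable_mult2 summable_mult summable_on_imp_summable_enum [of "\<lambda>x. exp (- (\<epsilon> / 2) * (norm (rvec x :: real^'n))\<^sup>2)"] gauss_lattice_summable)
           (use assms in simp)
      fix k :: nat assume "k \<ge> 0"
      have "(\<integral>u. norm (F k u) \<partial>lborel) \<le> (\<integral>u. M * exp (- (\<epsilon> / 2) * (norm (rvec (?e k)))\<^sup>2) * indicator unit_cube (u + rvec (?e k)) \<partial>lborel)"
        using F_le F_nn by (intro integral_mono integrable_norm F_int integrable_mult_right ind_int) auto
      then show "norm (\<integral>u. norm (F k u) \<partial>lborel) \<le> M * exp (- (\<epsilon> / 2) * (norm (rvec (?e k) :: real^'n))\<^sup>2) * measure lborel (unit_cube :: (real^'n) set)"
        by (simp add: emeas integral_nonneg_AE)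
    qed
  qed
  then show ?thesis using sums by (simp add: sums_iff)
qed

text \<open>
  The integral over \<open>z + \<real>\<^sup>n\<close> of the Gaussian \<open>exp (- c \<beta>(u))\<close>.
\<close>
definition gaussian :: "real \<Rightarrow> complex^'n \<Rightarrow> complex" where
  "gaussian c z = (\<integral>u. exp (- of_real c * quad \<beta> (cvec u + z)) \<partial>lborel)"

lemma gauss_dominate:
  assumes "c > 0"
  shows "integrable lborel (\<lambda>u :: real^'n. exp (- c * quad \<beta> u) * exp (R * norm u))"
proof -
  obtain \<delta> where \<delta>: "\<delta> > 0" "\<And>u :: real^'n. \<delta> * (norm u)\<^sup>2 \<le> quad \<beta> u" by (rule quad_lower_bound) blast
  define a where "a = c * \<delta>"
  have a: "a > 0" using assms \<delta> by (simp add: a_def)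
  have bd: "norm (exp (- c * quad \<beta> u) * exp (R * norm u)) \<le> exp (R\<^sup>2 / (2 * a)) * exp (- (a / 2) * (norm u)\<^sup>2)" for u :: "real^'n"
  proof -
    have "a * (norm u)\<^sup>2 \<le> c * quad \<beta> u"
      unfolding a_def mult.assoc using assms by (intro mult_left_mono \<delta>) auto
    moreover have "R * norm u \<le> R\<^sup>2 / (2 * a) + a / 2 * (norm u)\<^sup>2"
    proof -
      have "0 \<le> (R - a * norm u)\<^sup>2 / (2 * a)" using a by simp
      also have "\<dots> = R\<^sup>2 / (2 * a) + a / 2 * (norm u)\<^sup>2 - R * norm u"
        using a by (simp add: power2_eq_square field_simps)
      finally show ?thesis by simp
    qed
    ultimately have "- c * quad \<beta> u + R * norm u \<le> R\<^sup>2 / (2 * a) + - (a / 2) * (norm u)\<^sup>2"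
      by (simp add: field_simps)
    then show ?thesis by (simp flip: exp_add)
  qed
  have int: "integrable lborel (\<lambda>u :: real^'n. exp (R\<^sup>2 / (2 * a)) * exp (- (a / 2) * (norm u)\<^sup>2))"
    using gauss_integrable [of "a / 2"] a by (intro integrable_mult_right) auto
  have meas: "(\<lambda>u :: real^'n. exp (- c * quad \<beta> u) * exp (R * norm u)) \<in> borel_measurable lborel"
    by (simp add: borel_measurable_continuous_onI continuous_intros)
  show ?thesis
    by (rule Bochner_Integration.integrable_bound [OF int meas], rule AE_I2, rule order_trans [OF bd])
       (simp only: real_norm_def abs_ge_self)
qed

text \<open>
  Along a real direction the integral is translation invariant; as it depends holomorphically on the
  translation, it is invariant under complex translations too. The expansion in powers of \<open>w\<close> shows
  the holomorphy.
\<close>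
lemma gaussian_shift_scaled:
  fixes b :: "real^'n"
  assumes c: "c > 0"
  shows "gaussian c (w *s cvec b) = gaussian c 0"
proof -
  define m where "m k = (\<integral>u. exp (- of_real c * of_real (quad \<beta> u)) * (- of_real c * of_real (bil \<beta> u b)) ^ k / fact k \<partial>lborel)" for k :: nat
  define f where "f = (\<lambda>w k (u :: real^'n). complex_of_real (exp (- c * quad \<beta> u)) * ((- of_real c * w * of_real (bil \<beta> u b)) ^ k /\<^sub>R fact k))"
  have meas [measurable]: "f w k \<in> borel_measurable borel" for w k
    unfolding f_def by (intro borel_measurable_continuous_onI continuous_intros)
  define E where "E = (\<lambda>w (u :: real^'n). complex_of_real (exp (- c * quad \<beta> u)) * exp (- of_real c * w * of_real (bil \<beta> u b)))"
  define R where "R w = c * norm w * bil_bound * norm b" for w :: complex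
  have arg: "norm (- of_real c * w * of_real (bil \<beta> u b)) \<le> R w * norm u" for w and u :: "real^'n"
  proof -
    have "\<bar>bil \<beta> u b\<bar> \<le> bil_bound * norm u * norm b" using norm_bil_le [of u b] by simp
    then have "c * norm w * \<bar>bil \<beta> u b\<bar> \<le> c * norm w * (bil_bound * norm u * norm b)"
      using c by (intro mult_left_mono) auto
    then show ?thesis using c by (simp add: R_def norm_mult mult_ac)
  qed
  have fsums: "(\<lambda>k. norm (f w k u)) sums (exp (- c * quad \<beta> u) * exp (norm (- of_real c * w * of_real (bil \<beta> u b))))"
    and fsum: "(\<lambda>k. f w k u) sums E w u" for w u
  proof -
    show "(\<lambda>k. f w k u) sums E w u"
      unfolding f_def E_def by (intro sums_mult exp_converges)
    have "(\<lambda>k. exp (- c * quad \<beta> u) * (norm (- of_real c * w * of_real (bil \<beta> u b)) ^ k /\<^sub>R fact k)) sums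
       (exp (- c * quad \<beta> u) * exp (norm (- of_real c * w * of_real (bil \<beta> u b))))"
      by (intro sums_mult exp_converges)
    then show "(\<lambda>k. norm (f w k u)) sums (exp (- c * quad \<beta> u) * exp (norm (- of_real c * w * of_real (bil \<beta> u b))))"
      by (simp add: f_def norm_mult norm_power mult_ac)
  qed
  define G where "G w u = exp (- c * quad \<beta> u) * exp (R w * norm u)" for w and u :: "real^'n"
  have G: "integrable lborel (G w)" for w
    unfolding G_def by (rule gauss_dominate [OF c])
  have part: "(\<Sum>k<N. norm (f w k u)) \<le> G w u" for w u N
  proof -
    have "(\<Sum>k<N. norm (f w k u)) \<le> exp (- c * quad \<beta> u) * exp (norm (- of_real c * w * of_real (bil \<beta> u b)))"
      using fsums [of w u] sum_le_suminf [of "\<lambda>k. norm (f w k u)" "{..<N}"] by (auto simp: sums_iff)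
    also have "\<dots> \<le> G w u" unfolding G_def using arg [of w u] by (intro mult_left_mono) auto
    finally show ?thesis .
  qed
  have f_int: "integrable lborel (f w k)" for w k
  proof (rule Bochner_Integration.integrable_bound [OF G [of w]])
    have "norm (f w k u) \<le> G w u" for u
      using part [of w u "Suc k"] sum_nonneg [of "{..<k}" "\<lambda>k. norm (f w k u)"] by simp
    then show "AE u in lborel. norm (f w k u) \<le> norm (G w u)"
      by (intro AE_I2) (auto intro: order_trans [OF _ abs_ge_self])
  qed simp
  have sm: "summable (\<lambda>k. \<integral>u. norm (f w k u) \<partial>lborel)" for w
  proof (rule summableI_nonneg_bounded)
    fix N
    have "(\<Sum>k<N. \<integral>u. norm (f w k u) \<partial>lborel) = (\<integral>u. (\<Sum>k<N. norm (f w k u)) \<partial>lborel)"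
      using f_int by (intro Bochner_Integration.integral_sum [symmetric]) auto
    also have "\<dots> \<le> (\<integral>u. G w u \<partial>lborel)"
      by (intro integral_mono Bochner_Integration.integrable_sum integrable_norm f_int G part)
    finally show "(\<Sum>k<N. \<integral>u. norm (f w k u) \<partial>lborel) \<le> (\<integral>u. G w u \<partial>lborel)" .
  qed auto
  have swap: "(\<lambda>k. \<integral>u. f w k u \<partial>lborel) sums (\<integral>u. (\<Sum>k. f w k u) \<partial>lborel)" for w
    by (rule sums_integral [OF f_int _ sm]) (use fsums in \<open>auto simp: sums_iff\<close>)
  have homog: "(\<integral>u. f w k u \<partial>lborel) = (\<integral>u. f 1 k u \<partial>lborel) * w ^ k" for w k
  proof -
    have "f w k u = f 1 k u * w ^ k" for u
    proof -
      have "- of_real c * w * of_real (bil \<beta> u b) = (- of_real c * 1 * of_real (bil \<beta> u b)) * w" by simp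
      then show ?thesis unfolding f_def by (simp only: power_mult_distrib scaleR_conv_of_real mult_ac power_one mult_1_left)
    qed
    then show ?thesis by simp
  qed
  have pow: "(\<lambda>k. (\<integral>u. f 1 k u \<partial>lborel) * w ^ k) sums (\<integral>u. E w u \<partial>lborel)" for w
  proof -
    have "(\<lambda>u. \<Sum>k. f w k u) = E w" using fsum [of w] by (auto simp: sums_iff)
    then show ?thesis using swap [of w] by (simp only: homog [of w])
  qed
  define J where "J w = (\<integral>u. E w u \<partial>lborel)" for w
  have "J holomorphic_on ball 0 r" for r
    by (rule power_series_holomorphic [where a = "\<lambda>k. \<integral>u. f 1 k u \<partial>lborel"]) (use pow in \<open>simp add: J_def\<close>)
  then have "J holomorphic_on (\<Union>r. ball 0 r)" by (intro holomorphic_on_UN_open) auto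
  moreover have "(\<Union>r. ball (0::complex) r) = UNIV" by (auto intro: gt_ex)
  ultimately have J: "J holomorphic_on UNIV" by simp
  have gauss_J: "gaussian c (w *s cvec b) = exp (- of_real c * w\<^sup>2 * of_real (quad \<beta> b)) * J w" for w
  proof -
    have "exp (- of_real c * quad \<beta> (cvec u + w *s cvec b)) = exp (- of_real c * w\<^sup>2 * of_real (quad \<beta> b)) * E w u" for u
      by (simp add: E_def quad_add quad_scale bil_scale_right quad_cvec bil_cvec exp_of_real [symmetric] del: exp_of_real)
         (simp add: algebra_simps flip: exp_add)
    then show ?thesis unfolding gaussian_def J_def by simp
  qed
  have real: "gaussian c (of_real w *s cvec b) = gaussian c 0" for w
  proof -
    have "cvec u + of_real w *s cvec b = cvec (u + w *s b) + 0" for u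
      by (simp add: cvec_def vec_eq_iff)
    then show ?thesis unfolding gaussian_def
      using lborel_translate(1) [of "\<lambda>u. exp (- of_real c * quad \<beta> (cvec u + 0))" "w *s b"]
      by (simp add: borel_measurable_continuous_onI continuous_intros)
  qed
  define h where "h w = exp (- of_real c * w\<^sup>2 * of_real (quad \<beta> b)) * J w - gaussian c 0" for w
  have "h holomorphic_on UNIV" unfolding h_def by (intro holomorphic_intros J)
  moreover have "h w = 0" if "w \<in> \<real>" for w
    using that gauss_J real unfolding h_def by (metis Reals_cases eq_iff_diff_eq_0)
  moreover have "(0::complex) islimpt \<real>"
    unfolding islimpt_approachable
  proof (intro allI impI)
    fix e :: real assume "e > 0"
    then show "\<exists>x'\<in>\<real>. x' \<noteq> 0 \<and> dist x' (0::complex) < e"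
      by (intro bexI [of _ "of_real (e / 2)"]) auto
  qed
  ultimately have "h w = 0"
    using analytic_continuation [of h UNIV "\<real>" 0 w] by auto
  then show ?thesis by (simp add: h_def gauss_J)
qed

lemma gaussian_shift:
  assumes "c > 0"
  shows "gaussian c z = gaussian c 0"
proof -
  define a where "a = (\<chi> i. Re (z $ i))"
  define b where "b = (\<chi> i. Im (z $ i))"
  have z: "z = cvec a + \<i> *s cvec b"
    by (simp add: a_def b_def cvec_def vec_eq_iff complex_eq)
  have "gaussian c z = (\<integral>u. exp (- of_real c * quad \<beta> (cvec (u + a) + \<i> *s cvec b)) \<partial>lborel)"
    by (simp add: gaussian_def z cvec_add add.assoc)
  also have "\<dots> = gaussian c (\<i> *s cvec b)"
    unfolding gaussian_def
    by (rule lborel_translate(1) [of "\<lambda>u. exp (- of_real c * quad \<beta> (cvec u + \<i> *s cvec b))"])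
       (intro borel_measurable_continuous_onI continuous_intros)
  finally show ?thesis using gaussian_shift_scaled [OF assms] by simp
qed

lemma gaussian_integrand_integrable:
  assumes c: "c > 0"
  shows "integrable lborel (\<lambda>u. exp (- of_real c * quad \<beta> (cvec u + z)))"
proof (rule Bochner_Integration.integrable_bound)
  define K where "K = c * bil_bound * norm z"
  show "integrable lborel (\<lambda>u :: real^'n. exp (norm (of_real c * quad \<beta> z)) * (exp (- c * quad \<beta> u) * exp (K * norm u)))"
    by (intro integrable_mult_right gauss_dominate c)
  show "(\<lambda>u. exp (- of_real c * quad \<beta> (cvec u + z))) \<in> borel_measurable lborel"
    by (simp add: borel_measurable_continuous_onI continuous_intros)
  have "norm (exp (- of_real c * quad \<beta> (cvec u + z))) \<le> exp (norm (of_real c * quad \<beta> z)) * (exp (- c * quad \<beta> u) * exp (K * norm u))" for u :: "real^'n"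
  proof -
    have "exp (- of_real c * quad \<beta> (cvec u + z)) = exp (- of_real c * quad \<beta> z) * (exp (of_real (- c * quad \<beta> u)) * exp (- of_real c * bil \<beta> (cvec u) z))"
      using bil_commute [of z "cvec u"] by (simp add: quad_add quad_cvec algebra_simps flip: exp_add)
    moreover have "norm (exp (of_real (- c * quad \<beta> u) :: complex)) = exp (- c * quad \<beta> u)"
      by (simp only: norm_exp_eq_Re Re_complex_of_real)
    moreover have "norm (exp (- of_real c * quad \<beta> z)) \<le> exp (norm (of_real c * quad \<beta> z))"
      using norm_exp [of "- of_real c * quad \<beta> z"] by simp
    moreover have "norm (exp (- of_real c * bil \<beta> (cvec u) z)) \<le> exp (K * norm u)"
    proof (rule order_trans [OF norm_exp])
      have "norm (bil \<beta> (cvec u) z) \<le> bil_bound * norm (cvec u) * norm z" by (rule norm_bil_le)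
      also have "\<dots> \<le> bil_bound * norm u * norm z"
        by (intro mult_right_mono mult_left_mono norm_le_componentwise_cart) (auto simp: cvec_def bil_bound_nonneg)
      finally have "c * norm (bil \<beta> (cvec u) z) \<le> c * (bil_bound * norm u * norm z)"
        using c by (intro mult_left_mono) auto
      then show "exp (norm (- of_real c * bil \<beta> (cvec u) z)) \<le> exp (K * norm u)"
        using c by (simp add: K_def norm_mult mult_ac)
    qed
    ultimately show ?thesis
      unfolding norm_mult by (simp only: norm_mult) (intro mult_mono mult_nonneg_nonneg, auto)
  qed
  then show "AE u in lborel. norm (exp (- of_real c * quad \<beta> (cvec u + z))) \<le> norm (exp (norm (of_real c * quad \<beta> z)) * (exp (- c * quad \<beta> u) * exp (K * norm u)))"
    by (intro AE_I2) (auto intro: order_trans [OF _ abs_ge_self])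
qed

lemma gaussian_scale:
  assumes "t > 0" "c > 0"
  shows "gaussian (c / t) 0 = of_real (sqrt t ^ CARD('n)) * gaussian c 0"
proof -
  define s where "s = sqrt t"
  have s: "s > 0" "s\<^sup>2 = t" using assms by (auto simp: s_def)
  define f where "f = (\<lambda>u :: real^'n. exp (- complex_of_real (c / t) * quad \<beta> (cvec u)))"
  have [measurable]: "f \<in> borel_measurable borel"
    unfolding f_def by (intro borel_measurable_continuous_onI continuous_intros)
  have fs: "f (s *\<^sub>R u) = exp (- of_real c * quad \<beta> (cvec u))" for u
  proof -
    have "cvec (s *\<^sub>R u) = of_real s *s cvec u" by (simp add: cvec_def vec_eq_iff)
    then show ?thesis using assms s by (simp add: f_def quad_scale flip: of_real_power)
  qed
  have "(\<integral>u. f u \<partial>lborel) = integral\<^sup>L (density (distr lborel borel (\<lambda>x :: real^'n. 0 + s *\<^sub>R x)) (\<lambda>_. \<bar>s\<bar> ^ DIM(real^'n))) f"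
    by (rule arg_cong [where f = "\<lambda>M. integral\<^sup>L M f"], rule lborel_affine) (use s in simp)
  also have "\<dots> = (\<integral>u. (\<bar>s\<bar> ^ DIM(real^'n)) *\<^sub>R f u \<partial>(distr lborel borel (\<lambda>x :: real^'n. 0 + s *\<^sub>R x)))"
    by (rule integral_density) auto
  also have "\<dots> = (\<integral>u. (\<bar>s\<bar> ^ DIM(real^'n)) *\<^sub>R f (0 + s *\<^sub>R u) \<partial>lborel)"
    by (rule integral_distr) auto
  also have "\<dots> = of_real (s ^ CARD('n)) * (\<integral>u. f (s *\<^sub>R u) \<partial>lborel)"
    using s by (simp add: scaleR_conv_of_real)
  finally show ?thesis unfolding fs by (simp add: gaussian_def f_def s_def)
qed

lemma gaussian_nonneg:
  obtains r where "r \<ge> 0" "gaussian c 0 = of_real r"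
proof
  have "gaussian c 0 = (\<integral>u. of_real (exp (- c * quad \<beta> u)) \<partial>lborel)"
    unfolding gaussian_def by (simp add: quad_cvec exp_of_real [symmetric])
  then show "gaussian c 0 = of_real (\<integral>u. exp (- c * quad \<beta> u) \<partial>lborel)"
    by (simp only: integral_complex_of_real)
  show "0 \<le> (\<integral>u. exp (- c * quad \<beta> u) \<partial>lborel)" by (rule integral_nonneg_AE) auto
qed

section \<open>The inversion formula and van der Blij's lemma\<close>

lemma thterm_inverse:
  assumes "\<tau> \<noteq> 0"
  shows "thterm x (- 1 / \<tau>) ((1 / \<tau>) *s z) * ee (- quad \<beta> z / \<tau>) = sgn_lat x * ee (- quad \<beta> (z - cvec (sv x)) / \<tau>)"
proof -
  have "quad \<beta> (cvec (sv x)) * (- 1 / \<tau>) + bil \<beta> (cvec (sv x)) ((1 / \<tau>) *s z) + - quad \<beta> z / \<tau>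
      = - quad \<beta> (z - cvec (sv x)) / \<tau>"
    using bil_commute [of z "cvec (sv x)"] by (simp add: quad_diff bil_scale_right add_divide_distrib diff_divide_distrib)
  then show ?thesis by (simp add: thterm_def mult.assoc flip: ee_add)
qed

text \<open>
  The factor in the inversion formula that Poisson summation does not evaluate. It is nonnegative by its
  definition, and equals 1 by the relations of the modular group.
\<close>
definition gauss_mass :: complex where
  "gauss_mass = gaussian (2 * pi) 0 / of_real (measure lborel (unit_cube :: (real^'n) set))"

text \<open>
  Poisson summation. Both sides, restricted to \<open>z + \<real>\<^sup>n\<close>, are quasi-periodic in the same way, so it
  suffices to compare their Fourier coefficients. For the left side, unfolding the integral over the cube gives
  a Gaussian integral over the whole space. Imaginary \<open>\<tau>\<close> makes the exponent real, so that Gaussian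
  integrals are independent of the translation.
\<close>
lemma inversion_imaginary:
  assumes t: "t > 0"
  defines "\<tau> \<equiv> \<i> * of_real t"
  shows "th (- 1 / \<tau>) ((1 / \<tau>) *s z) * ee (- quad \<beta> z / \<tau>)
     = inverse (tc\<^sup>2) * gauss_mass * of_real (sqrt t ^ CARD('n)) * th \<tau> z"
proof -
  let ?V = "complex_of_real (measure lborel (unit_cube :: (real^'n) set))"
  have V: "?V \<noteq> 0" using measure_unit_cube_pos [where 'n = 'n] by simp
  have \<tau>: "\<tau> \<in> upper_half_plane" "\<tau> \<noteq> 0" using t by (auto simp: \<tau>_def upper_half_plane_def)
  note \<tau>' = upper_half_plane_inverse [OF \<tau>(1)]
  define c where "c = 2 * pi / t"
  have c: "c > 0" using t by (simp add: c_def)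
  have ee_c: "ee (- y / \<tau>) = exp (- of_real c * y)" for y
  proof -
    have "2 * of_real pi * \<i> * (- y / \<tau>) = - of_real c * y"
      using t by (simp add: \<tau>_def c_def divide_simps)
    then show ?thesis by (simp only: ee_def)
  qed
  \<comment> \<open>the factor \<open>t\<^sup>n\<^sup>/\<^sup>2\<close> is hidden in the Gaussian integral and extracted at the end by scaling\<close>
  define \<kappa> where "\<kappa> = inverse (tc\<^sup>2) * gaussian c 0 / ?V"
  define H where "H = (\<lambda>u. th (- 1 / \<tau>) ((1 / \<tau>) *s (z + cvec u)) * ee (- quad \<beta> (z + cvec u) / \<tau>))"
  define F where "F = (\<lambda>u. th \<tau> (z + cvec u))"
  \<comment> \<open>The exponential factor makes the difference periodic.\<close>
  define h where "h = (\<lambda>u. ee (- bil \<beta> \<rho> (cvec u)) * (H u - \<kappa> * F u))"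
  have H_sum: "((\<lambda>x. sgn_lat x * ee (- quad \<beta> (z + cvec u - cvec (sv x)) / \<tau>)) has_sum H u) UNIV" for u
    unfolding H_def thterm_inverse [OF \<tau>(2), symmetric] by (intro has_sum_cmult_left th_has_sum \<tau>')
  have F_cont: "continuous_on UNIV F"
    unfolding F_def by (intro th_continuous continuous_intros \<tau>)
  have scale_cont: "continuous_on A (\<lambda>u. (1 / \<tau>) *s f u)" if "continuous_on A f" for f :: "real^'n \<Rightarrow> complex^'n" and A
    unfolding vector_scalar_mult_def using that by (intro continuous_intros)
  have H_cont: "continuous_on UNIV H"
    unfolding H_def using \<tau>(2) by (intro continuous_intros th_continuous scale_cont \<tau>') auto
  have bil_cont: "continuous_on UNIV (\<lambda>u. ee (- bil \<beta> \<rho> (cvec u)))" by (intro continuous_intros)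
  have h_cont: "continuous_on UNIV h"
    unfolding h_def by (intro continuous_intros bil_cont H_cont F_cont)
  have H_per: "H (u + rvec y) = sgn_lat y * H u" for u y
  proof -
    have bij: "bij (\<lambda>x :: int^'n. x + y)"
      by (rule bij_betw_byWitness [where f' = "\<lambda>x. x - y"]) auto
    have "((\<lambda>x. sgn_lat (x + y) * ee (- quad \<beta> (z + cvec (u + rvec y) - cvec (sv (x + y))) / \<tau>)) has_sum H (u + rvec y)) UNIV"
      using has_sum_reindex_bij_betw [OF bij, of "\<lambda>x. sgn_lat x * ee (- quad \<beta> (z + cvec (u + rvec y) - cvec (sv x)) / \<tau>)"] H_sum [of "u + rvec y"]
      by simp
    moreover have "sgn_lat (x + y) * ee (- quad \<beta> (z + cvec (u + rvec y) - cvec (sv (x + y))) / \<tau>)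
        = sgn_lat y * (sgn_lat x * ee (- quad \<beta> (z + cvec u - cvec (sv x)) / \<tau>))" for x
    proof -
      have "z + cvec (u + rvec y) - cvec (sv (x + y)) = z + cvec u - cvec (sv x)"
        by (simp add: sv_add cvec_add)
      then show ?thesis by (simp only: sgn_lat_add mult_ac)
    qed
    ultimately have "((\<lambda>x. sgn_lat y * (sgn_lat x * ee (- quad \<beta> (z + cvec u - cvec (sv x)) / \<tau>))) has_sum H (u + rvec y)) UNIV"
      by simp
    then show ?thesis by (rule has_sum_unique) (intro has_sum_cmult_right H_sum)
  qed
  have F_per: "F (u + rvec y) = sgn_lat y * F u" for u y
    using th_translate [OF \<tau>(1), of "z + cvec u" y] by (simp add: F_def cvec_add add.assoc)
  have h_per: "h (u + rvec y) = h u" for u y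
  proof -
    have "ee (- bil \<beta> \<rho> (cvec (u + rvec y))) = sgn_lat y * ee (- bil \<beta> \<rho> (cvec u))"
    proof -
      have "inverse (sgn_lat y) = sgn_lat y" using sgn_lat_sq [of y] by (rule inverse_unique)
      then show ?thesis using ee_bil_rho [of 0 y] by (simp add: cvec_add bil_add_right ee_add ee_minus ee_diff divide_inverse)
    qed
    moreover have "h (u + rvec y) = ee (- bil \<beta> \<rho> (cvec (u + rvec y))) * (sgn_lat y * (H u - \<kappa> * F u))"
      by (simp add: h_def H_per F_per algebra_simps)
    ultimately have "h (u + rvec y) = (sgn_lat y * sgn_lat y) * h u" by (simp only: h_def mult_ac)
    then show ?thesis by simp
  qed
  have int: "set_integrable lborel unit_cube (\<lambda>u. ee (- bil \<beta> \<rho> (cvec u)) * G u * fchar k u)"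
    if "continuous_on UNIV G" for G and k :: "int^'n"
  proof (rule set_integrable_subset)
    show "set_integrable lborel (cbox 0 1) (\<lambda>u. ee (- bil \<beta> \<rho> (cvec u)) * G u * fchar k u)"
      unfolding set_integrable_def
      by (intro borel_integrable_compact compact_cbox continuous_intros continuous_on_subset [OF that] continuous_on_subset [OF bil_cont]) auto
  qed (use unit_cube_subset in auto)
  have coeff: "(LINT u:unit_cube|lborel. h u * fchar k u) = 0" for k
  proof -
    obtain y where y: "k = - gram y"
      using bij_gram by (metis bij_pointE minus_minus)
    define s where "s = cvec (sv y)"
    have F_coeff: "(LINT u:unit_cube|lborel. ee (- bil \<beta> \<rho> (cvec u)) * F u * fchar k u) = ?V * thterm y \<tau> z"
      using theta_coefficient [of "\<lambda>_. 1" \<tau> z F y] th_has_sum [OF \<tau>(1)] by (simp add: y F_def)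
    define g where "g = (\<lambda>u. ee (- quad \<beta> (z - \<rho> + cvec u) / \<tau>) * ee (- bil \<beta> s (cvec u)))"
    \<comment> \<open>completing the square\<close>
    have g_eq: "g u = ee (bil \<beta> s (z - \<rho>) + \<tau> * quad \<beta> s) * exp (- of_real c * quad \<beta> (cvec u + (z - \<rho> + \<tau> *s s)))" for u
    proof -
      have "quad \<beta> (cvec u + (z - \<rho> + \<tau> *s s)) = quad \<beta> (z - \<rho> + cvec u) + \<tau> * (bil \<beta> s (z - \<rho>) + bil \<beta> s (cvec u)) + \<tau>\<^sup>2 * quad \<beta> s"
      proof -
        define w where "w = z - \<rho> + cvec u"
        have "cvec u + (z - \<rho> + \<tau> *s s) = w + \<tau> *s s" by (simp add: w_def algebra_simps)
        moreover have "bil \<beta> w s = bil \<beta> s (z - \<rho>) + bil \<beta> s (cvec u)"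
          using bil_commute [of w s] by (simp only: w_def bil_add_right)
        ultimately have "quad \<beta> (cvec u + (z - \<rho> + \<tau> *s s)) = quad \<beta> w + \<tau>\<^sup>2 * quad \<beta> s + \<tau> * (bil \<beta> s (z - \<rho>) + bil \<beta> s (cvec u))"
          by (simp only: quad_add quad_scale bil_scale_right)
        then show ?thesis by (simp add: w_def)
      qed
      then have "- quad \<beta> (z - \<rho> + cvec u) / \<tau> + - bil \<beta> s (cvec u)
         = (bil \<beta> s (z - \<rho>) + \<tau> * quad \<beta> s) + - quad \<beta> (cvec u + (z - \<rho> + \<tau> *s s)) / \<tau>"
        using \<tau>(2) by (simp add: field_simps power2_eq_square)
      then show ?thesis unfolding g_def ee_add [symmetric] ee_c [symmetric] by simp
    qed
    have "(LINT u:unit_cube|lborel. ee (- bil \<beta> \<rho> (cvec u)) * H u * fchar k u) = (\<integral>u. g u \<partial>lborel)"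
    proof (rule unfold_integral)
      show "integrable lborel g"
        unfolding g_eq by (intro integrable_mult_right gaussian_integrand_integrable c)
      fix u
      have "((\<lambda>x. ee (- bil \<beta> s (cvec u)) * (sgn_lat x * ee (- quad \<beta> (z + cvec u - cvec (sv x)) / \<tau>))) has_sum ee (- bil \<beta> s (cvec u)) * H u) UNIV"
        by (intro has_sum_cmult_right H_sum)
      moreover have "ee (- bil \<beta> s (cvec u)) * (sgn_lat x * ee (- quad \<beta> (z + cvec u - cvec (sv x)) / \<tau>)) = g (u - rvec x)" for x
      proof -
        have A: "z + cvec u - cvec (sv x) = z - \<rho> + cvec (u - rvec x)"
          by (simp add: cvec_sv cvec_diff algebra_simps)
        have B: "ee (- bil \<beta> s (cvec u)) * sgn_lat x = ee (- bil \<beta> s (cvec (u - rvec x)))"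
          using ee_bil_rho [of y x] by (simp add: s_def cvec_sv cvec_diff bil_diff_right ee_diff ee_minus divide_inverse mult_ac)
        show ?thesis unfolding g_def A B [symmetric] by (simp only: mult_ac)
      qed
      moreover have "ee (- bil \<beta> s (cvec u)) * H u = ee (- bil \<beta> \<rho> (cvec u)) * H u * fchar k u"
      proof -
        have fk: "fchar k u = ee (- bil \<beta> (vec_of_int y) (cvec u))"
          using fchar_add_left [of "gram y" "- gram y" u]
          by (simp add: y fchar_gram ee_minus) (metis fchar_0 inverse_unique)
        have "- bil \<beta> s (cvec u) = - bil \<beta> \<rho> (cvec u) + - bil \<beta> (vec_of_int y) (cvec u)"
          by (simp add: s_def cvec_sv bil_add_left)
        then show ?thesis by (simp only: ee_add fk mult_ac)
      qed
      ultimately show "((\<lambda>x. g (u - rvec x)) has_sum ee (- bil \<beta> \<rho> (cvec u)) * H u * fchar k u) UNIV"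
        by simp
    qed
    also have "\<dots> = ee (bil \<beta> s (z - \<rho>) + \<tau> * quad \<beta> s) * gaussian c 0"
      using gaussian_shift [OF c, of "z - \<rho> + \<tau> *s s"] by (simp add: g_eq gaussian_def)
    also have "ee (bil \<beta> s (z - \<rho>) + \<tau> * quad \<beta> s) = inverse (tc\<^sup>2) * thterm y \<tau> z"
    proof -
      have "ee (bil \<beta> s \<rho>) = tc\<^sup>2 * sgn_lat y"
        using ee_bil_rho [of 0 y] bil_commute [of "vec_of_int y" \<rho>]
        by (simp add: s_def cvec_sv bil_add_left ee_add tc_def ee_power quad_def)
      moreover have "inverse (sgn_lat y) = sgn_lat y" using sgn_lat_sq [of y] by (rule inverse_unique)
      ultimately have A: "ee (- bil \<beta> s \<rho>) = inverse (tc\<^sup>2) * sgn_lat y" by (simp add: ee_minus)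
      have B: "bil \<beta> s (z - \<rho>) + \<tau> * quad \<beta> s = - bil \<beta> s \<rho> + (quad \<beta> s * \<tau> + bil \<beta> s z)"
        by (simp add: bil_diff_right algebra_simps)
      show ?thesis
        unfolding B ee_add [of "- bil \<beta> s \<rho>"] A thterm_def s_def [symmetric] by (simp only: mult.assoc)
    qed
    finally have H_coeff: "(LINT u:unit_cube|lborel. ee (- bil \<beta> \<rho> (cvec u)) * H u * fchar k u) = inverse (tc\<^sup>2) * thterm y \<tau> z * gaussian c 0" .
    have "(LINT u:unit_cube|lborel. h u * fchar k u)
       = (LINT u:unit_cube|lborel. ee (- bil \<beta> \<rho> (cvec u)) * H u * fchar k u - \<kappa> * (ee (- bil \<beta> \<rho> (cvec u)) * F u * fchar k u))"
      by (simp add: h_def algebra_simps)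
    also have "\<dots> = (LINT u:unit_cube|lborel. ee (- bil \<beta> \<rho> (cvec u)) * H u * fchar k u) - (LINT u:unit_cube|lborel. \<kappa> * (ee (- bil \<beta> \<rho> (cvec u)) * F u * fchar k u))"
      by (intro set_integral_diff int H_cont set_integrable_mult_right F_cont)
    also have "\<dots> = 0"
      using V by (simp add: H_coeff F_coeff \<kappa>_def)
    finally show ?thesis .
  qed
  have "h 0 = 0" by (rule fourier_uniqueness [OF h_cont h_per coeff])
  then have "H 0 = \<kappa> * F 0" by (simp add: h_def)
  moreover have "cvec 0 = (0 :: complex^'n)" by (simp add: cvec_def vec_eq_iff)
  moreover have "\<kappa> = inverse (tc\<^sup>2) * gauss_mass * of_real (sqrt t ^ CARD('n))"
    using gaussian_scale [OF t, of "2 * pi"] by (simp add: \<kappa>_def gauss_mass_def c_def)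
  ultimately show ?thesis by (simp add: H_def F_def)
qed

end

lemma uhp_nonzero: "\<tau> \<in> upper_half_plane \<Longrightarrow> \<tau> \<noteq> 0"
  by (auto simp: upper_half_plane_def)

lemma uhp_rotate: "\<tau> \<in> upper_half_plane \<Longrightarrow> - \<i> * \<tau> \<notin> \<real>\<^sub>\<le>\<^sub>0"
  by (auto simp: upper_half_plane_def complex_nonpos_Reals_iff)

lemma csqrt_rotate_holomorphic: "(\<lambda>\<tau>. csqrt (- \<i> * \<tau>)) holomorphic_on upper_half_plane"
  by (intro holomorphic_intros) (use uhp_rotate in auto)

context unimodular_lattice begin

lemma gauss_mass_nonneg: "\<exists>r\<ge>0. gauss_mass = of_real r"
proof -
  obtain r where "r \<ge> 0" "gaussian (2 * pi) 0 = of_real r" by (rule gaussian_nonneg)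
  then show ?thesis
    using measure_unit_cube_pos [where 'n = 'n]
    by (intro exI [of _ "r / measure lborel (unit_cube :: (real^'n) set)"]) (auto simp: gauss_mass_def)
qed

text \<open>
  Both sides are holomorphic in \<open>\<tau>\<close> and agree on the imaginary axis.
\<close>
lemma inversion_up_to_mass:
  assumes \<tau>: "\<tau> \<in> upper_half_plane"
  shows "th (- 1 / \<tau>) ((1 / \<tau>) *s z) * ee (- quad \<beta> z / \<tau>)
     = inverse (tc\<^sup>2) * gauss_mass * csqrt (- \<i> * \<tau>) ^ CARD('n) * th \<tau> z"
proof -
  define f where "f = (\<lambda>\<tau>. th (- 1 / \<tau>) ((1 / \<tau>) *s z) * ee (- quad \<beta> z / \<tau>)
     - inverse (tc\<^sup>2) * gauss_mass * csqrt (- \<i> * \<tau>) ^ CARD('n) * th \<tau> z)"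
  have "(\<lambda>\<tau>. th \<tau> (1 *s z)) holomorphic_on upper_half_plane"
    by (intro th_compose_holomorphic holomorphic_intros open_upper_half_plane)
  then have 1: "(\<lambda>\<tau>. th \<tau> z) holomorphic_on upper_half_plane" by simp
  have 2: "(\<lambda>\<tau>. th (- 1 / \<tau>) ((1 / \<tau>) *s z)) holomorphic_on upper_half_plane"
    by (intro th_compose_holomorphic holomorphic_intros open_upper_half_plane upper_half_plane_inverse) (auto simp: uhp_nonzero)
  have f_hol: "f holomorphic_on upper_half_plane"
    unfolding f_def by (intro holomorphic_intros 1 2 csqrt_rotate_holomorphic) (auto simp: uhp_nonzero)
  have f_zero: "f w = 0" if "w \<in> (\<lambda>t. \<i> * of_real t) ` {0<..}" for w
  proof -
    obtain t where t: "t > 0" "w = \<i> * of_real t" using \<open>w \<in> _\<close> by auto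
    have "csqrt (- \<i> * w) = of_real (sqrt t)"
      using t by (simp add: csqrt_of_real_nonneg)
    then show ?thesis using inversion_imaginary [OF t(1), of z] by (simp add: f_def t(2))
  qed
  have lim: "\<i> islimpt (\<lambda>t. \<i> * of_real t) ` {0<..}"
    unfolding islimpt_approachable
  proof (intro allI impI)
    fix e :: real assume e: "e > 0"
    have "\<i> * of_real (1 + e / 2) - \<i> = \<i> * of_real (e / 2)" by (simp add: algebra_simps)
    then have "dist (\<i> * of_real (1 + e / 2)) \<i> = e / 2"
      unfolding dist_norm using e by (simp only:) (simp add: norm_mult)
    moreover have "\<i> * of_real (1 + e / 2) \<in> (\<lambda>t. \<i> * of_real t) ` {0<..}"
      by (rule imageI) (use e in simp)
    ultimately show "\<exists>x'\<in>(\<lambda>t. \<i> * of_real t) ` {0<..}. x' \<noteq> \<i> \<and> dist x' \<i> < e"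
      using e by (metis dist_self field_sum_of_halves less_add_same_cancel1 half_gt_zero less_irrefl)
  qed
  have sub: "(\<lambda>t. \<i> * of_real t) ` {0<..} \<subseteq> upper_half_plane" and i: "\<i> \<in> upper_half_plane"
    by (auto simp: upper_half_plane_def)
  have "f \<tau> = 0"
    by (rule analytic_continuation [OF f_hol open_upper_half_plane connected_upper_half_plane sub i lim f_zero \<tau>])
  then show ?thesis by (simp add: f_def)
qed

text \<open>
  Otherwise theta would vanish identically at \<open>\<tau> = \<i>\<close>, against the uniqueness of theta expansions.
\<close>
lemma gauss_mass_nonzero: "gauss_mass \<noteq> 0"
proof
  assume "gauss_mass = 0"
  have i: "\<i> \<in> upper_half_plane" by (simp add: upper_half_plane_def)
  have "th \<i> w = 0" for w
  proof -
    have "(1 / \<i>) *s (\<i> *s w) = w" by (simp add: vec_eq_iff)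
    then show ?thesis
      using inversion_up_to_mass [OF i, of "\<i> *s w"] \<open>gauss_mass = 0\<close> by simp
  qed
  then show False using th_not_identically_zero [OF i] by metis
qed

text \<open>
  The relation \<open>STS = T\<^sup>-\<^sup>1ST\<^sup>-\<^sup>1\<close> in the modular group, applied to theta at \<open>\<tau> = (1 + \<i>)/2\<close>. There
  \<open>TS\<tau> = \<i>\<close>, so one of the three square roots is 1, and the other two differ by the factor \<open>e(1/8)\<close>.
\<close>
lemma tc_gauss_mass: "tc * gauss_mass = ee (of_nat CARD('n) / 8)"
proof -
  define \<tau> where "\<tau> = (1 + \<i>) / 2"
  have i\<tau>: "\<i> * \<tau> = \<tau> - 1" by (simp add: \<tau>_def complex_eq_iff)
  have "\<tau> * (1 - \<i>) = 1" by (simp add: \<tau>_def complex_eq_iff)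
  then have inv\<tau>: "1 / \<tau> = 1 - \<i>" by (metis divide_inverse inverse_unique mult_1_left)
  then have 1: "1 - 1 / \<tau> = \<i>" by simp
  have \<tau>: "\<tau> \<in> upper_half_plane" "\<tau> - 1 \<in> upper_half_plane" "\<i> \<in> upper_half_plane" "- 1 / \<tau> \<in> upper_half_plane"
    "- 1 / \<i> - 1 \<in> upper_half_plane"
    by (auto simp: \<tau>_def upper_half_plane_def Im_divide)
  have nz: "\<tau> \<noteq> 0" "\<tau> - 1 \<noteq> 0" using uhp_nonzero [OF \<tau>(1)] uhp_nonzero [OF \<tau>(2)] by auto
  define C where "C = (\<lambda>\<tau>. inverse (tc\<^sup>2) * gauss_mass * csqrt (- \<i> * \<tau>) ^ CARD('n))"
  have S: "th (- 1 / \<sigma>) ((1 / \<sigma>) *s z) = ee (quad \<beta> z / \<sigma>) * C \<sigma> * th \<sigma> z" if "\<sigma> \<in> upper_half_plane" for \<sigma> z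
    using inversion_up_to_mass [OF that, of z] by (simp add: C_def ee_minus field_simps)
  obtain z where z: "th \<tau> z \<noteq> 0" by (rule th_not_identically_zero [OF \<tau>(1)])
  define y where "y = (1 / \<tau>) *s z"
  have y: "(1 / \<i>) *s y = (1 / (\<tau> - 1)) *s z"
  proof -
    have "(1 / \<i>) * (1 / \<tau>) = 1 / (\<tau> - 1)"
      unfolding i\<tau> [symmetric] by (simp only: times_divide_times_eq mult_1_left)
    then show ?thesis by (simp add: y_def vector_smult_assoc)
  qed
  have "th (- 1 / (\<tau> - 1)) ((1 / (\<tau> - 1)) *s z) = tc * th (- 1 / \<i>) ((1 / \<i>) *s y)"
  proof -
    have "- 1 / (\<tau> - 1) = - (1 / \<i>) * (1 / \<tau>)"
      unfolding i\<tau> [symmetric] by (simp only: times_divide_times_eq mult_1_left mult_minus_left minus_divide_left)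
    also have "\<dots> = - 1 / \<i> + 1" unfolding inv\<tau> by (simp add: algebra_simps)
    finally have "- 1 / (\<tau> - 1) = - 1 / \<i> + 1" .
    moreover have "- 1 / \<i> \<in> upper_half_plane" by (simp add: upper_half_plane_def)
    ultimately show ?thesis unfolding y [symmetric] by (simp only: th_T)
  qed
  also have "th (- 1 / \<i>) ((1 / \<i>) *s y) = ee (quad \<beta> y / \<i>) * C \<i> * th \<i> y" by (rule S [OF \<tau>(3)])
  also have "th \<i> y = tc * th (- 1 / \<tau>) y"
    using th_T [OF \<tau>(4), of y] 1 by (simp add: algebra_simps)
  also have "th (- 1 / \<tau>) y = ee (quad \<beta> z / \<tau>) * C \<tau> * th \<tau> z"
    unfolding y_def by (rule S [OF \<tau>(1)])
  also have "th \<tau> z = tc * th (\<tau> - 1) z" using th_T [OF \<tau>(2), of z] by simp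
  finally have L: "th (- 1 / (\<tau> - 1)) ((1 / (\<tau> - 1)) *s z) = ee (quad \<beta> y / \<i>) * ee (quad \<beta> z / \<tau>) * (tc ^ 3 * C \<i> * C \<tau>) * th (\<tau> - 1) z"
    by (simp add: power3_eq_cube mult_ac)
  have e: "quad \<beta> y / \<i> + quad \<beta> z / \<tau> = quad \<beta> z / (\<tau> - 1)"
  proof -
    have "(1 / \<tau>)\<^sup>2 / \<i> + 1 / \<tau> = 1 / (\<tau> - 1)"
    proof -
      have "(1 / \<tau>)\<^sup>2 / \<i> = 1 / (\<tau> * (\<i> * \<tau>))"
        by (simp only: power2_eq_square times_divide_times_eq divide_divide_eq_left mult_1_left mult_ac)
      then have "(1 / \<tau>)\<^sup>2 / \<i> = 1 / (\<tau> * (\<tau> - 1))" unfolding i\<tau> .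
      moreover have "1 / (\<tau> * (\<tau> - 1)) + 1 / \<tau> = 1 / (\<tau> - 1)" using nz by (simp add: divide_simps)
      ultimately show ?thesis by (simp only:)
    qed
    then have "quad \<beta> z * ((1 / \<tau>)\<^sup>2 / \<i> + 1 / \<tau>) = quad \<beta> z * (1 / (\<tau> - 1))" by simp
    then show ?thesis by (simp add: y_def quad_scale algebra_simps)
  qed
  have "ee (quad \<beta> z / (\<tau> - 1)) * C (\<tau> - 1) * th (\<tau> - 1) z = ee (quad \<beta> z / (\<tau> - 1)) * (tc ^ 3 * C \<i> * C \<tau>) * th (\<tau> - 1) z"
    using S [OF \<tau>(2), of z] L [folded ee_add, unfolded e] by (simp only:)
  moreover have "th (\<tau> - 1) z \<noteq> 0" using z th_T [OF \<tau>(2), of z] by auto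
  ultimately have CC: "C (\<tau> - 1) = tc ^ 3 * C \<i> * C \<tau>" by simp
  define r where "r = csqrt (- \<i> * \<tau>)"
  \<comment> \<open>The inequality keeps \<open>e(1/8) r\<close> in the right half plane, so it is the principal root of its square.\<close>
  have "Re r > 0 \<and> \<bar>Im r\<bar> < Re r"
  proof -
    have r2: "r\<^sup>2 = (1 - \<i>) / 2" by (simp add: r_def \<tau>_def algebra_simps diff_divide_distrib)
    have re: "(Re r)\<^sup>2 - (Im r)\<^sup>2 = 1 / 2" using arg_cong [OF r2, of Re] by (simp add: power2_eq_square)
    have ge: "Re r \<ge> 0" unfolding r_def using csqrt_principal [of "- \<i> * \<tau>"] by auto
    have "\<bar>Im r\<bar>\<^sup>2 < (Re r)\<^sup>2" using re by simp
    from power2_less_imp_less [OF this ge] have "\<bar>Im r\<bar> < Re r" .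
    then show ?thesis by auto
  qed
  define \<zeta> where "\<zeta> = ee (1 / 8)"
  have \<zeta>: "\<zeta> = Complex (sqrt 2 / 2) (sqrt 2 / 2)"
  proof -
    have "2 * of_real pi * \<i> * (1 / 8) = \<i> * of_real (pi / 4)" by simp
    then have "\<zeta> = cis (pi / 4)" by (simp add: \<zeta>_def ee_def cis_conv_exp)
    then show ?thesis by (simp add: cis.ctr cos_45 sin_45)
  qed
  have "csqrt (- \<i> * (\<tau> - 1)) = \<zeta> * r"
  proof (rule csqrt_unique)
    have "\<zeta>\<^sup>2 = \<i>" by (simp add: \<zeta> power2_eq_square complex_eq_iff)
    moreover have "r\<^sup>2 = - \<i> * \<tau>" by (simp add: r_def)
    ultimately have "(\<zeta> * r)\<^sup>2 = \<i> * (- \<i> * \<tau>)" by (simp only: power_mult_distrib)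
    also have "\<dots> = - \<i> * (\<tau> - 1)" by (simp add: \<tau>_def complex_eq_iff)
    finally show "(\<zeta> * r)\<^sup>2 = - \<i> * (\<tau> - 1)" .
    have "Re (\<zeta> * r) = sqrt 2 / 2 * (Re r - Im r)" by (simp add: \<zeta> algebra_simps)
    also have "\<dots> > 0" using \<open>Re r > 0 \<and> \<bar>Im r\<bar> < Re r\<close> by auto
    finally show "0 < Re (\<zeta> * r) \<or> Re (\<zeta> * r) = 0 \<and> 0 \<le> Im (\<zeta> * r)" by simp
  qed
  then have C\<tau>': "C (\<tau> - 1) = inverse (tc\<^sup>2) * gauss_mass * (\<zeta> ^ CARD('n) * r ^ CARD('n))"
    by (simp only: C_def power_mult_distrib)
  have Ci: "C \<i> = inverse (tc\<^sup>2) * gauss_mass" by (simp add: C_def)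
  have C\<tau>: "C \<tau> = inverse (tc\<^sup>2) * gauss_mass * r ^ CARD('n)" by (simp only: C_def r_def)
  have cancel: "x = a * G" if "inverse (a\<^sup>2) * G * (x * R) = a ^ 3 * (inverse (a\<^sup>2) * G) * (inverse (a\<^sup>2) * G * R)"
    "a \<noteq> 0" "G \<noteq> 0" "R \<noteq> 0" for a G x R :: complex
    using that by (simp add: field_simps power2_eq_square power3_eq_cube)
  have "r \<noteq> 0" using \<open>Re r > 0 \<and> \<bar>Im r\<bar> < Re r\<close> by auto
  then have "\<zeta> ^ CARD('n) = tc * gauss_mass"
    using cancel [OF CC [unfolded C\<tau>' Ci C\<tau>]] gauss_mass_nonzero by simp
  then show ?thesis by (simp add: \<zeta>_def ee_power)
qed

text \<open>
  Compare absolute values: the mass is nonnegative and the multiplier has modulus 1.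
\<close>
lemma gauss_mass_eq_1: "gauss_mass = 1"
proof -
  obtain r where r: "r \<ge> 0" "gauss_mass = of_real r" using gauss_mass_nonneg by blast
  have "norm (ee (of_real (real CARD('n) / 8))) = 1" by (simp only: norm_ee Im_complex_of_real) simp
  then have "norm (ee (of_nat CARD('n) / 8)) = 1" by simp
  then have "norm (tc * gauss_mass) = 1" by (simp only: tc_gauss_mass)
  then show ?thesis using r by (simp add: norm_mult norm_tc)
qed

text \<open>
  In terms of the lattice: \<open>\<beta>(r) \<equiv> n/8\<close> modulo 1 for \<open>r\<close> in the shadow.
\<close>
theorem van_der_Blij: "tc = ee (of_nat CARD('n) / 8)"
  using tc_gauss_mass by (simp add: gauss_mass_eq_1)

theorem theta_inversion:
  assumes "\<tau> \<in> upper_half_plane"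
  shows "th (- 1 / \<tau>) ((1 / \<tau>) *s z) * ee (- quad \<beta> z / \<tau>)
     = inverse (tc\<^sup>2) * csqrt (- \<i> * \<tau>) ^ CARD('n) * th \<tau> z"
  using inversion_up_to_mass [OF assms, of z] by (simp add: gauss_mass_eq_1)

end

section \<open>The inversion formula of the eta function\<close>

lemma eta_T: "\<tau> \<in> upper_half_plane \<Longrightarrow> eta (\<tau> + 1) = ee (1 / 24) * eta \<tau>"
proof -
  assume \<tau>: "\<tau> \<in> upper_half_plane"
  then have "\<tau> + 1 \<in> upper_half_plane" by (simp add: upper_half_plane_def)
  moreover have "ee (\<tau> + 1) = ee \<tau>" by (rule ee_eqI) simp
  ultimately show ?thesis using \<tau> by (simp add: eta_eq add_divide_distrib ee_add)
qed

text \<open>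
  Jacobi's identity, symmetrized: the terms at \<open>k\<close> and \<open>-1 - k\<close> agree, which turns the sum over the natural
  numbers into half a sum over \<open>\<int>\<close>.
\<close>
lemma eta_cube_series:
  assumes "\<tau> \<in> upper_half_plane"
  shows "((\<lambda>k :: int. (of_int k + 1/2) * ee ((of_int k)\<^sup>2 / 2) * ee ((of_int k + 1/2)\<^sup>2 / 2 * \<tau>)) has_sum eta \<tau> ^ 3) UNIV"
proof -
  define q where "q = ee \<tau>"
  have q: "norm q < 1" "q \<noteq> 0" using norm_ee_less_1 assms by (auto simp: q_def)
  define T where "T = (\<lambda>k :: int. (of_int k + 1/2) * ee ((of_int k)\<^sup>2 / 2) * ee ((of_int k + 1/2)\<^sup>2 / 2 * \<tau>))"
  define c where "c = (\<lambda>j::nat. (2 * of_nat j + 1) * (- 1) ^ j * q ^ (Suc j choose 2))"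
  have sq: "ee ((of_nat j)\<^sup>2 / 2) = (- 1) ^ j" for j
  proof -
    have "ee ((of_nat j)\<^sup>2 / 2) = ee (1 / 2) ^ (j * j)" by (simp add: ee_power power2_eq_square)
    also have "ee (1 / 2) = - 1" by (simp add: ee_def)
    finally show ?thesis by (simp add: minus_one_power_iff)
  qed
  have Q: "ee ((of_nat j + 1/2)\<^sup>2 / 2 * \<tau>) = ee (\<tau> / 8) * q ^ (Suc j choose 2)" for j
  proof -
    have "of_nat (2 * (Suc j choose 2)) = (of_nat (j * Suc j) :: complex)" by (simp only: triangle_choose)
    then have "of_nat (Suc j choose 2) = (of_nat j * (of_nat j + 1) / 2 :: complex)" by (simp add: field_simps)
    then have "(of_nat j + 1/2)\<^sup>2 / 2 * \<tau> = \<tau> / 8 + of_nat (Suc j choose 2) * \<tau>"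
      by (simp only:) (simp add: power2_eq_square field_simps)
    then show ?thesis by (simp only: q_def ee_power ee_add)
  qed
  have Tpos: "T (int j) = 1/2 * ee (\<tau> / 8) * c j" for j
    using sq [of j] Q [of j] by (simp add: T_def c_def field_simps)
  have Tneg: "T (- 1 - int j) = 1/2 * ee (\<tau> / 8) * c j" for j
  proof -
    have "(of_int (- 1 - int j) :: complex) = - of_nat (Suc j)" by simp
    moreover have "(- of_nat (Suc j) + 1/2)\<^sup>2 = (of_nat j + 1/2 :: complex)\<^sup>2"
    proof -
      have "- of_nat (Suc j) + 1/2 = - (of_nat j + 1/2 :: complex)" by (simp add: field_simps)
      then show ?thesis by (simp only: power2_minus)
    qed
    moreover have "ee ((- of_nat (Suc j))\<^sup>2 / 2) = (- 1) ^ Suc j" using sq [of "Suc j"] by (simp only: power2_minus)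
    ultimately have "T (- 1 - int j) = (- of_nat (Suc j) + 1/2) * (- 1) ^ Suc j * (ee (\<tau> / 8) * q ^ (Suc j choose 2))"
      unfolding T_def by (simp only: Q)
    moreover have "(- of_nat (Suc j) + 1/2) * (- 1) ^ Suc j = 1/2 * ((2 * of_nat j + 1) * (- 1 :: complex) ^ j)"
    proof -
      have "- of_nat (Suc j) + 1/2 = - (1/2 * (2 * of_nat j + 1) :: complex)" by (simp add: field_simps)
      then show ?thesis by (simp only:) simp
    qed
    ultimately have "T (- 1 - int j) = 1/2 * ((2 * of_nat j + 1) * (- 1 :: complex) ^ j) * (ee (\<tau> / 8) * q ^ (Suc j choose 2))"
      by (simp only:)
    then show ?thesis by (simp only: c_def mult_ac)
  qed
  have c: "(c has_sum euler_prod q ^ 3) UNIV"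
    using norm_summable_imp_has_sum jacobi_identity [OF q] by (simp add: c_def)
  have half: "((\<lambda>j. 1/2 * ee (\<tau> / 8) * c j) has_sum 1/2 * ee (\<tau> / 8) * euler_prod q ^ 3) UNIV"
    by (rule has_sum_cmult_right [OF c])
  have 1: "(T has_sum 1/2 * ee (\<tau> / 8) * euler_prod q ^ 3) (range int)"
    by (subst has_sum_reindex) (use half in \<open>simp_all add: o_def Tpos inj_on_def\<close>)
  have 2: "(T has_sum 1/2 * ee (\<tau> / 8) * euler_prod q ^ 3) (range (\<lambda>j. - 1 - int j))"
    by (subst has_sum_reindex) (use half in \<open>simp_all add: o_def Tneg inj_on_def\<close>)
  have "range int \<union> range (\<lambda>j. - 1 - int j) = UNIV"
  proof -
    have "k \<in> range int \<union> range (\<lambda>j. - 1 - int j)" for k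
    proof (cases "k \<ge> 0")
      case True
      then have "k = int (nat k)" by simp
      then show ?thesis by blast
    next
      case False
      then have "k = - 1 - int (nat (- 1 - k))" by simp
      then show ?thesis by blast
    qed
    then show ?thesis by blast
  qed
  moreover have "range int \<inter> range (\<lambda>j. - 1 - int j) = {}" by auto
  ultimately have "(T has_sum 1/2 * ee (\<tau> / 8) * euler_prod q ^ 3 + 1/2 * ee (\<tau> / 8) * euler_prod q ^ 3) UNIV"
    using has_sum_Un_disjoint [OF 1 2] by simp
  moreover have "1/2 * ee (\<tau> / 8) * euler_prod q ^ 3 + 1/2 * ee (\<tau> / 8) * euler_prod q ^ 3 = eta \<tau> ^ 3"
    using assms by (simp add: eta_eq q_def power_mult_distrib ee_power)
  ultimately show ?thesis by (simp add: T_def)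
qed

text \<open>
  The lattice \<open>\<int>\<close>, whose theta function governs the eta function.
\<close>
definition Z_form :: "int^1 \<Rightarrow> int^1 \<Rightarrow> int" where "Z_form x y = x $ 1 * y $ 1"

lemma bil_Z_form: "bil Z_form x y = x $ 1 * y $ 1"
  by (simp add: bil_def Z_form_def sum_1)

interpretation Z1: unimodular_lattice Z_form
proof
  show "integral_lattice Z_form" by (simp add: integral_lattice_def Z_form_def algebra_simps)
  show "positive_definite Z_form"
    by (auto simp: positive_definite_def Z_form_def vec_eq_iff zero_less_mult_iff)
  have "r \<in> dual_lattice Z_form \<longleftrightarrow> r \<in> range vec_of_int" for r :: "rat^1"
  proof
    assume "r \<in> dual_lattice Z_form"
    then have "bil Z_form r (vec_of_int 1) \<in> \<int>" by (auto simp: dual_lattice_def)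
    then obtain n where "r $ 1 = of_int n" by (auto simp: bil_Z_form vec_of_int_def elim: Ints_cases)
    then have "r = vec_of_int (\<chi> i. n)" by (simp add: vec_eq_iff vec_of_int_def)
    then show "r \<in> range vec_of_int" by blast
  qed (auto simp: dual_lattice_def bil_Z_form vec_of_int_def)
  then show "unimodular Z_form" unfolding unimodular_def by blast
qed

text \<open>
  Differentiating the theta series of \<open>\<int>\<close> at \<open>z = 0\<close> produces the factors \<open>k + 1/2\<close> of the series for
  \<open>\<eta>\<^sup>3\<close>. The constant depends on the base point chosen in the shadow \<open>\<int> + 1/2\<close>.
\<close>
lemma eta_cube_theta:
  obtains c where "c \<noteq> 0"
    "\<And>\<tau>. \<tau> \<in> upper_half_plane \<Longrightarrow> ((\<lambda>w. Z1.th \<tau> (w *s 1)) has_field_derivative c * eta \<tau> ^ 3) (at 0)"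
proof -
  have "Z1.r0 \<in> shadow Z_form" by (rule Z1.r0_shadow)
  then have "bil Z_form Z1.r0 (vec_of_int 1) - quad Z_form (vec_of_int 1) \<in> \<int>" by (auto simp: shadow_def)
  then obtain m where m: "Z1.r0 $ 1 - 1/2 = of_int m"
    by (auto simp: bil_Z_form quad_def vec_of_int_def elim: Ints_cases)
  then have r0: "Z1.r0 $ 1 = 1/2 + of_int m" by (simp add: algebra_simps)
  define c where "c = 2 * of_real pi * \<i> * ee ((of_int m)\<^sup>2 / 2)"
  have sv: "cvec (Z1.sv x) $ 1 = of_int (x $ 1 + m) + 1/2" for x
    by (simp add: Z1.sv_def cvec_def vec_of_rat_def vec_of_int_def r0 of_rat_add of_rat_divide)
  show thesis
  proof (rule that)
    show "c \<noteq> 0" by (simp add: c_def)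
    fix \<tau> assume \<tau>: "\<tau> \<in> upper_half_plane"
    obtain D where D: "((\<lambda>p. Z1.th (fst p) (snd p)) has_derivative D) (at (\<tau>, 0))"
      "\<And>h. ((\<lambda>x. 2 * of_real pi * \<i> * (quad Z_form (cvec (Z1.sv x)) * fst h + bil Z_form (cvec (Z1.sv x)) (snd h)) * Z1.thterm x \<tau> 0) has_sum D h) UNIV"
      using Z1.th_has_derivative [OF \<tau>, of 0] by blast
    have bij: "bij (\<lambda>k :: int. (\<chi> i. k - m) :: int^1)"
      by (rule bij_betw_byWitness [where f' = "\<lambda>x. x $ 1 + m"]) (auto simp: vec_eq_iff)
    have reindexed: "((\<lambda>k :: int. 2 * of_real pi * \<i> * (quad Z_form (cvec (Z1.sv (\<chi> i. k - m))) * fst h + bil Z_form (cvec (Z1.sv (\<chi> i. k - m))) (snd h)) * Z1.thterm (\<chi> i. k - m) \<tau> 0) has_sum D h) UNIV" for h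
      by (subst has_sum_reindex_bij_betw [OF bij]) (rule D(2))
    have summand: "2 * of_real pi * \<i> * (quad Z_form (cvec (Z1.sv (\<chi> i. k - m))) * fst (0, h *s 1) + bil Z_form (cvec (Z1.sv (\<chi> i. k - m))) (snd (0, h *s 1))) * Z1.thterm (\<chi> i. k - m) \<tau> 0
       = c * h * ((of_int k + 1/2) * ee ((of_int k)\<^sup>2 / 2) * ee ((of_int k + 1/2)\<^sup>2 / 2 * \<tau>))" for k h
    proof -
      have A: "Z1.sgn_lat (\<chi> i. k - m) = ee ((of_int k)\<^sup>2 / 2) * ee ((of_int m)\<^sup>2 / 2)"
        unfolding Z1.sgn_lat_def ee_add [symmetric]
      proof (rule ee_eqI)
        have "quad Z_form (vec_of_int (\<chi> i. k - m)) - ((of_int k)\<^sup>2 / 2 + (of_int m)\<^sup>2 / 2) = (of_int (- k * m) :: complex)"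
          by (simp add: quad_def bil_Z_form vec_of_int_def power2_eq_square field_simps)
        then show "quad Z_form (vec_of_int (\<chi> i. k - m)) - ((of_int k)\<^sup>2 / 2 + (of_int m)\<^sup>2 / 2) \<in> (\<int> :: complex set)"
          by (simp only: Ints_of_int)
      qed
      have B: "quad Z_form (cvec (Z1.sv (\<chi> i. k - m))) = (of_int k + 1/2)\<^sup>2 / 2"
        by (simp add: quad_def bil_Z_form sv power2_eq_square)
      show ?thesis
        unfolding Z1.thterm_def A B bil_Z_form by (simp add: c_def sv mult_ac)
    qed
    have hsum: "((\<lambda>k. c * h * ((of_int k + 1/2) * ee ((of_int k)\<^sup>2 / 2) * ee ((of_int k + 1/2)\<^sup>2 / 2 * \<tau>))) has_sum D (0, h *s 1)) UNIV" for h
      using reindexed [of "(0, h *s 1)"] by (simp only: summand)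
    have Dh: "D (0, h *s 1) = c * eta \<tau> ^ 3 * h" for h
    proof -
      have "D (0, h *s 1) = c * h * eta \<tau> ^ 3"
        by (rule has_sum_unique [OF hsum has_sum_cmult_right [OF eta_cube_series [OF \<tau>]]])
      then show ?thesis by (simp only: mult_ac)
    qed
    have "((\<lambda>w. (\<tau>, w *s 1 :: complex^1)) has_derivative (\<lambda>h. (0, h *s 1))) (at 0)"
      by (intro has_derivative_Pair has_derivative_const bounded_linear_imp_has_derivative Z1.bounded_linear_scale_vec)
    from diff_chain_at [OF this, of "\<lambda>p. Z1.th (fst p) (snd p)" D] D(1)
    have "((\<lambda>w. Z1.th \<tau> (w *s 1)) has_derivative (\<lambda>h. D (0, h *s 1))) (at 0)"
      by (simp add: o_def)
    then show "((\<lambda>w. Z1.th \<tau> (w *s 1)) has_field_derivative c * eta \<tau> ^ 3) (at 0)"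
      unfolding has_field_derivative_def Dh .
  qed
qed

text \<open>
  The function takes finitely many values, and the half plane is connected.
\<close>
lemma continuous_power_constant:
  assumes f: "continuous_on upper_half_plane f" and pow: "\<And>\<tau>. \<tau> \<in> upper_half_plane \<Longrightarrow> f \<tau> ^ N = (c :: complex)"
    and "N > 0" "\<tau> \<in> upper_half_plane" "\<sigma> \<in> upper_half_plane"
  shows "f \<tau> = f \<sigma>"
proof -
  have "finite (f ` upper_half_plane)"
    by (rule finite_subset [OF _ finite_nth_roots [OF \<open>N > 0\<close>, of c]]) (use pow in auto)
  then have "f constant_on upper_half_plane"
    by (rule continuous_finite_range_constant [OF connected_upper_half_plane f])
  then show ?thesis using assms by (auto simp: constant_on_def)
qed

text \<open>
  Differentiating the inversion formula of the theta function of \<open>\<int>\<close> at \<open>z = 0\<close> gives the cube of the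
  claim. The cube root of unity that remains is constant on the half plane and equals 1 at \<open>\<tau> = \<i>\<close>.
\<close>
theorem eta_inversion:
  assumes \<tau>: "\<tau> \<in> upper_half_plane"
  shows "eta (- 1 / \<tau>) = csqrt (- \<i> * \<tau>) * eta \<tau>"
proof -
  obtain c where c: "c \<noteq> 0"
    "\<And>\<tau>. \<tau> \<in> upper_half_plane \<Longrightarrow> ((\<lambda>w. Z1.th \<tau> (w *s 1)) has_field_derivative c * eta \<tau> ^ 3) (at 0)"
    using eta_cube_theta by blast
  have tc: "inverse (Z1.tc\<^sup>2) = - \<i>"
  proof -
    have "Z1.tc\<^sup>2 = ee (1 / 4)" by (simp add: Z1.van_der_Blij ee_power)
    also have "\<dots> = exp (\<i> * of_real (pi / 2))" by (simp add: ee_def)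
    also have "\<dots> = cis (pi / 2)" by (simp only: cis_conv_exp)
    also have "\<dots> = \<i>" by simp
    finally show ?thesis by simp
  qed
  have cube: "eta (- 1 / \<tau>) ^ 3 = (csqrt (- \<i> * \<tau>) * eta \<tau>) ^ 3" if \<tau>: "\<tau> \<in> upper_half_plane" for \<tau>
  proof -
    have nz: "\<tau> \<noteq> 0" using uhp_nonzero \<tau> by blast
    define L where "L = (\<lambda>w. Z1.th (- 1 / \<tau>) ((w / \<tau>) *s 1) * ee (- w\<^sup>2 / (2 * \<tau>)))"
    have "((\<lambda>w. Z1.th (- 1 / \<tau>) (w *s 1)) has_field_derivative c * eta (- 1 / \<tau>) ^ 3) (at (0 / \<tau>))"
      using c(2) [OF upper_half_plane_inverse [OF \<tau>]] by simp
    then have 1: "((\<lambda>w. Z1.th (- 1 / \<tau>) ((w / \<tau>) *s 1)) has_field_derivative c * eta (- 1 / \<tau>) ^ 3 * (1 / \<tau>)) (at 0)"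
      by (rule DERIV_chain2) (auto intro!: derivative_eq_intros simp: nz)
    have 2: "((\<lambda>w. ee (- w\<^sup>2 / (2 * \<tau>))) has_field_derivative 0) (at 0)"
      unfolding ee_def by (auto intro!: derivative_eq_intros simp: nz)
    have "(L has_field_derivative c * eta (- 1 / \<tau>) ^ 3 * (1 / \<tau>)) (at 0)"
      using DERIV_mult [OF 1 2] by (simp add: L_def)
    moreover have "L w = - \<i> * csqrt (- \<i> * \<tau>) * Z1.th \<tau> (w *s 1)" for w
    proof -
      have A: "(1 / \<tau>) *s (w *s 1) = (w / \<tau>) *s (1 :: complex^1)" by (simp add: vec_eq_iff)
      have Q: "quad Z_form (w *s 1) = w\<^sup>2 / 2" by (simp add: quad_def bil_Z_form power2_eq_square)
      show ?thesis
        using Z1.theta_inversion [OF \<tau>, of "w *s 1"] unfolding A Q tc by (simp add: L_def)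
    qed
    then have "L = (\<lambda>w. - \<i> * csqrt (- \<i> * \<tau>) * Z1.th \<tau> (w *s 1))" by blast
    moreover have "((\<lambda>w. - \<i> * csqrt (- \<i> * \<tau>) * Z1.th \<tau> (w *s 1)) has_field_derivative - \<i> * csqrt (- \<i> * \<tau>) * (c * eta \<tau> ^ 3)) (at 0)"
      by (intro DERIV_cmult c(2) \<tau>)
    ultimately have "c * eta (- 1 / \<tau>) ^ 3 * (1 / \<tau>) = - \<i> * csqrt (- \<i> * \<tau>) * (c * eta \<tau> ^ 3)"
      using DERIV_unique by metis
    then have "c * eta (- 1 / \<tau>) ^ 3 = c * (csqrt (- \<i> * \<tau>) * (- \<i> * \<tau>) * eta \<tau> ^ 3)"
      using nz by (simp add: field_simps)
    then have "eta (- 1 / \<tau>) ^ 3 = csqrt (- \<i> * \<tau>) * (- \<i> * \<tau>) * eta \<tau> ^ 3"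
      by (rule mult_left_cancel [OF c(1), THEN iffD1])
    also have "csqrt (- \<i> * \<tau>) * (- \<i> * \<tau>) = csqrt (- \<i> * \<tau>) ^ 3"
    proof -
      have "csqrt (- \<i> * \<tau>) ^ 3 = csqrt (- \<i> * \<tau>) * (csqrt (- \<i> * \<tau>))\<^sup>2"
        by (simp only: power3_eq_cube power2_eq_square mult.assoc)
      then show ?thesis by (simp only: power2_csqrt)
    qed
    finally show ?thesis by (simp only: power_mult_distrib)
  qed
  have nz: "csqrt (- \<i> * \<tau>) \<noteq> 0" "eta \<tau> \<noteq> 0" if "\<tau> \<in> upper_half_plane" for \<tau>
    using that uhp_nonzero eta_nonzero by auto
  define E where "E = (\<lambda>\<tau>. eta (- 1 / \<tau>) / (csqrt (- \<i> * \<tau>) * eta \<tau>))"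
  have "(\<lambda>\<tau>. - 1 / \<tau>) holomorphic_on upper_half_plane"
    by (intro holomorphic_intros) (rule uhp_nonzero)
  then have "(eta \<circ> (\<lambda>\<tau>. - 1 / \<tau>)) holomorphic_on upper_half_plane"
    by (rule holomorphic_on_compose_gen [OF _ eta_holomorphic]) (use upper_half_plane_inverse in blast)
  then have "(\<lambda>\<tau>. eta (- 1 / \<tau>)) holomorphic_on upper_half_plane" by (simp only: o_def)
  then have "E holomorphic_on upper_half_plane"
    unfolding E_def using nz by (intro holomorphic_intros csqrt_rotate_holomorphic eta_holomorphic) auto
  then have cont: "continuous_on upper_half_plane E" by (rule holomorphic_on_imp_continuous_on)
  have pow: "E \<tau> ^ 3 = 1" if "\<tau> \<in> upper_half_plane" for \<tau>
    using cube [OF that] nz [OF that] by (simp add: E_def power_divide)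
  have i: "\<i> \<in> upper_half_plane" by (simp add: upper_half_plane_def)
  have "E \<tau> = E \<i>" by (rule continuous_power_constant [OF cont pow _ \<tau> i]) auto
  also have "E \<i> = 1" using nz(2) [OF i] by (simp add: E_def)
  finally show ?thesis using nz [OF \<tau>] by (simp add: E_def field_simps)
qed

section \<open>The modular group\<close>

lemma SL2Z_det: "A \<in> SL2Z \<longleftrightarrow> A $ 1 $ 1 * A $ 2 $ 2 - A $ 1 $ 2 * A $ 2 $ 1 = 1"
  by (simp add: SL2Z_def det_2)

lemma cocycle_nonzero:
  assumes "A \<in> SL2Z" "\<tau> \<in> upper_half_plane"
  shows "cocycle A \<tau> \<noteq> 0"
proof
  assume 0: "cocycle A \<tau> = 0"
  have "of_int (A $ 2 $ 1) * Im \<tau> = 0" using arg_cong [OF 0, of Im] by (simp add: cocycle_def)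
  then have "A $ 2 $ 1 = 0" using assms by (simp add: upper_half_plane_def)
  with 0 have "A $ 2 $ 2 = 0" by (simp add: cocycle_def)
  with \<open>A $ 2 $ 1 = 0\<close> show False using assms by (simp add: SL2Z_det)
qed

lemma Im_moebius:
  assumes "A \<in> SL2Z" "\<tau> \<in> upper_half_plane"
  shows "Im (moebius_act A \<tau>) = Im \<tau> / (norm (cocycle A \<tau>))\<^sup>2"
proof -
  let ?a = "real_of_int (A $ 1 $ 1)" and ?b = "real_of_int (A $ 1 $ 2)" and ?c = "real_of_int (A $ 2 $ 1)" and ?d = "real_of_int (A $ 2 $ 2)"
  have "real_of_int (A $ 1 $ 1 * A $ 2 $ 2 - A $ 1 $ 2 * A $ 2 $ 1) = 1"
    using assms by (simp only: SL2Z_det of_int_1)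
  then have det: "?a * ?d - ?b * ?c = 1" by simp
  have "Im ((of_int (A $ 1 $ 1) * \<tau> + of_int (A $ 1 $ 2)) * cnj (cocycle A \<tau>)) = (?a * ?d - ?b * ?c) * Im \<tau>"
    by (simp add: cocycle_def algebra_simps)
  also have "\<dots> = Im \<tau>" by (simp add: det)
  finally show ?thesis
    unfolding moebius_act_def by (subst complex_div_cnj) (simp add: Im_divide_of_real flip: of_real_power)
qed

lemma moebius_uhp:
  assumes "A \<in> SL2Z" "\<tau> \<in> upper_half_plane"
  shows "moebius_act A \<tau> \<in> upper_half_plane"
  using assms cocycle_nonzero [OF assms] by (simp add: upper_half_plane_def Im_moebius)

lemma SL2Z_mult: "A \<in> SL2Z \<Longrightarrow> B \<in> SL2Z \<Longrightarrow> A ** B \<in> SL2Z"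
  by (simp add: SL2Z_def det_mul)

lemma cocycle_mult:
  assumes "B \<in> SL2Z" "\<tau> \<in> upper_half_plane"
  shows "cocycle (A ** B) \<tau> = cocycle A (moebius_act B \<tau>) * cocycle B \<tau>"
  using cocycle_nonzero [OF assms]
  by (simp add: cocycle_def [of A] cocycle_def [of "A ** B"] moebius_act_def matrix_matrix_mult_def sum_2 field_simps)
     (simp add: cocycle_def algebra_simps)

lemma moebius_mult:
  assumes "A \<in> SL2Z" "B \<in> SL2Z" "\<tau> \<in> upper_half_plane"
  shows "moebius_act (A ** B) \<tau> = moebius_act A (moebius_act B \<tau>)"
proof -
  define \<sigma> where "\<sigma> = moebius_act B \<tau>"
  have nB: "cocycle B \<tau> \<noteq> 0" by (rule cocycle_nonzero [OF assms(2,3)])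
  have nA: "cocycle A \<sigma> \<noteq> 0" unfolding \<sigma>_def by (intro cocycle_nonzero moebius_uhp assms)
  have \<sigma>: "\<sigma> * cocycle B \<tau> = of_int (B $ 1 $ 1) * \<tau> + of_int (B $ 1 $ 2)"
    using nB by (simp add: \<sigma>_def moebius_act_def)
  have "of_int ((A ** B) $ 1 $ 1) * \<tau> + of_int ((A ** B) $ 1 $ 2)
      = of_int (A $ 1 $ 1) * (of_int (B $ 1 $ 1) * \<tau> + of_int (B $ 1 $ 2)) + of_int (A $ 1 $ 2) * cocycle B \<tau>"
    by (simp add: matrix_matrix_mult_def sum_2 cocycle_def algebra_simps)
  also have "\<dots> = (of_int (A $ 1 $ 1) * \<sigma> + of_int (A $ 1 $ 2)) * cocycle B \<tau>"
    unfolding \<sigma> [symmetric] by (simp add: algebra_simps)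
  finally have "moebius_act (A ** B) \<tau> = ((of_int (A $ 1 $ 1) * \<sigma> + of_int (A $ 1 $ 2)) * cocycle B \<tau>) / (cocycle A \<sigma> * cocycle B \<tau>)"
    unfolding moebius_act_def [of "A ** B"] cocycle_mult [OF assms(2,3)] \<sigma>_def [symmetric] by (simp only:)
  also have "\<dots> = moebius_act A \<sigma>" using nB by (simp add: moebius_act_def [of A])
  finally show ?thesis by (simp only: \<sigma>_def)
qed

definition mS :: "int^2^2" where "mS = vector [vector [0, -1], vector [1, 0]]"

definition mT :: "int \<Rightarrow> int^2^2" where "mT m = vector [vector [1, m], vector [0, 1]]"

lemmas mat2_simps = vec_eq_iff forall_2 matrix_matrix_mult_def sum_2 mS_def mT_def mat_def

lemma mS_SL2Z: "mS \<in> SL2Z" and mT_SL2Z: "mT m \<in> SL2Z" and mat1_SL2Z: "mat 1 \<in> SL2Z"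
  by (simp_all add: SL2Z_det mS_def mT_def mat_def)

lemma moebius_mS: "moebius_act mS \<tau> = - 1 / \<tau>" "cocycle mS \<tau> = \<tau>" "mS $ 2 $ 1 = 1"
  by (simp_all add: moebius_act_def cocycle_def mS_def)

lemma moebius_mT: "moebius_act (mT m) \<tau> = \<tau> + of_int m" "cocycle (mT m) \<tau> = 1" "mT m $ 2 $ 1 = 0"
  by (simp_all add: moebius_act_def cocycle_def mT_def)

text \<open>The Euclidean algorithm on the lower row: \<open>S\<close> and \<open>T\<^sup>\<plusminus>\<^sup>1\<close> generate the modular group.\<close>
lemma SL2Z_induct [consumes 1, case_names one S T]:
  assumes "A \<in> SL2Z" and one: "P (mat 1)"
    and S: "\<And>A. A \<in> SL2Z \<Longrightarrow> P A \<Longrightarrow> P (A ** mS)"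
    and T: "\<And>A m. A \<in> SL2Z \<Longrightarrow> P A \<Longrightarrow> m = 1 \<or> m = -1 \<Longrightarrow> P (A ** mT m)"
  shows "P A"
proof -
  have T_nat: "P (A ** mT (s * int k))" if "A \<in> SL2Z" "P A" "s = 1 \<or> s = -1" for A k s
  proof (induction k)
    case 0
    have "mT 0 = mat 1" by (simp add: mat2_simps)
    then show ?case using that by simp
  next
    case (Suc k)
    have "mT (s * int k) ** mT s = mT (s * int (Suc k))" by (simp add: mat2_simps algebra_simps)
    then show ?case using T [OF SL2Z_mult [OF that(1) mT_SL2Z] Suc that(3)] by (simp add: matrix_mul_assoc [symmetric])
  qed
  have T_int: "P (A ** mT m)" if "A \<in> SL2Z" "P A" for A m
    using T_nat [OF that, of 1 "nat m"] T_nat [OF that, of "-1" "nat (- m)"] by (cases "m \<ge> 0") auto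
  have T_back: "P A" if "A \<in> SL2Z" "P (A ** mT m)" for A m
  proof -
    have "mT m ** mT (- m) = mat 1" by (simp add: mat2_simps)
    then show ?thesis using T_int [OF SL2Z_mult [OF that(1) mT_SL2Z] that(2), of "- m"]
      by (simp add: matrix_mul_assoc [symmetric])
  qed
  have S_back: "P A" if "A \<in> SL2Z" "P (A ** mS)" for A
  proof -
    have "P (A ** mS ** mS ** mS ** mS)"
      by (intro S SL2Z_mult mS_SL2Z that)
    moreover have "mS ** (mS ** (mS ** mS)) = mat 1" by (simp add: mat2_simps)
    ultimately show ?thesis by (simp add: matrix_mul_assoc [symmetric])
  qed
  show ?thesis using \<open>A \<in> SL2Z\<close>
  proof (induction "nat \<bar>A $ 2 $ 1\<bar>" arbitrary: A rule: less_induct)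
    case (less A)
    show ?case
    proof (cases "A $ 2 $ 1 = 0")
      case True
      then have "A $ 1 $ 1 * A $ 2 $ 2 = 1" using less.prems by (simp add: SL2Z_det)
      then consider "A $ 1 $ 1 = 1" "A $ 2 $ 2 = 1" | "A $ 1 $ 1 = -1" "A $ 2 $ 2 = -1"
        using zmult_eq_1_iff by blast
      then show ?thesis
      proof cases
        case 1
        then have "A = mat 1 ** mT (A $ 1 $ 2)" using True by (simp add: mat2_simps)
        then show ?thesis using T_int [OF mat1_SL2Z one] by metis
      next
        case 2
        then have "A = mat 1 ** mS ** mS ** mT (- (A $ 1 $ 2))" using True by (simp add: mat2_simps)
        moreover have "P (mat 1 ** mS ** mS)" by (intro S SL2Z_mult mat1_SL2Z mS_SL2Z one)
        ultimately show ?thesis using T_int [OF SL2Z_mult [OF SL2Z_mult [OF mat1_SL2Z mS_SL2Z] mS_SL2Z]] by metis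
      qed
    next
      case False
      define m where "m = - (A $ 2 $ 2 div A $ 2 $ 1)"
      define B where "B = A ** mT m ** mS"
      have "B $ 2 $ 1 = A $ 2 $ 2 mod A $ 2 $ 1"
        by (simp add: B_def mat2_simps m_def minus_div_mult_eq_mod [symmetric])
      then have "\<bar>B $ 2 $ 1\<bar> < \<bar>A $ 2 $ 1\<bar>" using False by (simp add: abs_mod_less)
      then have "nat \<bar>B $ 2 $ 1\<bar> < nat \<bar>A $ 2 $ 1\<bar>" by linarith
      moreover have "B \<in> SL2Z" unfolding B_def by (intro SL2Z_mult less.prems mT_SL2Z mS_SL2Z)
      ultimately have "P B" by (rule less.hyps)
      then have "P (A ** mT m)" unfolding B_def by (rule S_back [OF SL2Z_mult [OF less.prems mT_SL2Z]])
      then show ?thesis by (rule T_back [OF less.prems])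
    qed
  qed
qed

lemma moebius_mat1: "moebius_act (mat 1) \<tau> = \<tau>" "cocycle (mat 1) \<tau> = 1" "(mat 1 :: int^2^2) $ 2 $ 1 = 0"
  by (simp_all add: moebius_act_def cocycle_def mat_def)

text \<open>
  The cocycle of eta, which is \<open>\<epsilon>(A, w) w(\<tau>)\<close> without the choice of a square root.
\<close>
definition eta_quot :: "int^2^2 \<Rightarrow> complex \<Rightarrow> complex" where
  "eta_quot A \<tau> = eta (moebius_act A \<tau>) / eta \<tau>"

lemma eta_quot_mult:
  assumes "A \<in> SL2Z" "B \<in> SL2Z" "\<tau> \<in> upper_half_plane"
  shows "eta_quot (A ** B) \<tau> = eta_quot A (moebius_act B \<tau>) * eta_quot B \<tau>"
  using eta_nonzero [OF moebius_uhp [OF assms(2,3)]] by (simp add: eta_quot_def moebius_mult [OF assms])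

lemma eta_quot_mat1: "\<tau> \<in> upper_half_plane \<Longrightarrow> eta_quot (mat 1) \<tau> = 1"
  by (simp add: eta_quot_def moebius_mat1 eta_nonzero)

lemma eta_quot_mS: "\<tau> \<in> upper_half_plane \<Longrightarrow> eta_quot mS \<tau> = csqrt (- \<i> * \<tau>)"
  using eta_inversion [of \<tau>] eta_nonzero [of \<tau>] by (simp add: eta_quot_def moebius_mS)

lemma eta_quot_mT:
  assumes "\<tau> \<in> upper_half_plane" "m = 1 \<or> m = -1"
  shows "eta_quot (mT m) \<tau> = ee (of_int m / 24)"
proof (cases "m = 1")
  case True
  then show ?thesis using eta_T [OF assms(1)] eta_nonzero [OF assms(1)] by (simp add: eta_quot_def moebius_mT)
next
  case False
  have "\<tau> - 1 \<in> upper_half_plane" using assms by (simp add: upper_half_plane_def)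
  from eta_T [OF this] have "eta \<tau> = ee (1 / 24) * eta (\<tau> - 1)" by simp
  then show ?thesis using False assms(2) eta_nonzero [OF assms(1)] by (auto simp: eta_quot_def moebius_mT ee_minus inverse_eq_divide)
qed

text \<open>
  The discriminant \<open>\<eta>\<^sup>2\<^sup>4\<close> has weight 12: it suffices to check this for the generators, since both sides are
  multiplicative cocycles.
\<close>
lemma eta_quot_24:
  assumes "A \<in> SL2Z" "\<tau> \<in> upper_half_plane"
  shows "eta_quot A \<tau> ^ 24 = cocycle A \<tau> ^ 12"
  using assms
proof (induction A arbitrary: \<tau> rule: SL2Z_induct)
  case one
  then show ?case by (simp add: eta_quot_mat1 moebius_mat1)
next
  case (S A)
  \<comment> \<open>the generator \<open>S\<close>: the cocycle of eta is a square root of \<open>-\<i>\<tau>\<close>\<close>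
  have "x ^ 24 = (x\<^sup>2) ^ 12" for x :: complex using power_mult [of x 2 12] by simp
  then have "eta_quot mS \<tau> ^ 24 = ((csqrt (- \<i> * \<tau>))\<^sup>2) ^ 12"
    by (simp only: eta_quot_mS [OF S(3)])
  also have "\<dots> = (- \<i>) ^ 12 * \<tau> ^ 12" by (simp only: power2_csqrt power_mult_distrib)
  also have "(- \<i>) ^ 12 = ((- \<i>)\<^sup>2) ^ 6" using power_mult [of "- \<i>" 2 6] by simp
  also have "\<dots> = 1" by simp
  also have "1 * \<tau> ^ 12 = \<tau> ^ 12" by simp
  finally show ?case
    using S.IH [OF moebius_uhp [OF mS_SL2Z S(3)]] S
    by (simp add: eta_quot_mult mS_SL2Z cocycle_mult power_mult_distrib moebius_mS)
next
  case (T A m)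
  have "eta_quot (mT m) \<tau> ^ 24 = ee (of_int m)" using T by (simp add: eta_quot_mT ee_power)
  also have "\<dots> = 1" by (rule ee_Ints) simp
  finally show ?case
    using T.IH [OF moebius_uhp [OF mT_SL2Z T(4)]] T
    by (simp add: eta_quot_mult mT_SL2Z cocycle_mult power_mult_distrib moebius_mT)
qed

lemma moebius_holomorphic: "A \<in> SL2Z \<Longrightarrow> moebius_act A holomorphic_on upper_half_plane"
  unfolding moebius_act_def [abs_def] using cocycle_nonzero
  by (auto intro!: holomorphic_intros simp: cocycle_def)

lemma Mp2ZD:
  assumes "(A, w) \<in> Mp2Z"
  shows "A \<in> SL2Z" "w holomorphic_on upper_half_plane"
    "\<And>\<tau>. \<tau> \<in> upper_half_plane \<Longrightarrow> (w \<tau>)\<^sup>2 = cocycle A \<tau>" "\<And>\<tau>. \<tau> \<in> upper_half_plane \<Longrightarrow> w \<tau> \<noteq> 0"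
proof -
  show "A \<in> SL2Z" "w holomorphic_on upper_half_plane" "\<And>\<tau>. \<tau> \<in> upper_half_plane \<Longrightarrow> (w \<tau>)\<^sup>2 = cocycle A \<tau>"
    using assms by (auto simp: Mp2Z_def)
  then show "\<And>\<tau>. \<tau> \<in> upper_half_plane \<Longrightarrow> w \<tau> \<noteq> 0"
    using cocycle_nonzero by (metis zero_power2)
qed

text \<open>
  The quotient by \<open>\<eta>(\<tau>) w(\<tau>)\<close> is a 24th root of unity that depends continuously on \<open>\<tau>\<close>, hence it does not
  depend on \<open>\<tau>\<close>.
\<close>
theorem eta_transform:
  assumes "(A, w) \<in> Mp2Z" "\<tau> \<in> upper_half_plane"
  shows "eta (moebius_act A \<tau>) = eps (A, w) * w \<tau> * eta \<tau>" and "eps (A, w) ^ 24 = 1"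
proof -
  note A = Mp2ZD [OF assms(1)]
  define E where "E = (\<lambda>\<tau>. eta (moebius_act A \<tau>) / (eta \<tau> * w \<tau>))"
  have i: "\<i> \<in> upper_half_plane" by (simp add: upper_half_plane_def)
  have "(eta \<circ> moebius_act A) holomorphic_on upper_half_plane"
    by (rule holomorphic_on_compose_gen [OF moebius_holomorphic eta_holomorphic]) (use A moebius_uhp in auto)
  then have "E holomorphic_on upper_half_plane"
    unfolding E_def o_def using A eta_nonzero by (intro holomorphic_intros eta_holomorphic) auto
  then have cont: "continuous_on upper_half_plane E" by (rule holomorphic_on_imp_continuous_on)
  have pow: "E \<tau> ^ 24 = 1" if "\<tau> \<in> upper_half_plane" for \<tau>
  proof -
    have "E \<tau> = eta_quot A \<tau> / w \<tau>" by (simp add: E_def eta_quot_def)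
    then have "E \<tau> ^ 24 = cocycle A \<tau> ^ 12 / ((w \<tau>)\<^sup>2) ^ 12"
      using eta_quot_24 [OF A(1) that] by (simp add: power_divide)
    then show ?thesis using A(3) [OF that] cocycle_nonzero [OF A(1) that] by simp
  qed
  have "E \<tau> = E \<i>"
    by (rule continuous_power_constant [OF cont pow _ assms(2) i]) auto
  also have "E \<i> = eps (A, w)" by (simp add: E_def eps_def)
  finally show "eta (moebius_act A \<tau>) = eps (A, w) * w \<tau> * eta \<tau>"
    using eta_nonzero [OF assms(2)] A(4) [OF assms(2)] by (simp add: E_def field_simps)
  show "eps (A, w) ^ 24 = 1" using pow [OF i] \<open>E \<i> = eps (A, w)\<close> by simp
qed

text \<open>
  The half plane avoids the branch cut of the square root after a change of sign that depends on the sign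
  of \<open>c\<close>.
\<close>
lemma Mp2Z_exists:
  assumes "A \<in> SL2Z"
  shows "\<exists>w. (A, w) \<in> Mp2Z"
proof -
  have main: "\<exists>w. (A, w) \<in> Mp2Z" if "v holomorphic_on upper_half_plane" "\<And>\<tau>. \<tau> \<in> upper_half_plane \<Longrightarrow> (v \<tau>)\<^sup>2 = cocycle A \<tau>" for v
  proof -
    have "(\<lambda>\<tau>. if \<tau> \<in> upper_half_plane then v \<tau> else 0) holomorphic_on upper_half_plane"
      using that(1) by (rule holomorphic_transform) simp
    then have "(A, \<lambda>\<tau>. if \<tau> \<in> upper_half_plane then v \<tau> else 0) \<in> Mp2Z"
      using that(2) assms by (simp add: Mp2Z_def)
    then show ?thesis by blast
  qed
  let ?c = "A $ 2 $ 1" and ?d = "A $ 2 $ 2"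
  consider "?c > 0" | "?c < 0" | "?c = 0" "?d = 1" | "?c = 0" "?d = -1"
  proof -
    have "?d = 1 \<or> ?d = -1" if "?c = 0"
      using assms that zmult_eq_1_iff [of "A $ 1 $ 1" ?d] by (auto simp: SL2Z_det)
    then show thesis using that by linarith
  qed
  then show ?thesis
  proof cases
    case 1
    show ?thesis
    proof (rule main)
      show "(\<lambda>\<tau>. csqrt (cocycle A \<tau>)) holomorphic_on upper_half_plane"
        unfolding cocycle_def
        by (intro holomorphic_intros) (use 1 in \<open>auto simp: complex_nonpos_Reals_iff upper_half_plane_def\<close>)
    qed simp
  next
    case 2
    show ?thesis
    proof (rule main)
      show "(\<lambda>\<tau>. \<i> * csqrt (- cocycle A \<tau>)) holomorphic_on upper_half_plane"
        unfolding cocycle_def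
        by (intro holomorphic_intros) (use 2 in \<open>auto simp: complex_nonpos_Reals_iff upper_half_plane_def\<close>)
    qed (simp add: power_mult_distrib)
  next
    case 3
    show ?thesis by (rule main [of "\<lambda>_. 1"]) (use 3 in \<open>simp_all add: cocycle_def\<close>)
  next
    case 4
    show ?thesis by (rule main [of "\<lambda>_. \<i>"]) (use 4 in \<open>simp_all add: cocycle_def\<close>)
  qed
qed

section \<open>The theta function as a Jacobi form\<close>

context unimodular_lattice begin

text \<open>
  The transformation law of theta. In terms of the cocycle of eta it involves no square root, as
  \<open>\<epsilon>\<^sup>3\<^sup>n w\<^sup>n = (\<epsilon> w)\<^sup>3\<^sup>n / w\<^sup>2\<^sup>n\<close>; so it can be multiplied in the modular group itself.
\<close>
definition theta_law :: "int^2^2 \<Rightarrow> bool" where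
  "theta_law A \<longleftrightarrow> (\<forall>\<tau>\<in>upper_half_plane. \<forall>z.
     th (moebius_act A \<tau>) (inverse (cocycle A \<tau>) *s z) * ee (- of_int (A $ 2 $ 1) * quad \<beta> z / cocycle A \<tau>)
       = eta_quot A \<tau> ^ (3 * CARD('n)) * inverse (cocycle A \<tau>) ^ CARD('n) * th \<tau> z)"

lemma theta_law_mult:
  assumes A: "A \<in> SL2Z" "theta_law A" and B: "B \<in> SL2Z" "theta_law B"
  shows "theta_law (A ** B)"
  unfolding theta_law_def
proof (intro ballI allI)
  fix \<tau> and z :: "complex^'n" assume \<tau>: "\<tau> \<in> upper_half_plane"
  define \<sigma> where "\<sigma> = moebius_act B \<tau>"
  define y where "y = inverse (cocycle B \<tau>) *s z"
  have \<sigma>: "\<sigma> \<in> upper_half_plane" using \<tau> B by (simp add: \<sigma>_def moebius_uhp)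
  have nB: "cocycle B \<tau> \<noteq> 0" and nA: "cocycle A \<sigma> \<noteq> 0" using cocycle_nonzero A B \<tau> \<sigma> by auto
  have AB: "cocycle (A ** B) \<tau> = cocycle A \<sigma> * cocycle B \<tau>" "moebius_act (A ** B) \<tau> = moebius_act A \<sigma>"
    using cocycle_mult moebius_mult A B \<tau> by (auto simp: \<sigma>_def)
  have y: "inverse (cocycle (A ** B) \<tau>) *s z = inverse (cocycle A \<sigma>) *s y"
    by (simp add: AB y_def vector_smult_assoc)
  have exponent: "- of_int ((A ** B) $ 2 $ 1) * quad \<beta> z / cocycle (A ** B) \<tau>
      = - of_int (A $ 2 $ 1) * quad \<beta> y / cocycle A \<sigma> + - of_int (B $ 2 $ 1) * quad \<beta> z / cocycle B \<tau>"
  proof -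
    have det: "of_int (B $ 1 $ 1) * of_int (B $ 2 $ 2) - of_int (B $ 1 $ 2) * of_int (B $ 2 $ 1) = (1 :: complex)"
      using B(1) unfolding SL2Z_det by (metis of_int_1 of_int_diff of_int_mult)
    have s: "\<sigma> * cocycle B \<tau> = of_int (B $ 1 $ 1) * \<tau> + of_int (B $ 1 $ 2)"
      using nB by (simp add: \<sigma>_def moebius_act_def)
    have "of_int ((A ** B) $ 2 $ 1) * cocycle B \<tau>
       = of_int (A $ 2 $ 1) * (of_int (B $ 1 $ 1) * of_int (B $ 2 $ 2) - of_int (B $ 1 $ 2) * of_int (B $ 2 $ 1))
         + of_int (B $ 2 $ 1) * (of_int (A $ 2 $ 1) * (of_int (B $ 1 $ 1) * \<tau> + of_int (B $ 1 $ 2)) + of_int (A $ 2 $ 2) * cocycle B \<tau>)"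
      by (simp add: matrix_matrix_mult_def sum_2 cocycle_def algebra_simps)
    also have "\<dots> = of_int (A $ 2 $ 1) + of_int (B $ 2 $ 1) * (cocycle A \<sigma> * cocycle B \<tau>)"
      unfolding det s [symmetric] by (simp add: cocycle_def [of A] algebra_simps)
    finally have k: "of_int ((A ** B) $ 2 $ 1) * cocycle B \<tau> = of_int (A $ 2 $ 1) + of_int (B $ 2 $ 1) * (cocycle A \<sigma> * cocycle B \<tau>)" .
    have "of_int ((A ** B) $ 2 $ 1) / (cocycle A \<sigma> * cocycle B \<tau>)
       = of_int ((A ** B) $ 2 $ 1) * cocycle B \<tau> / (cocycle A \<sigma> * (cocycle B \<tau>)\<^sup>2)"
      using nA nB by (simp add: power2_eq_square)
    also have "\<dots> = of_int (A $ 2 $ 1) * (inverse (cocycle B \<tau>))\<^sup>2 / cocycle A \<sigma> + of_int (B $ 2 $ 1) / cocycle B \<tau>"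
      unfolding k using nA nB by (simp add: field_simps power2_eq_square)
    finally have "quad \<beta> z * (of_int ((A ** B) $ 2 $ 1) / (cocycle A \<sigma> * cocycle B \<tau>))
       = quad \<beta> z * (of_int (A $ 2 $ 1) * (inverse (cocycle B \<tau>))\<^sup>2 / cocycle A \<sigma> + of_int (B $ 2 $ 1) / cocycle B \<tau>)" by simp
    then show ?thesis unfolding AB y_def quad_scale by (simp add: algebra_simps)
  qed
  have "th (moebius_act (A ** B) \<tau>) (inverse (cocycle (A ** B) \<tau>) *s z) * ee (- of_int ((A ** B) $ 2 $ 1) * quad \<beta> z / cocycle (A ** B) \<tau>)
     = (th (moebius_act A \<sigma>) (inverse (cocycle A \<sigma>) *s y) * ee (- of_int (A $ 2 $ 1) * quad \<beta> y / cocycle A \<sigma>)) * ee (- of_int (B $ 2 $ 1) * quad \<beta> z / cocycle B \<tau>)"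
    unfolding exponent ee_add AB(2) y by (simp only: mult.assoc)
  also have "th (moebius_act A \<sigma>) (inverse (cocycle A \<sigma>) *s y) * ee (- of_int (A $ 2 $ 1) * quad \<beta> y / cocycle A \<sigma>)
     = eta_quot A \<sigma> ^ (3 * CARD('n)) * inverse (cocycle A \<sigma>) ^ CARD('n) * th \<sigma> y"
    using A(2) \<sigma> unfolding theta_law_def by blast
  also have "\<dots> * ee (- of_int (B $ 2 $ 1) * quad \<beta> z / cocycle B \<tau>)
     = eta_quot A \<sigma> ^ (3 * CARD('n)) * inverse (cocycle A \<sigma>) ^ CARD('n) * (th \<sigma> y * ee (- of_int (B $ 2 $ 1) * quad \<beta> z / cocycle B \<tau>))"
    by (simp only: mult.assoc)
  also have "th \<sigma> y * ee (- of_int (B $ 2 $ 1) * quad \<beta> z / cocycle B \<tau>)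
     = eta_quot B \<tau> ^ (3 * CARD('n)) * inverse (cocycle B \<tau>) ^ CARD('n) * th \<tau> z"
    using B(2) \<tau> unfolding theta_law_def \<sigma>_def y_def by blast
  finally show "th (moebius_act (A ** B) \<tau>) (inverse (cocycle (A ** B) \<tau>) *s z) * ee (- of_int ((A ** B) $ 2 $ 1) * quad \<beta> z / cocycle (A ** B) \<tau>)
     = eta_quot (A ** B) \<tau> ^ (3 * CARD('n)) * inverse (cocycle (A ** B) \<tau>) ^ CARD('n) * th \<tau> z"
    unfolding AB(1) eta_quot_mult [OF A(1) B(1) \<tau>] \<sigma>_def [symmetric]
    by (simp only: power_mult_distrib inverse_mult_distrib mult_ac)
qed

text \<open>
  The factor \<open>(-\<i>)\<^sup>n\<close> of the inversion formula is absorbed by \<open>\<eta>\<^sup>3\<^sup>n\<close>, because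
  \<open>(-\<i>\<tau>)\<^sup>3\<^sup>/\<^sup>2 / \<tau> = -\<i> (-\<i>\<tau>)\<^sup>1\<^sup>/\<^sup>2\<close>.
\<close>
lemma theta_law_mS: "theta_law mS"
  unfolding theta_law_def
proof (intro ballI allI)
  fix \<tau> and z :: "complex^'n" assume \<tau>: "\<tau> \<in> upper_half_plane"
  define r where "r = csqrt (- \<i> * \<tau>)"
  have nz: "\<tau> \<noteq> 0" by (rule uhp_nonzero [OF \<tau>])
  have "tc\<^sup>2 = ee (1 / 4) ^ CARD('n)" by (simp add: van_der_Blij ee_power)
  also have "ee (1 / 4) = \<i>"
  proof -
    have "ee (1 / 4) = exp (\<i> * of_real (pi / 2))" by (simp add: ee_def)
    also have "\<dots> = cis (pi / 2)" by (simp only: cis_conv_exp)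
    finally show ?thesis by simp
  qed
  finally have tc: "inverse (tc\<^sup>2) = (- \<i>) ^ CARD('n)" by (simp add: power_inverse [symmetric])
  have "r ^ (3 * CARD('n)) = (r\<^sup>2 * r) ^ CARD('n)" by (simp add: power_mult power3_eq_cube power2_eq_square)
  also have "r\<^sup>2 = - \<i> * \<tau>" by (simp add: r_def)
  finally have "r ^ (3 * CARD('n)) * inverse \<tau> ^ CARD('n) = ((- \<i> * \<tau> * r) * inverse \<tau>) ^ CARD('n)"
    by (simp only: power_mult_distrib)
  also have "(- \<i> * \<tau> * r) * inverse \<tau> = - \<i> * r" using nz by simp
  finally have "r ^ (3 * CARD('n)) * inverse \<tau> ^ CARD('n) = inverse (tc\<^sup>2) * r ^ CARD('n)"
    by (simp only: tc power_mult_distrib)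
  then show "th (moebius_act mS \<tau>) (inverse (cocycle mS \<tau>) *s z) * ee (- of_int (mS $ 2 $ 1) * quad \<beta> z / cocycle mS \<tau>)
     = eta_quot mS \<tau> ^ (3 * CARD('n)) * inverse (cocycle mS \<tau>) ^ CARD('n) * th \<tau> z"
    unfolding eta_quot_mS [OF \<tau>] moebius_mS
    using theta_inversion [OF \<tau>, of z] by (simp add: inverse_eq_divide r_def)
qed

text \<open>
  Van der Blij's lemma: \<open>e(n/8) = e(1/24)\<^sup>3\<^sup>n\<close>.
\<close>
lemma theta_law_mT:
  assumes m: "m = 1 \<or> m = -1"
  shows "theta_law (mT m)"
  unfolding theta_law_def
proof (intro ballI allI)
  fix \<tau> and z :: "complex^'n" assume \<tau>: "\<tau> \<in> upper_half_plane"
  have "th (\<tau> + of_int m) z = ee (of_int m / 24) ^ (3 * CARD('n)) * th \<tau> z"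
  proof (cases "m = 1")
    case True
    then show ?thesis using th_T [OF \<tau>, of z] by (simp add: van_der_Blij ee_power)
  next
    case False
    have "\<tau> - 1 \<in> upper_half_plane" using \<tau> by (simp add: upper_half_plane_def)
    from th_T [OF this, of z] have "th \<tau> z = tc * th (\<tau> - 1) z" by simp
    then show ?thesis using False m by (simp add: van_der_Blij ee_power ee_minus power_inverse field_simps)
  qed
  then show "th (moebius_act (mT m) \<tau>) (inverse (cocycle (mT m) \<tau>) *s z) * ee (- of_int (mT m $ 2 $ 1) * quad \<beta> z / cocycle (mT m) \<tau>)
     = eta_quot (mT m) \<tau> ^ (3 * CARD('n)) * inverse (cocycle (mT m) \<tau>) ^ CARD('n) * th \<tau> z"
    unfolding eta_quot_mT [OF \<tau> m] moebius_mT by (simp add: vector_smult_lid)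
qed

lemma theta_law_all: "A \<in> SL2Z \<Longrightarrow> theta_law A"
proof (induction A rule: SL2Z_induct)
  case one
  show ?case by (simp add: theta_law_def moebius_mat1 eta_quot_mat1)
next
  case (S A)
  then show ?case by (intro theta_law_mult theta_law_mS mS_SL2Z)
next
  case (T A m)
  then show ?case by (intro theta_law_mult theta_law_mT mT_SL2Z)
qed

theorem theta_transform:
  assumes "(A, w) \<in> Mp2Z" "\<tau> \<in> upper_half_plane"
  shows "th (moebius_act A \<tau>) (inverse (cocycle A \<tau>) *s z) * ee (- of_int (A $ 2 $ 1) * quad \<beta> z / cocycle A \<tau>)
       = eps (A, w) ^ (3 * CARD('n)) * w \<tau> ^ CARD('n) * th \<tau> z"
proof -
  note A = Mp2ZD [OF assms(1)]
  have quot: "eta_quot A \<tau> = eps (A, w) * w \<tau>"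
    using eta_transform(1) [OF assms] eta_nonzero [OF assms(2)] by (simp add: eta_quot_def)
  have w: "(w \<tau>) ^ (3 * CARD('n)) * inverse (cocycle A \<tau>) ^ CARD('n) = w \<tau> ^ CARD('n)"
  proof -
    have "(w \<tau>) ^ (3 * CARD('n)) * inverse (cocycle A \<tau>) ^ CARD('n) = ((w \<tau>) ^ 3 * inverse ((w \<tau>)\<^sup>2)) ^ CARD('n)"
      by (simp only: A(3) [OF assms(2)] power_mult power_mult_distrib)
    also have "(w \<tau>) ^ 3 * inverse ((w \<tau>)\<^sup>2) = w \<tau>"
      using A(4) [OF assms(2)] by (simp add: power3_eq_cube power2_eq_square field_simps)
    finally show ?thesis .
  qed
  have "th (moebius_act A \<tau>) (inverse (cocycle A \<tau>) *s z) * ee (- of_int (A $ 2 $ 1) * quad \<beta> z / cocycle A \<tau>)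
       = eta_quot A \<tau> ^ (3 * CARD('n)) * inverse (cocycle A \<tau>) ^ CARD('n) * th \<tau> z"
    using theta_law_all [OF A(1)] assms(2) unfolding theta_law_def by blast
  also have "\<dots> = eps (A, w) ^ (3 * CARD('n)) * (w \<tau> ^ (3 * CARD('n)) * inverse (cocycle A \<tau>) ^ CARD('n)) * th \<tau> z"
    by (simp only: quot power_mult_distrib mult.assoc)
  finally show ?thesis by (simp only: w)
qed

end

section \<open>Modular functions of weight zero\<close>

lemma power_series_on_disc:
  fixes b :: "nat \<Rightarrow> complex"
  assumes "\<And>\<tau>. \<tau> \<in> upper_half_plane \<Longrightarrow> summable (\<lambda>j. b j * ee \<tau> ^ j)"
  shows "\<exists>F. F holomorphic_on ball 0 1 \<and> (\<forall>\<tau>\<in>upper_half_plane. (\<lambda>j. b j * ee \<tau> ^ j) sums F (ee \<tau>))"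
proof -
  define F where "F q = (\<Sum>j. b j * q ^ j)" for q
  have sums: "(\<lambda>j. b j * q ^ j) sums F q" if "q \<in> ball 0 1" for q
  proof (cases "q = 0")
    case True
    then show ?thesis using powser_sums_zero [of b] by (simp add: F_def sums_iff)
  next
    case False
    have n: "norm q < 1" using that by simp
    obtain \<tau> where "\<tau> \<in> upper_half_plane" "ee \<tau> = q" by (rule ee_surj [OF False n])
    then show ?thesis using assms [of \<tau>] unfolding F_def by (auto intro: summable_sums)
  qed
  have "F holomorphic_on ball 0 1"
    by (rule power_series_holomorphic [where a = b]) (use sums in simp)
  moreover have "(\<lambda>j. b j * ee \<tau> ^ j) sums F (ee \<tau>)" if "\<tau> \<in> upper_half_plane" for \<tau>
    using sums [of "ee \<tau>"] norm_ee_less_1 [OF that] by simp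
  ultimately show ?thesis by blast
qed

text \<open>
  By Dirichlet's approximation theorem some lower row \<open>(c, d)\<close> has \<open>\<bar>c\<tau> + d\<bar>\<^sup>2 \<le> 5 Im \<tau>\<close>; so every
  orbit of the modular group meets the half plane \<open>Im \<tau> \<ge> 1/5\<close>.
\<close>
lemma orbit_meets_cusp:
  assumes "\<tau> \<in> upper_half_plane"
  obtains A where "A \<in> SL2Z" "Im (moebius_act A \<tau>) \<ge> 1 / 5"
proof (cases "Im \<tau> \<ge> 1 / 5")
  case True
  then show thesis using that [OF mat1_SL2Z] by (simp add: moebius_mat1)
next
  case False
  define y where "y = Im \<tau>"
  have y: "0 < y" "y < 1 / 5" using False assms by (auto simp: y_def upper_half_plane_def)
  define s where "s = 1 / sqrt y"
  have s: "s \<ge> 1" "s\<^sup>2 = 1 / y" using y by (auto simp: s_def power_divide)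
  define N where "N = nat \<lceil>s\<rceil>"
  have N: "s \<le> real N" "real N \<le> 2 * s" "N > 0" using s(1) unfolding N_def by linarith+
  \<comment> \<open>\<open>h/k\<close> approximates \<open>Re \<tau>\<close>; the lower row is \<open>(k, -h)\<close>\<close>
  obtain h k where hk: "coprime h k" "0 < k" "k \<le> int N" "\<bar>of_int k * Re \<tau> - of_int h\<bar> < 1 / N"
    using Dirichlet_approx_coprime [OF N(3), of "Re \<tau>"] by blast
  obtain u v where uv: "u * h + v * k = 1" using bezout_int [of h k] hk(1) by auto
  define A :: "int^2^2" where "A = vector [vector [- u, - v], vector [k, - h]]"
  have A: "A \<in> SL2Z" using uv by (simp add: SL2Z_det A_def algebra_simps)
  have "(norm (cocycle A \<tau>))\<^sup>2 = (of_int k * Re \<tau> - of_int h)\<^sup>2 + (of_int k)\<^sup>2 * y\<^sup>2"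
    by (simp add: cocycle_def A_def cmod_power2 y_def power_mult_distrib)
  also have "\<dots> \<le> y + 4 * y"
  proof (rule add_mono)
    have "\<bar>of_int k * Re \<tau> - of_int h\<bar> \<le> 1 / s"
    proof -
      have "1 / real N \<le> 1 / s" using N(1) s(1) by (intro divide_left_mono) auto
      then show ?thesis using hk(4) by linarith
    qed
    then have "(of_int k * Re \<tau> - of_int h)\<^sup>2 \<le> (1 / s)\<^sup>2"
      by (metis abs_ge_zero power2_abs power_mono)
    also have "(1 / s)\<^sup>2 = y" using s(2) y by (simp add: power_divide)
    finally show "(of_int k * Re \<tau> - of_int h)\<^sup>2 \<le> y" .
    have "real_of_int k \<le> 2 * s" using hk(3) N(2) by linarith
    then have "(real_of_int k)\<^sup>2 \<le> (2 * s)\<^sup>2" using hk(2) by (intro power_mono) auto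
    then have "(real_of_int k)\<^sup>2 * y\<^sup>2 \<le> (2 * s)\<^sup>2 * y\<^sup>2" by (intro mult_right_mono) auto
    also have "\<dots> = 4 * y" using s(2) y by (simp add: power_mult_distrib power2_eq_square)
    finally show "(real_of_int k)\<^sup>2 * y\<^sup>2 \<le> 4 * y" .
  qed
  finally have "(norm (cocycle A \<tau>))\<^sup>2 \<le> 5 * y" by simp
  moreover have "0 < (norm (cocycle A \<tau>))\<^sup>2" using cocycle_nonzero [OF A assms] by simp
  ultimately have "1 / 5 \<le> y / (norm (cocycle A \<tau>))\<^sup>2" using y by (simp add: field_simps)
  then have "1 / 5 \<le> Im (moebius_act A \<tau>)" by (simp add: Im_moebius [OF A assms] y_def)
  then show thesis using that A by blast
qed

text \<open>
  As every orbit comes close to the cusp, \<open>\<bar>f\<bar>\<^sup>2\<^sup>4\<close> attains its maximum on the disc \<open>\<bar>q\<bar> < 1\<close>, and the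
  maximum principle applies to \<open>f\<^sup>2\<^sup>4\<close>, a holomorphic function of \<open>q\<close>.
\<close>
lemma weight_zero_constant:
  assumes F: "F holomorphic_on ball 0 1"
    and f: "\<And>\<tau>. \<tau> \<in> upper_half_plane \<Longrightarrow> f \<tau> = ee (of_nat a * \<tau> / 24) * F (ee \<tau>)"
    and inv: "\<And>A \<tau>. A \<in> SL2Z \<Longrightarrow> \<tau> \<in> upper_half_plane \<Longrightarrow> norm (f (moebius_act A \<tau>)) = norm (f \<tau>)"
  shows "\<exists>c. \<forall>\<tau>\<in>upper_half_plane. f \<tau> = c"
proof -
  define H where "H = (\<lambda>q. q ^ a * F q ^ 24)"
  have H_hol: "H holomorphic_on ball 0 1" unfolding H_def by (intro holomorphic_intros F)
  have Hf: "H (ee \<tau>) = f \<tau> ^ 24" if "\<tau> \<in> upper_half_plane" for \<tau>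
  proof -
    have "ee (of_nat a * \<tau> / 24) ^ 24 = ee \<tau> ^ a" by (simp add: ee_power)
    then show ?thesis by (simp add: f [OF that] H_def power_mult_distrib)
  qed
  define r where "r = exp (- (2 * pi * (1 / 5)))"
  have r: "0 < r" "r < 1" by (auto simp: r_def)
  have "continuous_on (cball 0 r) (\<lambda>q. norm (H q))"
    by (intro continuous_on_norm holomorphic_on_imp_continuous_on holomorphic_on_subset [OF H_hol]) (use r in auto)
  then obtain q0 where q0: "q0 \<in> cball 0 r" "\<And>q. q \<in> cball 0 r \<Longrightarrow> norm (H q) \<le> norm (H q0)"
    using continuous_attains_sup [of "cball 0 r" "\<lambda>q. norm (H q)"] r by auto
  have max: "norm (H q) \<le> norm (H q0)" if "q \<in> ball 0 1" for q
  proof (cases "q = 0")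
    case True
    then show ?thesis using q0(2) [of 0] r by simp
  next
    case False
    have n: "norm q < 1" using that by simp
    obtain \<tau> where \<tau>: "\<tau> \<in> upper_half_plane" "ee \<tau> = q" by (rule ee_surj [OF False n])
    obtain A where A: "A \<in> SL2Z" "Im (moebius_act A \<tau>) \<ge> 1 / 5" by (rule orbit_meets_cusp [OF \<tau>(1)])
    have "norm (H q) = norm (H (ee (moebius_act A \<tau>)))"
      using Hf [OF \<tau>(1)] Hf [OF moebius_uhp [OF A(1) \<tau>(1)]] inv [OF A(1) \<tau>(1)] by (simp add: \<tau>(2) norm_power)
    also have "\<dots> \<le> norm (H q0)"
      using A(2) by (intro q0(2)) (simp add: norm_ee r_def)
    finally show ?thesis .
  qed
  have "H constant_on ball 0 1"
    by (rule maximum_modulus_principle [where U = "ball 0 1" and \<xi> = q0]) (use H_hol max q0 r in auto)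
  then obtain C where C: "\<And>q. q \<in> ball 0 1 \<Longrightarrow> H q = C" by (auto simp: constant_on_def)
  have pow: "f \<tau> ^ 24 = C" if "\<tau> \<in> upper_half_plane" for \<tau>
    using Hf [OF that] C [of "ee \<tau>"] norm_ee_less_1 [OF that] by simp
  have "(\<lambda>\<tau>. ee (of_nat a * \<tau> / 24) * F (ee \<tau>)) holomorphic_on upper_half_plane"
    by (intro holomorphic_intros holomorphic_on_compose_gen [OF _ F, unfolded o_def]) (auto simp: norm_ee_less_1)
  then have "f holomorphic_on upper_half_plane" using f by (simp cong: holomorphic_cong)
  then have cont: "continuous_on upper_half_plane f" by (rule holomorphic_on_imp_continuous_on)
  have i: "\<i> \<in> upper_half_plane" by (simp add: upper_half_plane_def)
  have "f \<tau> = f \<i>" if "\<tau> \<in> upper_half_plane" for \<tau>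
    by (rule continuous_power_constant [OF cont pow _ that i]) auto
  then show ?thesis by blast
qed

lemma modular_forms_holomorphic_in_q:
  assumes "g \<in> modular_forms k"
  shows "\<exists>G. G holomorphic_on ball 0 1 \<and> (\<forall>\<tau>\<in>upper_half_plane. g \<tau> = G (ee \<tau>))"
proof -
  obtain b :: "nat \<Rightarrow> complex" where b: "\<And>\<tau>. \<tau> \<in> upper_half_plane \<Longrightarrow> (\<lambda>m. b m * ee (of_nat m * \<tau>)) sums g \<tau>"
    using assms unfolding modular_forms_def by blast
  have b': "(\<lambda>m. b m * ee \<tau> ^ m) sums g \<tau>" if "\<tau> \<in> upper_half_plane" for \<tau>
    using b [OF that] by (simp add: ee_power)
  then have "\<And>\<tau>. \<tau> \<in> upper_half_plane \<Longrightarrow> summable (\<lambda>m. b m * ee \<tau> ^ m)" by (rule sums_summable)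
  from power_series_on_disc [OF this] obtain G where G: "G holomorphic_on ball 0 1"
    "\<forall>\<tau>\<in>upper_half_plane. (\<lambda>m. b m * ee \<tau> ^ m) sums G (ee \<tau>)" by blast
  have "g \<tau> = G (ee \<tau>)" if "\<tau> \<in> upper_half_plane" for \<tau>
    using b' [OF that] bspec [OF G(2) that] by (rule sums_unique2)
  with G(1) show ?thesis by blast
qed

lemma holomorphic_in_q_expansion:
  assumes "F holomorphic_on ball 0 1"
  shows "\<exists>b :: nat \<Rightarrow> complex. \<forall>\<tau>\<in>upper_half_plane.
    ((\<lambda>m. b m * ee \<tau> ^ m) has_sum F (ee \<tau>)) UNIV \<and> summable (\<lambda>m. norm (b m * ee \<tau> ^ m))"
proof -
  define b where "b m = (deriv ^^ m) F 0 / fact m" for m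
  have sums: "(\<lambda>m. b m * q ^ m) sums F q" if "q \<in> ball 0 1" for q
    using holomorphic_power_series [OF assms that] by (simp add: b_def)
  have norm: "summable (\<lambda>m. norm (b m * ee \<tau> ^ m))" if "\<tau> \<in> upper_half_plane" for \<tau>
  proof -
    define x where "x = (1 + norm (ee \<tau>)) / 2"
    have x: "norm (ee \<tau>) < x" "x < 1" using norm_ee_less_1 [OF that] by (auto simp: x_def)
    have "summable (\<lambda>m. b m * of_real x ^ m)"
      using sums [of "of_real x"] x norm_ge_zero [of "ee \<tau>"] by (auto simp: sums_iff)
    then show ?thesis
      by (rule powser_insidea) (use x norm_ge_zero [of "ee \<tau>"] in auto)
  qed
  show ?thesis
  proof (intro exI [of _ b] ballI conjI)
    fix \<tau> assume \<tau>: "\<tau> \<in> upper_half_plane"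
    show "summable (\<lambda>m. norm (b m * ee \<tau> ^ m))" by (rule norm [OF \<tau>])
    then show "((\<lambda>m. b m * ee \<tau> ^ m) has_sum F (ee \<tau>)) UNIV"
      by (rule norm_summable_imp_has_sum) (use sums norm_ee_less_1 [OF \<tau>] in auto)
  qed
qed

section \<open>Jacobi forms are multiples of theta\<close>

lemma of_rat_Ints_iff: "(of_rat s :: complex) \<in> \<int> \<longleftrightarrow> s \<in> \<int>"
proof
  assume "(of_rat s :: complex) \<in> \<int>"
  then obtain n where "(of_rat s :: complex) = of_int n" by (rule Ints_cases)
  then have "(of_rat s :: complex) = of_rat (of_int n)" by (simp only: of_rat_of_int_eq)
  then have "s = of_int n" by (simp only: of_rat_eq_iff)
  then show "s \<in> \<int>" by simp
qed (auto elim: Ints_cases)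

context unimodular_lattice begin

text \<open>
  The power of \<open>\<eta>\<close> that splits off from a form with character \<open>\<epsilon>\<^sup>h\<close>.
\<close>
definition eta_exponent :: "int \<Rightarrow> nat" where
  "eta_exponent h = nat ((h - 3 * int CARD('n)) mod 24)"

lemma eta_exponent_less: "eta_exponent h < 24"
  by (simp add: eta_exponent_def nat_less_iff)

lemma eta_exponent_cong: "\<exists>t. int (eta_exponent h) = h - 3 * int CARD('n) + 24 * t"
proof -
  have "int (eta_exponent h) = (h - 3 * int CARD('n)) mod 24" by (simp add: eta_exponent_def)
  also have "\<dots> = h - 3 * int CARD('n) + 24 * - ((h - 3 * int CARD('n)) div 24)"
    by (simp add: minus_div_mult_eq_mod [symmetric])
  finally show ?thesis by blast
qed

definition expansion_index :: "int \<Rightarrow> (rat \<times> (rat^'n)) set" where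
  "expansion_index h = {(m, r). m - of_int h / 24 \<in> \<int> \<and> r \<in> shadow \<beta> \<and> quad \<beta> r \<le> m}"

text \<open>
  Coordinates for the summands of the Fourier expansion of a Jacobi form: a vector of the shadow, and the
  integral part of the excess of the exponent of \<open>q\<close>.
\<close>
definition index_map :: "int \<Rightarrow> (int^'n) \<times> nat \<Rightarrow> rat \<times> (rat^'n)" where
  "index_map h = (\<lambda>(x, j). (quad \<beta> (r0 + vec_of_int x) + of_nat (eta_exponent h) / 24 + of_nat j, r0 + vec_of_int x))"

lemma quad_shadow_mod_1: "quad \<beta> (r0 + vec_of_int x) - of_nat CARD('n) / 8 \<in> \<int>"
proof -
  have "\<rho> + vec_of_int x = vec_of_rat (r0 + vec_of_int x)" by (simp add: \<rho>_def vec_of_rat_add)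
  then have "ee (of_rat (quad \<beta> (r0 + vec_of_int x)) - of_nat CARD('n) / 8) = 1"
    using ee_quad_rho [of x] van_der_Blij by (simp add: quad_vec_of_rat ee_diff)
  then have "of_rat (quad \<beta> (r0 + vec_of_int x) - of_nat CARD('n) / 8) \<in> (\<int> :: complex set)"
    by (simp add: ee_eq_1_iff of_rat_diff of_rat_divide)
  then show ?thesis by (simp only: of_rat_Ints_iff)
qed

text \<open>
  Since \<open>\<beta>(r) \<equiv> n/8 mod 1\<close> on the shadow, the exponents \<open>m \<ge> \<beta>(r)\<close> with \<open>m \<equiv> h/24 mod 1\<close> are the
  numbers \<open>\<beta>(r) + a/24 + j\<close>, where \<open>j\<close> is a natural number and \<open>a\<close> is the residue of \<open>h - 3n\<close> mod 24.
\<close>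
lemma bij_index_map: "bij_betw (index_map h) UNIV (expansion_index h)"
  unfolding bij_betw_def
proof (intro conjI)
  show "inj (index_map h)"
    by (auto simp: index_map_def inj_def dest: injD [OF inj_vec_of_int])
  obtain t where t: "int (eta_exponent h) = h - 3 * int CARD('n) + 24 * t" using eta_exponent_cong by blast
  then have "of_int (int (eta_exponent h)) = (of_int (h - 3 * int CARD('n) + 24 * t) :: rat)" by (simp only:)
  then have t': "of_nat (eta_exponent h) / 24 = (of_int h / 24 - of_nat CARD('n) / 8 + of_int t :: rat)" by simp
  show "range (index_map h) = expansion_index h"
  proof (intro equalityI subsetI)
    fix p assume "p \<in> range (index_map h)"
    then obtain x j where p: "p = index_map h (x, j)" by auto
    have "quad \<beta> (r0 + vec_of_int x) + of_nat (eta_exponent h) / 24 + of_nat j - of_int h / 24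
        = (quad \<beta> (r0 + vec_of_int x) - of_nat CARD('n) / 8) + of_int t + of_nat j"
      by (simp add: t')
    also have "\<dots> \<in> \<int>"
      by (rule Ints_add [OF Ints_add [OF quad_shadow_mod_1 Ints_of_int] Ints_of_nat])
    finally show "p \<in> expansion_index h"
      by (auto simp: p index_map_def expansion_index_def shadow_eq)
  next
    fix p assume "p \<in> expansion_index h"
    then obtain m r where p: "p = (m, r)" "m - of_int h / 24 \<in> \<int>" "r \<in> shadow \<beta>" "quad \<beta> r \<le> m"
      by (auto simp: expansion_index_def)
    then obtain x where r: "r = r0 + vec_of_int x" by (auto simp: shadow_eq)
    have "m - quad \<beta> r - of_nat (eta_exponent h) / 24
       = (m - of_int h / 24) - (quad \<beta> r - of_nat CARD('n) / 8) - of_int t" by (simp add: t')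
    also have "\<dots> \<in> \<int>"
      by (rule Ints_diff [OF Ints_diff [OF p(2) quad_shadow_mod_1 [of x, folded r]] Ints_of_int])
    finally obtain i where i: "m - quad \<beta> r - of_nat (eta_exponent h) / 24 = of_int i" by (elim Ints_cases)
    have "of_int i > (-1 :: rat)"
    proof -
      have "(of_nat (eta_exponent h) :: rat) < 24" 
        using eta_exponent_less [of h] by (simp only: of_nat_less_iff [symmetric, where ?'a = rat] of_nat_numeral)
      then show ?thesis using p(4) i by simp
    qed
    then have "of_int i > (of_int (-1) :: rat)" by simp
    then have "i > -1" by (simp only: of_int_less_iff)
    then have "of_int i = (of_nat (nat i) :: rat)" by simp
    with i have "m = quad \<beta> r + of_nat (eta_exponent h) / 24 + of_nat (nat i)" by linarith
    then have "p = index_map h (x, nat i)" by (simp only: p(1) index_map_def case_prod_conv r)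
    then show "p \<in> range (index_map h)" by blast
  qed
qed

lemma index_map_summand:
  "(\<lambda>(m, r). c (m, r) * ee (of_rat m * \<tau>) * ee (bil \<beta> z (vec_of_rat r))) (index_map h (x, j))
     = ee (of_nat (eta_exponent h) * \<tau> / 24) * (c (index_map h (x, j)) * sgn_lat x * ee \<tau> ^ j * thterm x \<tau> z)"
proof -
  have v: "vec_of_rat (r0 + vec_of_int x) = cvec (sv x)" by (simp add: cvec_sv \<rho>_def vec_of_rat_add)
  have q: "of_rat (quad \<beta> (r0 + vec_of_int x)) = quad \<beta> (cvec (sv x))" by (simp only: v [symmetric] quad_vec_of_rat)
  have "ee (of_rat (quad \<beta> (r0 + vec_of_int x) + of_nat (eta_exponent h) / 24 + of_nat j) * \<tau>)
     = ee (quad \<beta> (cvec (sv x)) * \<tau>) * ee (of_nat (eta_exponent h) * \<tau> / 24) * ee \<tau> ^ j"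
  proof -
    have "of_rat (quad \<beta> (r0 + vec_of_int x) + of_nat (eta_exponent h) / 24 + of_nat j) * \<tau>
       = quad \<beta> (cvec (sv x)) * \<tau> + of_nat (eta_exponent h) * \<tau> / 24 + of_nat j * \<tau>"
      by (simp only: of_rat_add of_rat_divide q of_rat_of_nat_eq of_rat_numeral_eq) (simp add: algebra_simps)
    then show ?thesis by (simp only: ee_add ee_of_nat_mult)
  qed
  moreover have "bil \<beta> z (cvec (sv x)) = bil \<beta> (cvec (sv x)) z" by (rule bil_commute)
  moreover have "sgn_lat x * thterm x \<tau> z = ee (quad \<beta> (cvec (sv x)) * \<tau>) * ee (bil \<beta> (cvec (sv x)) z)"
  proof -
    have "sgn_lat x * thterm x \<tau> z = (sgn_lat x * sgn_lat x) * ee (quad \<beta> (cvec (sv x)) * \<tau> + bil \<beta> (cvec (sv x)) z)"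
      by (simp only: thterm_def mult.assoc)
    then show ?thesis by (simp only: sgn_lat_sq mult_1_left ee_add)
  qed
  moreover have "ee (of_nat (eta_exponent h) * \<tau> / 24) * (c (index_map h (x, j)) * sgn_lat x * ee \<tau> ^ j * thterm x \<tau> z)
     = ee (of_nat (eta_exponent h) * \<tau> / 24) * c (index_map h (x, j)) * ee \<tau> ^ j * (sgn_lat x * thterm x \<tau> z)"
    by (simp only: mult_ac)
  ultimately show ?thesis
    by (simp only: index_map_def case_prod_conv v mult_ac)
qed

text \<open>
  The quasi-periodicity in the direction \<open>y\<tau>\<close> and the uniqueness of theta expansions show that the
  coefficients \<open>B\<close> are invariant under all translations of the lattice.
\<close>
lemma quasi_periodic_multiple_of_theta:
  assumes \<tau>: "\<tau> \<in> upper_half_plane"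
    and expansion: "\<And>z. ((\<lambda>x. B x * thterm x \<tau> z) has_sum \<Phi> z) UNIV"
    and quasi: "\<And>y z. \<Phi> (z + \<tau> *s vec_of_int y) * ee (\<tau> * quad \<beta> (vec_of_int y) + bil \<beta> (vec_of_int y) z) = sgn_lat y * \<Phi> z"
  shows "\<Phi> z = B 0 * th \<tau> z"
proof -
  have shift: "B x = B (x - y)" for x y
  proof -
    have "((\<lambda>x. (B x - B (x - y)) * thterm x \<tau> z) has_sum 0) UNIV" for z
    proof -
      have "((\<lambda>x. B x * thterm x \<tau> (z + \<tau> *s vec_of_int y) * ee (\<tau> * quad \<beta> (vec_of_int y) + bil \<beta> (vec_of_int y) z)) has_sum sgn_lat y * \<Phi> z) UNIV"
        unfolding quasi [symmetric] by (intro has_sum_cmult_left expansion)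
      then have "((\<lambda>x. B x * (sgn_lat y * thterm (x + y) \<tau> z)) has_sum sgn_lat y * \<Phi> z) UNIV"
        by (simp only: mult.assoc thterm_quasi)
      from has_sum_cmult_right [OF this, of "sgn_lat y"]
      have "((\<lambda>x. (sgn_lat y * sgn_lat y) * (B x * thterm (x + y) \<tau> z)) has_sum (sgn_lat y * sgn_lat y) * \<Phi> z) UNIV"
        by (simp only: mult_ac)
      then have s: "((\<lambda>x. B x * thterm (x + y) \<tau> z) has_sum \<Phi> z) UNIV" by simp
      have bij: "bij (\<lambda>x :: int^'n. x - y)"
        by (rule bij_betw_byWitness [where f' = "\<lambda>x. x + y"]) auto
      have "((\<lambda>x. B (x - y) * thterm x \<tau> z) has_sum \<Phi> z) UNIV"
        using has_sum_reindex_bij_betw [OF bij, of "\<lambda>x. B x * thterm (x + y) \<tau> z"] s by simp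
      from has_sum_add [OF expansion [of z] has_sum_uminusI [OF this]]
      show ?thesis by (simp add: algebra_simps)
    qed
    then have "B x - B (x - y) = 0" by (rule theta_expansion_unique)
    then show ?thesis by simp
  qed
  have "B = (\<lambda>x. B 0)"
  proof (rule ext)
    show "B x = B 0" for x using shift [of x x] by (simp only: diff_self)
  qed
  then have "(\<lambda>x. B x * thterm x \<tau> z) = (\<lambda>x. B 0 * thterm x \<tau> z)" by metis
  with expansion [of z] have "((\<lambda>x. B 0 * thterm x \<tau> z) has_sum \<Phi> z) UNIV" by (simp only:)
  then show ?thesis by (rule has_sum_unique) (intro has_sum_cmult_right th_has_sum \<tau>)
qed

text \<open>
  Summed over \<open>j\<close> first, the Fourier expansion is an expansion in the terms of theta, whose coefficients
  are power series in \<open>q\<close>. All of them are equal, and one of them is \<open>F\<close>.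
\<close>
lemma jacobi_form_multiple_of_theta:
  assumes "\<phi> \<in> jacobi_forms \<beta> k h"
  shows "\<exists>F. F holomorphic_on ball 0 1 \<and>
    (\<forall>\<tau>\<in>upper_half_plane. \<forall>z. \<phi> (\<tau>, z) = ee (of_nat (eta_exponent h) * \<tau> / 24) * F (ee \<tau>) * th \<tau> z)"
proof -
  let ?E = "\<lambda>\<tau>. ee (of_nat (eta_exponent h) * \<tau> / 24)"
  obtain c where c: "\<And>\<tau> z. \<tau> \<in> upper_half_plane \<Longrightarrow>
      ((\<lambda>(m, r). c (m, r) * ee (of_rat m * \<tau>) * ee (bil \<beta> z (vec_of_rat r))) has_sum \<phi> (\<tau>, z)) (expansion_index h)"
    using assms unfolding jacobi_forms_def expansion_index_def by blast
  have quasi: "\<phi> (\<tau>, z + \<tau> *s vec_of_int y) * ee (\<tau> * quad \<beta> (vec_of_int y) + bil \<beta> (vec_of_int y) z) = sgn_lat y * \<phi> (\<tau>, z)"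
    if "\<tau> \<in> upper_half_plane" for \<tau> y z
  proof -
    have "\<phi> (\<tau>, z + \<tau> *s vec_of_int y + vec_of_int 0) * ee (\<tau> * quad \<beta> (vec_of_int y) + bil \<beta> (vec_of_int y) z)
      = ee (quad \<beta> (vec_of_int (y + 0))) * \<phi> (\<tau>, z)"
      using assms that unfolding jacobi_forms_def by blast
    then show ?thesis by (simp add: sgn_lat_def)
  qed
  define d where "d x j = c (index_map h (x, j)) * sgn_lat x" for x j
  define A where "A x \<tau> = (\<Sum>\<^sub>\<infinity>j\<in>UNIV. d x j * ee \<tau> ^ j)" for x \<tau>
  have double: "((\<lambda>(x, j). ?E \<tau> * (d x j * ee \<tau> ^ j * thterm x \<tau> z)) has_sum \<phi> (\<tau>, z)) (UNIV \<times> UNIV)"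
    if "\<tau> \<in> upper_half_plane" for \<tau> z
  proof -
    have "((\<lambda>p. (\<lambda>(m, r). c (m, r) * ee (of_rat m * \<tau>) * ee (bil \<beta> z (vec_of_rat r))) (index_map h p)) has_sum \<phi> (\<tau>, z)) UNIV"
      by (subst has_sum_reindex_bij_betw [OF bij_index_map]) (rule c [OF that])
    also have "(\<lambda>p. (\<lambda>(m, r). c (m, r) * ee (of_rat m * \<tau>) * ee (bil \<beta> z (vec_of_rat r))) (index_map h p))
       = (\<lambda>(x, j). ?E \<tau> * (d x j * ee \<tau> ^ j * thterm x \<tau> z))"
    proof (rule ext)
      fix p :: "(int^'n) \<times> nat"
      obtain x j where p: "p = (x, j)" by fastforce
      show "(\<lambda>(m, r). c (m, r) * ee (of_rat m * \<tau>) * ee (bil \<beta> z (vec_of_rat r))) (index_map h p)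
         = (\<lambda>(x, j). ?E \<tau> * (d x j * ee \<tau> ^ j * thterm x \<tau> z)) p"
        unfolding p index_map_summand d_def by (simp only: case_prod_conv)
    qed
    finally show ?thesis by simp
  qed
  have inner: "((\<lambda>j. d x j * ee \<tau> ^ j) has_sum A x \<tau>) UNIV" if "\<tau> \<in> upper_half_plane" for \<tau> x
  proof -
    have "(\<lambda>j. ?E \<tau> * (d x j * ee \<tau> ^ j * thterm x \<tau> 0)) summable_on UNIV"
      by (rule summable_on_SigmaD1 [where A = UNIV and B = "\<lambda>_. UNIV"])
         (use double [OF that, of 0] in \<open>auto intro: has_sum_imp_summable\<close>)
    then have "(\<lambda>j. inverse (?E \<tau> * thterm x \<tau> 0) * (?E \<tau> * (d x j * ee \<tau> ^ j * thterm x \<tau> 0))) summable_on UNIV"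
      by (rule summable_on_cmult_right)
    moreover have "thterm x \<tau> 0 \<noteq> 0" by (simp add: thterm_def)
    then have "inverse (?E \<tau> * thterm x \<tau> 0) * (?E \<tau> * (d x j * ee \<tau> ^ j * thterm x \<tau> 0)) = d x j * ee \<tau> ^ j" for j
      by (simp add: field_simps)
    ultimately have "(\<lambda>j. d x j * ee \<tau> ^ j) summable_on UNIV" by (simp only:)
    then show ?thesis unfolding A_def by (rule has_sum_infsum)
  qed
  have outer: "((\<lambda>x. (?E \<tau> * A x \<tau>) * thterm x \<tau> z) has_sum \<phi> (\<tau>, z)) UNIV" if "\<tau> \<in> upper_half_plane" for \<tau> z
  proof (rule has_sum_SigmaD [OF double [OF that]])
    fix x :: "int^'n"
    have "((\<lambda>j. ?E \<tau> * ((d x j * ee \<tau> ^ j) * thterm x \<tau> z)) has_sum ?E \<tau> * (A x \<tau> * thterm x \<tau> z)) UNIV"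
      by (intro has_sum_cmult_right has_sum_cmult_left inner that)
    then show "((\<lambda>j. case (x, j) of (x, j) \<Rightarrow> ?E \<tau> * (d x j * ee \<tau> ^ j * thterm x \<tau> z)) has_sum (?E \<tau> * A x \<tau>) * thterm x \<tau> z) UNIV"
      by (simp add: mult.assoc)
  qed
  have main: "\<phi> (\<tau>, z) = (?E \<tau> * A 0 \<tau>) * th \<tau> z" if "\<tau> \<in> upper_half_plane" for \<tau> z
    by (rule quasi_periodic_multiple_of_theta [OF that outer [OF that] quasi [OF that]])
  have "summable (\<lambda>j. d 0 j * ee \<tau> ^ j)" if "\<tau> \<in> upper_half_plane" for \<tau>
    using has_sum_imp_sums [OF inner [OF that, of 0]] by (rule sums_summable)
  from power_series_on_disc [OF this] obtain F where F: "F holomorphic_on ball 0 1"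
    "\<forall>\<tau>\<in>upper_half_plane. (\<lambda>j. d 0 j * ee \<tau> ^ j) sums F (ee \<tau>)" by blast
  have "\<phi> (\<tau>, z) = ?E \<tau> * F (ee \<tau>) * th \<tau> z" if "\<tau> \<in> upper_half_plane" for \<tau> z
  proof -
    have "A 0 \<tau> = F (ee \<tau>)"
      using has_sum_imp_sums [OF inner [OF that, of 0]] bspec [OF F(2) that] by (rule sums_unique2)
    then show ?thesis by (simp only: main [OF that])
  qed
  with F(1) show ?thesis by blast
qed

text \<open>
  The product of the two absolutely convergent series is a Fourier expansion of the required shape, since the
  summands on both sides correspond to each other.
\<close>
lemma theta_multiple_expansion:
  assumes F: "F holomorphic_on ball 0 1"
  shows "\<exists>c. \<forall>\<tau>\<in>upper_half_plane. \<forall>z.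
    ((\<lambda>(m, r). c (m, r) * ee (of_rat m * \<tau>) * ee (bil \<beta> z (vec_of_rat r)))
       has_sum ee (of_nat (eta_exponent h) * \<tau> / 24) * F (ee \<tau>) * th \<tau> z) (expansion_index h)"
proof -
  let ?E = "\<lambda>\<tau>. ee (of_nat (eta_exponent h) * \<tau> / 24)"
  obtain b :: "nat \<Rightarrow> complex" where b0: "\<forall>\<tau>\<in>upper_half_plane.
    ((\<lambda>m. b m * ee \<tau> ^ m) has_sum F (ee \<tau>)) UNIV \<and> summable (\<lambda>m. norm (b m * ee \<tau> ^ m))"
    using holomorphic_in_q_expansion [OF F] by (rule exE)
  have b: "((\<lambda>m. b m * ee \<tau> ^ m) has_sum F (ee \<tau>)) UNIV" "summable (\<lambda>m. norm (b m * ee \<tau> ^ m))"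
    if "\<tau> \<in> upper_half_plane" for \<tau>
    using bspec [OF b0 that] by (auto simp only:)
  define c where "c p = (case inv_into UNIV (index_map h) p of (x, j) \<Rightarrow> b j * sgn_lat x)" for p
  have inj: "inj (index_map h)" using bij_index_map [of h] by (simp add: bij_betw_def)
  have c: "c (index_map h (x, j)) = b j * sgn_lat x" for x j
    by (simp add: c_def inv_f_f [OF inj])
  show ?thesis
  proof (intro exI [of _ c] ballI allI)
    fix \<tau> z assume \<tau>: "\<tau> \<in> upper_half_plane"
    have "((\<lambda>(x, j). thterm x \<tau> z * (b j * ee \<tau> ^ j)) has_sum th \<tau> z * F (ee \<tau>)) (UNIV \<times> UNIV)"
    proof (rule has_sum_SigmaI)
      show "((\<lambda>j. case (x, j) of (x, j) \<Rightarrow> thterm x \<tau> z * (b j * ee \<tau> ^ j)) has_sum thterm x \<tau> z * F (ee \<tau>)) UNIV" for x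
        using has_sum_cmult_right [OF b(1) [OF \<tau>], of "thterm x \<tau> z"] by simp
      show "((\<lambda>x. thterm x \<tau> z * F (ee \<tau>)) has_sum th \<tau> z * F (ee \<tau>)) UNIV"
        by (intro has_sum_cmult_left th_has_sum \<tau>)
      have s1: "(\<lambda>x. norm (thterm x \<tau> z)) summable_on UNIV"
        using thterm_summable [OF \<tau>, of z] by (simp add: summable_on_iff_abs_summable_on_complex)
      have s2: "(\<lambda>j. norm (b j * ee \<tau> ^ j)) summable_on UNIV"
        by (rule norm_summable_imp_summable_on) (use b(2) [OF \<tau>] in simp)
      define g where "g = (\<lambda>j. b j * ee \<tau> ^ j)"
      have s2': "(\<lambda>j. norm (g j)) summable_on UNIV" using s2 by (simp only: g_def)
      have "(\<lambda>p. norm (case p of (x, j) \<Rightarrow> thterm x \<tau> z * g j)) summable_on UNIV \<times> UNIV"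
      proof (subst Infinite_Sum.abs_summable_on_Sigma_iff, intro conjI ballI)
        show "(\<lambda>j. norm (case (x, j) of (x, j) \<Rightarrow> thterm x \<tau> z * g j)) summable_on UNIV" for x
          unfolding case_prod_conv norm_mult by (rule summable_on_cmult_right [OF s2'])
        have "(\<lambda>x. norm (norm (thterm x \<tau> z) * (\<Sum>\<^sub>\<infinity>j\<in>UNIV. norm (g j)))) = (\<lambda>x. norm (thterm x \<tau> z) * \<bar>\<Sum>\<^sub>\<infinity>j\<in>UNIV. norm (g j)\<bar>)"
          by (simp add: abs_mult)
        then show "(\<lambda>x. norm (\<Sum>\<^sub>\<infinity>j\<in>UNIV. norm (case (x, j) of (x, j) \<Rightarrow> thterm x \<tau> z * g j))) summable_on UNIV"
          unfolding case_prod_conv norm_mult infsum_cmult_right' by (simp only: norm_mult [symmetric]) (simp add: abs_mult summable_on_cmult_left [OF s1])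
      qed
      then have "(\<lambda>(x, j). thterm x \<tau> z * g j) summable_on UNIV \<times> UNIV"
        by (rule abs_summable_summable)
      then show "(\<lambda>(x, j). thterm x \<tau> z * (b j * ee \<tau> ^ j)) summable_on UNIV \<times> UNIV"
        by (simp only: g_def)
    qed
    then have "((\<lambda>p. ?E \<tau> * (case p of (x, j) \<Rightarrow> thterm x \<tau> z * (b j * ee \<tau> ^ j))) has_sum ?E \<tau> * (th \<tau> z * F (ee \<tau>))) (UNIV \<times> UNIV)"
      by (rule has_sum_cmult_right)
    moreover have "?E \<tau> * (case p of (x, j) \<Rightarrow> thterm x \<tau> z * (b j * ee \<tau> ^ j))
       = (\<lambda>(m, r). c (m, r) * ee (of_rat m * \<tau>) * ee (bil \<beta> z (vec_of_rat r))) (index_map h p)" for p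
    proof -
      obtain x j where p: "p = (x, j)" by fastforce
      have "b j * sgn_lat x * sgn_lat x = b j * (sgn_lat x * sgn_lat x)" by (simp only: mult.assoc)
      then have "b j * sgn_lat x * sgn_lat x = b j" by simp
      then show ?thesis unfolding p index_map_summand c by (simp only: case_prod_conv mult_ac)
    qed
    ultimately have "((\<lambda>p. (\<lambda>(m, r). c (m, r) * ee (of_rat m * \<tau>) * ee (bil \<beta> z (vec_of_rat r))) (index_map h p)) has_sum ?E \<tau> * F (ee \<tau>) * th \<tau> z) UNIV"
      by (simp add: mult_ac)
    then show "((\<lambda>(m, r). c (m, r) * ee (of_rat m * \<tau>) * ee (bil \<beta> z (vec_of_rat r))) has_sum ?E \<tau> * F (ee \<tau>) * th \<tau> z) (expansion_index h)"
      by (subst (asm) has_sum_reindex_bij_betw [OF bij_index_map])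
  qed
qed

end

section \<open>Jacobi forms and modular forms\<close>

text \<open>
  The bookkeeping of automorphy factors: \<open>\<phi> = f \<theta>\<close> has weight \<open>K/2\<close> and character \<open>e\<^sup>h\<close> if and only if
  \<open>f\<close> has the weight and character that remain after those of theta are split off.
\<close>
lemma powi_transform_iff:
  fixes e w x y :: complex
  assumes "e \<noteq> 0" "w \<noteq> 0"
  shows "x * (e ^ m * w ^ n) * w powi (- K) = e powi h * y \<longleftrightarrow>
    x = e powi (h - int m) * w powi (K - int n) * y"
  using assms by (simp add: power_int_diff power_int_minus field_simps)

lemma powi_mod_24:
  fixes e :: complex
  assumes "e ^ 24 = 1" "int a = m + 24 * t"
  shows "e powi m = e ^ a"
proof -
  have e: "e \<noteq> 0" using assms(1) by auto
  have "e powi (24 * t) = 1" using assms(1) by (simp add: power_int_mult)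
  then have "e powi (m + 24 * t) = e powi m" using e by (simp add: power_int_add)
  then show ?thesis by (simp add: assms(2) [symmetric])
qed

text \<open>
  The element \<open>(-1, \<i>)\<close> of the metaplectic group acts on weights by powers of \<open>\<i>\<close>.
\<close>
lemma imaginary_unit_powi_eq_1:
  assumes "\<i> powi p = 1"
  shows "4 dvd p"
proof -
  define r where "r = nat (p mod 4)"
  have r: "r < 4" "p = 4 * (p div 4) + int r" by (auto simp: r_def nat_less_iff)
  have "\<i> powi (4 * (p div 4)) = 1" by (simp add: power_int_mult)
  moreover have "\<i> powi (4 * (p div 4) + int r) = \<i> powi (4 * (p div 4)) * \<i> powi int r"
    by (rule power_int_add) simp
  then have "\<i> powi p = \<i> powi (4 * (p div 4)) * \<i> ^ r"
    by (simp only: r(2) [symmetric] power_int_of_nat)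
  ultimately have "\<i> ^ r = 1" using assms by simp
  moreover have "r = 0 \<or> r = 1 \<or> r = 2 \<or> r = 3" using r(1) by linarith
  ultimately have "r = 0" by (auto simp: power3_eq_cube complex_eq_iff)
  then show ?thesis using r(2) by (metis add.right_neutral dvd_triv_left of_nat_0)
qed

lemma eps_nonzero:
  assumes "(A, w) \<in> Mp2Z"
  shows "eps (A, w) \<noteq> 0" "norm (eps (A, w)) = 1"
proof -
  have i: "\<i> \<in> upper_half_plane" by (simp add: upper_half_plane_def)
  have e: "eps (A, w) ^ 24 = 1" by (rule eta_transform(2) [OF assms i])
  then show "eps (A, w) \<noteq> 0" by auto
  show "norm (eps (A, w)) = 1" using power_eq_1_iff [OF e] by simp
qed

lemma eta_power_eq:
  assumes "\<tau> \<in> upper_half_plane"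
  shows "eta \<tau> ^ a = ee (of_nat a * \<tau> / 24) * euler_prod (ee \<tau>) ^ a"
  by (simp add: eta_eq [OF assms] power_mult_distrib ee_power)

lemma constant_modular_form: "(\<lambda>\<tau>. c * (if \<tau> \<in> upper_half_plane then 1 else 0)) \<in> modular_forms 0"
proof -
  have "(\<lambda>m. (if m = 0 then c else 0) * ee (of_nat m * \<tau>)) sums c" for \<tau>
    using sums_finite [of "{0}" "\<lambda>m. (if m = 0 then c else 0) * ee (of_nat m * \<tau>)"] by (simp add: ee_0)
  then have "\<exists>a :: nat \<Rightarrow> complex. \<forall>\<tau>\<in>upper_half_plane.
      (\<lambda>m. a m * ee (of_nat m * \<tau>)) sums (c * (if \<tau> \<in> upper_half_plane then 1 else 0))"
    by (intro exI [of _ "\<lambda>m. if m = 0 then c else 0"]) simp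
  moreover have "(\<lambda>\<tau>. c * (if \<tau> \<in> upper_half_plane then 1 else 0)) holomorphic_on upper_half_plane"
    by (rule holomorphic_transform [of "\<lambda>_. c"]) auto
  ultimately show ?thesis by (simp add: modular_forms_def moebius_uhp)
qed

lemma subspace_multiplier:
  assumes "fun_space.subspace S"
  shows "fun_space.subspace {f. (\<lambda>p. f (fst p) * u p) \<in> S}"
proof -
  have "(\<lambda>p. (f + g) (fst p) * u p) \<in> S" if "(\<lambda>p. f (fst p) * u p) \<in> S" "(\<lambda>p. g (fst p) * u p) \<in> S" for f g
  proof -
    have "(\<lambda>p. (f + g) (fst p) * u p) = (\<lambda>p. f (fst p) * u p) + (\<lambda>p. g (fst p) * u p)"
      by (simp add: fun_eq_iff algebra_simps)
    then show ?thesis using fun_space.subspace_add [OF assms that] by (simp only:)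
  qed
  moreover have "(\<lambda>p. (c * f (fst p)) * u p) \<in> S" if "(\<lambda>p. f (fst p) * u p) \<in> S" for f c
  proof -
    have "(\<lambda>p. (c * f (fst p)) * u p) = (\<lambda>p. c * (f (fst p) * u p))" by (simp add: fun_eq_iff)
    then show ?thesis using fun_space.subspace_scale [OF assms that, of c] by (simp only:)
  qed
  moreover have "(\<lambda>p. (0 :: 'a \<Rightarrow> complex) (fst p) * u p) \<in> S"
  proof -
    have "(\<lambda>p. (0 :: 'a \<Rightarrow> complex) (fst p) * u p) = 0" by (simp add: fun_eq_iff)
    then show ?thesis using fun_space.subspace_0 [OF assms] by (simp only:)
  qed
  ultimately show ?thesis unfolding fun_space.subspace_def by blast
qed

lemma subspace_multiples:
  assumes M: "fun_space.subspace M"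
  shows "fun_space.subspace {\<lambda>p. f (fst p) * u p | f. f \<in> M}"
  unfolding fun_space.subspace_def
proof (intro conjI ballI allI)
  have "0 = (\<lambda>p. (0 :: 'a \<Rightarrow> complex) (fst p) * u p)" by (simp add: fun_eq_iff)
  then show "0 \<in> {\<lambda>p. f (fst p) * u p | f. f \<in> M}" using fun_space.subspace_0 [OF M] by blast
next
  fix x y assume "x \<in> {\<lambda>p. f (fst p) * u p | f. f \<in> M}" "y \<in> {\<lambda>p. f (fst p) * u p | f. f \<in> M}"
  then obtain f g where fg: "x = (\<lambda>p. f (fst p) * u p)" "y = (\<lambda>p. g (fst p) * u p)" "f \<in> M" "g \<in> M" by blast
  then have "x + y = (\<lambda>p. (f + g) (fst p) * u p)" by (simp add: fun_eq_iff algebra_simps)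
  then show "x + y \<in> {\<lambda>p. f (fst p) * u p | f. f \<in> M}" using fun_space.subspace_add [OF M fg(3,4)] by blast
next
  fix c x assume "x \<in> {\<lambda>p. f (fst p) * u p | f. f \<in> M}"
  then obtain f where f: "x = (\<lambda>p. f (fst p) * u p)" "f \<in> M" by blast
  then have "(\<lambda>p. c * x p) = (\<lambda>p. (\<lambda>\<tau>. c * f \<tau>) (fst p) * u p)" by (simp add: fun_eq_iff)
  then show "(\<lambda>p. c * x p) \<in> {\<lambda>p. f (fst p) * u p | f. f \<in> M}" using fun_space.subspace_scale [OF M f(2), of c] by (intro CollectI exI [of _ "\<lambda>\<tau>. c * f \<tau>"] conjI)
qed

context unimodular_lattice begin

text \<open>
  The theta function of the generator of \<open>W\<close>, extended by zero. All others are multiples of it.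
\<close>
definition theta_fn :: "complex \<times> (complex^'n) \<Rightarrow> complex" where
  "theta_fn = (\<lambda>(\<tau>, z). if \<tau> \<in> upper_half_plane then th \<tau> z else 0)"

lemma theta_eq_theta_fn: "l \<in> W_space \<beta> \<Longrightarrow> theta \<beta> l = (\<lambda>p. l r0 * theta_fn p)"
proof (rule ext)
  fix p :: "complex \<times> (complex^'n)"
  assume l: "l \<in> W_space \<beta>"
  obtain \<tau> z where p: "p = (\<tau>, z)" by fastforce
  show "theta \<beta> l p = l r0 * theta_fn p"
  proof (cases "\<tau> \<in> upper_half_plane")
    case True
    then show ?thesis unfolding p theta_eq_th [OF l True] by (simp add: theta_fn_def)
  next
    case False
    then show ?thesis by (simp add: p theta_def theta_fn_def)
  qed
qed

text \<open>
  Divide the transformation law of \<open>\<phi>\<close> by that of theta at a point \<open>z\<close> where theta does not vanish.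
\<close>
lemma multiple_transform:
  assumes \<phi>: "\<phi> \<in> jacobi_forms \<beta> k h"
    and f: "\<And>\<tau> z. \<tau> \<in> upper_half_plane \<Longrightarrow> \<phi> (\<tau>, z) = f \<tau> * th \<tau> z"
    and \<alpha>: "(A, w) \<in> Mp2Z" and \<tau>: "\<tau> \<in> upper_half_plane"
  shows "f (moebius_act A \<tau>) = eps (A, w) powi (h - int (3 * CARD('n))) * w \<tau> powi (\<lfloor>2 * k\<rfloor> - int CARD('n)) * f \<tau>"
proof -
  obtain z where z: "th \<tau> z \<noteq> 0" by (rule th_not_identically_zero [OF \<tau>])
  let ?J = "ee (- of_int (A $ 2 $ 1) * quad \<beta> z / cocycle A \<tau>)"
  let ?z = "inverse (cocycle A \<tau>) *s z"
  have J: "\<phi> (moebius_act A \<tau>, ?z) * ?J * w \<tau> powi (- \<lfloor>2 * k\<rfloor>) = eps (A, w) powi h * \<phi> (\<tau>, z)"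
    using \<phi> \<alpha> \<tau> unfolding jacobi_forms_def by blast
  have t: "th (moebius_act A \<tau>) ?z * ?J = eps (A, w) ^ (3 * CARD('n)) * w \<tau> ^ CARD('n) * th \<tau> z"
    by (rule theta_transform [OF \<alpha> \<tau>])
  note A = Mp2ZD [OF \<alpha>]
  have "f (moebius_act A \<tau>) * (th (moebius_act A \<tau>) ?z * ?J) * w \<tau> powi (- \<lfloor>2 * k\<rfloor>) = eps (A, w) powi h * (f \<tau> * th \<tau> z)"
    using J by (simp only: f [OF moebius_uhp [OF A(1) \<tau>]] f [OF \<tau>] mult.assoc)
  then have "(f (moebius_act A \<tau>) * (eps (A, w) ^ (3 * CARD('n)) * w \<tau> ^ CARD('n)) * w \<tau> powi (- \<lfloor>2 * k\<rfloor>)) * th \<tau> z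
     = (eps (A, w) powi h * f \<tau>) * th \<tau> z"
    unfolding t by (simp only: mult_ac)
  then have "f (moebius_act A \<tau>) * (eps (A, w) ^ (3 * CARD('n)) * w \<tau> ^ CARD('n)) * w \<tau> powi (- \<lfloor>2 * k\<rfloor>)
     = eps (A, w) powi h * f \<tau>"
    by (rule mult_right_cancel [OF z, THEN iffD1])
  then show ?thesis using powi_transform_iff [OF eps_nonzero(1) [OF \<alpha>] A(4) [OF \<tau>]] by blast
qed

text \<open>
  The quotient \<open>f = \<phi>/\<theta>\<close> has the character \<open>\<epsilon>\<^sup>h\<^sup>-\<^sup>3\<^sup>n = \<epsilon>\<^sup>a\<close> of \<open>\<eta>\<^sup>a\<close> and starts with the same power
  \<open>q\<^sup>a\<^sup>/\<^sup>2\<^sup>4\<close>. Since \<open>\<eta>\<close> has no zeros, \<open>g = f/\<eta>\<^sup>a\<close> is holomorphic at the cusp too, and has trivial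
  character. The element \<open>(-1, \<i>)\<close> of the metaplectic group acts trivially on the half plane, and this
  restricts the weight of \<open>g\<close>.
\<close>
lemma jacobi_form_decomposition:
  assumes \<phi>: "\<phi> \<in> jacobi_forms \<beta> k h" and nz: "\<phi> \<noteq> 0"
  shows "\<exists>g \<kappa>. even \<kappa> \<and> g \<in> modular_forms \<kappa> \<and>
    \<lfloor>2 * k\<rfloor> = int CARD('n) + int (eta_exponent h) + 2 * \<kappa> \<and>
    \<phi> = (\<lambda>p. eta (fst p) ^ eta_exponent h * g (fst p) * theta_fn p)"
proof -
  define a where "a = eta_exponent h"
  obtain t where t: "int a = h - 3 * int CARD('n) + 24 * t" using eta_exponent_cong unfolding a_def by blast
  define p where "p = \<lfloor>2 * k\<rfloor> - int CARD('n) - int a"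
  from jacobi_form_multiple_of_theta [OF \<phi>, folded a_def] obtain F where F: "F holomorphic_on ball 0 1"
    and \<phi>F: "\<And>\<tau> z. \<tau> \<in> upper_half_plane \<Longrightarrow> \<phi> (\<tau>, z) = ee (of_nat a * \<tau> / 24) * F (ee \<tau>) * th \<tau> z"
    by blast
  define G where "G q = F q / euler_prod q ^ a" for q
  have G: "G holomorphic_on ball 0 1"
    unfolding G_def by (intro holomorphic_intros F euler_prod_holomorphic) (auto simp: euler_prod_nonzero)
  define g where "g \<tau> = (if \<tau> \<in> upper_half_plane then G (ee \<tau>) else 0)" for \<tau>
  have \<phi>g: "\<phi> (\<tau>, z) = (eta \<tau> ^ a * g \<tau>) * th \<tau> z" if "\<tau> \<in> upper_half_plane" for \<tau> z
    using that norm_ee_less_1 [OF that] by (simp add: \<phi>F eta_power_eq g_def G_def euler_prod_nonzero)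
  have trans: "g (moebius_act A \<tau>) = w \<tau> powi p * g \<tau>" if \<alpha>: "(A, w) \<in> Mp2Z" and \<tau>: "\<tau> \<in> upper_half_plane" for A w \<tau>
  proof -
    note A = Mp2ZD [OF \<alpha>]
    let ?e = "eps (A, w)"
    have e: "?e powi (h - int (3 * CARD('n))) = ?e ^ a"
      by (rule powi_mod_24 [OF eta_transform(2) [OF \<alpha> \<tau>], of _ _ t]) (simp add: t)
    \<comment> \<open>what is left of the weight after splitting off theta and \<open>\<eta>\<^sup>a\<close>\<close>
    have w: "w \<tau> powi (\<lfloor>2 * k\<rfloor> - int CARD('n)) = w \<tau> ^ a * w \<tau> powi p"
    proof -
      have "\<lfloor>2 * k\<rfloor> - int CARD('n) = int a + p" by (simp add: p_def)
      then show ?thesis using A(4) [OF \<tau>] by (simp add: power_int_add)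
    qed
    have "eta (moebius_act A \<tau>) ^ a * g (moebius_act A \<tau>) = ?e ^ a * (w \<tau> ^ a * w \<tau> powi p) * (eta \<tau> ^ a * g \<tau>)"
      using multiple_transform [OF \<phi> \<phi>g \<alpha> \<tau>] unfolding e w .
    then have "(?e ^ a * w \<tau> ^ a * eta \<tau> ^ a) * g (moebius_act A \<tau>) = (?e ^ a * w \<tau> ^ a * eta \<tau> ^ a) * (w \<tau> powi p * g \<tau>)"
      unfolding eta_transform(1) [OF \<alpha> \<tau>] power_mult_distrib by (simp only: mult_ac)
    moreover have n: "?e ^ a * w \<tau> ^ a * eta \<tau> ^ a \<noteq> 0"
      using eps_nonzero(1) [OF \<alpha>] A(4) [OF \<tau>] eta_nonzero [OF \<tau>] by simp
    ultimately show ?thesis by (metis mult_left_cancel)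
  qed
  have "\<exists>\<tau>\<in>upper_half_plane. g \<tau> \<noteq> 0"
  proof (rule ccontr)
    assume none: "\<not> (\<exists>\<tau>\<in>upper_half_plane. g \<tau> \<noteq> 0)"
    have "\<phi> (\<tau>, z) = 0" for \<tau> z
    proof (cases "\<tau> \<in> upper_half_plane")
      case True
      then have "g \<tau> = 0" using none by blast
      then show ?thesis by (simp add: \<phi>g [OF True])
    next
      case False
      then show ?thesis using \<phi> unfolding jacobi_forms_def by blast
    qed
    then have "\<phi> = 0" by (auto simp: fun_eq_iff)
    then show False using nz by blast
  qed
  then obtain \<tau>1 where \<tau>1: "\<tau>1 \<in> upper_half_plane" "g \<tau>1 \<noteq> 0" by blast
  have "4 dvd p"
  proof -
    \<comment> \<open>the element \<open>(-1, \<i>)\<close> fixes every point of the half plane\<close>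
    define N :: "int^2^2" where "N = vector [vector [-1, 0], vector [0, -1]]"
    have N: "N \<in> SL2Z" by (simp add: SL2Z_det N_def)
    have c: "cocycle N \<tau> = -1" for \<tau> by (simp add: cocycle_def N_def)
    have "(\<lambda>\<tau>. if \<tau> \<in> upper_half_plane then \<i> else 0) holomorphic_on upper_half_plane"
      by (rule holomorphic_transform [of "\<lambda>_. \<i>"]) auto
    then have "(N, \<lambda>\<tau>. if \<tau> \<in> upper_half_plane then \<i> else 0) \<in> Mp2Z"
      by (simp add: Mp2Z_def N c)
    from trans [OF this \<tau>1(1)] have "g (moebius_act N \<tau>1) = \<i> powi p * g \<tau>1" using \<tau>1(1) by simp
    moreover have "moebius_act N \<tau>1 = \<tau>1" by (simp add: moebius_act_def c) (simp add: N_def)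
    ultimately have "\<i> powi p = 1" using \<tau>1(2) by simp
    then show ?thesis by (rule imaginary_unit_powi_eq_1)
  qed
  then obtain u where u: "p = 4 * u" by (auto simp: dvd_def)
  have "g \<in> modular_forms (2 * u)"
    unfolding modular_forms_def mem_Collect_eq
  proof (intro conjI allI impI ballI)
    show "g \<tau> = 0" if "\<tau> \<notin> upper_half_plane" for \<tau> using that by (simp add: g_def)
    have "(\<lambda>\<tau>. G (ee \<tau>)) holomorphic_on upper_half_plane"
      by (intro holomorphic_on_compose_gen [OF _ G, unfolded o_def] holomorphic_intros) (auto simp: norm_ee_less_1)
    then show "g holomorphic_on upper_half_plane" by (rule holomorphic_transform) (simp add: g_def)
    show "g (moebius_act A \<tau>) = cocycle A \<tau> powi (2 * u) * g \<tau>" if A: "A \<in> SL2Z" and \<tau>: "\<tau> \<in> upper_half_plane" for A \<tau>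
    proof -
      obtain w where w: "(A, w) \<in> Mp2Z" using Mp2Z_exists [OF A] by blast
      have "w \<tau> powi p = (w \<tau> powi 2) powi (2 * u)" unfolding u by (simp only: power_int_mult [symmetric]) simp
      also have "w \<tau> powi 2 = cocycle A \<tau>" using Mp2ZD(3) [OF w \<tau>] by simp
      finally show ?thesis using trans [OF w \<tau>] by simp
    qed
    obtain b :: "nat \<Rightarrow> complex" where b: "\<forall>\<tau>\<in>upper_half_plane.
      ((\<lambda>m. b m * ee \<tau> ^ m) has_sum G (ee \<tau>)) UNIV \<and> summable (\<lambda>m. norm (b m * ee \<tau> ^ m))"
      using holomorphic_in_q_expansion [OF G] by (rule exE)
    have "(\<lambda>m. b m * ee (of_nat m * \<tau>)) sums g \<tau>" if "\<tau> \<in> upper_half_plane" for \<tau>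
      using has_sum_imp_sums [OF conjunct1 [OF bspec [OF b that]]] that by (simp add: g_def ee_power)
    then show "\<exists>b :: nat \<Rightarrow> complex. \<forall>\<tau>\<in>upper_half_plane. (\<lambda>m. b m * ee (of_nat m * \<tau>)) sums g \<tau>" by blast
  qed
  moreover have "\<phi> = (\<lambda>p. eta (fst p) ^ a * g (fst p) * theta_fn p)"
  proof (rule ext)
    fix q :: "complex \<times> (complex^'n)"
    obtain \<tau> z where q: "q = (\<tau>, z)" by fastforce
    show "\<phi> q = eta (fst q) ^ a * g (fst q) * theta_fn q"
    proof (cases "\<tau> \<in> upper_half_plane")
      case True
      then show ?thesis by (simp add: q \<phi>g theta_fn_def)
    next
      case False
      then have "\<phi> (\<tau>, z) = 0" using \<phi> unfolding jacobi_forms_def by blast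
      then show ?thesis using False by (simp add: q theta_fn_def)
    qed
  qed
  moreover have "\<lfloor>2 * k\<rfloor> = int CARD('n) + int a + 2 * (2 * u)" using u by (simp add: p_def)
  ultimately show ?thesis unfolding a_def by (intro exI [of _ g] exI [of _ "2 * u"]) simp
qed

lemma holomorphic_multiple_of_theta:
  assumes "f holomorphic_on upper_half_plane"
  shows "holomorphic_jacobi (\<lambda>p. f (fst p) * theta_fn p)"
  unfolding holomorphic_jacobi_def
proof
  fix p :: "complex \<times> (complex^'n)" assume "p \<in> upper_half_plane \<times> UNIV"
  then obtain \<tau> z where p: "p = (\<tau>, z)" and \<tau>: "\<tau> \<in> upper_half_plane" by auto
  obtain D where D: "((\<lambda>p. th (fst p) (snd p)) has_derivative D) (at (\<tau>, z))"
    and lin: "\<forall>c v. D (c * fst v, c *s snd v) = c * D v"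
    using th_complex_linear_derivative [OF \<tau>] by blast
  have "(f has_derivative (*) (deriv f \<tau>)) (at (fst (\<tau>, z)))"
    using holomorphic_derivI [OF assms open_upper_half_plane \<tau>] by (simp add: has_field_derivative_imp_has_derivative)
  from has_derivative_compose [OF has_derivative_fst [OF has_derivative_ident] this]
  have f: "((\<lambda>p :: complex \<times> (complex^'n). f (fst p)) has_derivative (\<lambda>v. deriv f \<tau> * fst v)) (at (\<tau>, z))" .
  define E where "E v = f \<tau> * D v + (deriv f \<tau> * fst v) * th \<tau> z" for v :: "complex \<times> (complex^'n)"
  have "((\<lambda>p. f (fst p) * th (fst p) (snd p)) has_derivative E) (at (\<tau>, z))"
    using has_derivative_mult [OF f D] unfolding E_def by simp
  then have "((\<lambda>p. f (fst p) * theta_fn p) has_derivative E) (at (\<tau>, z))"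
    by (rule has_derivative_transform_within_open [OF _ open_Times [OF open_upper_half_plane open_UNIV]])
       (use \<tau> in \<open>auto simp: theta_fn_def\<close>)
  moreover have "E (c * fst v, c *s snd v) = c * E v" for c v
    using lin by (simp add: E_def algebra_simps)
  ultimately show "\<exists>D. ((\<lambda>p. f (fst p) * theta_fn p) has_derivative D) (at p) \<and> (\<forall>c v. D (c * fst v, c *s snd v) = c * D v)"
    unfolding p by blast
qed

text \<open>
  Weights and characters of \<open>\<eta>\<^sup>a\<close>, \<open>g\<close> and \<open>\<theta>\<close> add up; the elliptic law and the Fourier expansion are
  those of \<open>\<theta>\<close>, multiplied by a function of \<open>\<tau>\<close>.
\<close>
lemma multiple_of_theta_jacobi_form:
  assumes g: "g \<in> modular_forms \<kappa>"
    and K: "\<lfloor>2 * k\<rfloor> = int CARD('n) + int (eta_exponent h) + 2 * \<kappa>"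
  shows "(\<lambda>p. eta (fst p) ^ eta_exponent h * g (fst p) * theta_fn p) \<in> jacobi_forms \<beta> k h"
proof -
  define a where "a = eta_exponent h"
  obtain t where t: "int a = h - 3 * int CARD('n) + 24 * t" using eta_exponent_cong unfolding a_def by blast
  define f where "f \<tau> = eta \<tau> ^ a * g \<tau>" for \<tau>
  have g_hol: "g holomorphic_on upper_half_plane"
    and g_trans: "\<And>A \<tau>. A \<in> SL2Z \<Longrightarrow> \<tau> \<in> upper_half_plane \<Longrightarrow> g (moebius_act A \<tau>) = cocycle A \<tau> powi \<kappa> * g \<tau>"
    using g unfolding modular_forms_def by blast+
  have f_hol: "f holomorphic_on upper_half_plane"
    unfolding f_def by (intro holomorphic_intros eta_holomorphic g_hol)
  define \<phi> where "\<phi> = (\<lambda>p. f (fst p) * theta_fn p)"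
  have \<phi>: "\<phi> (\<tau>, z) = f \<tau> * th \<tau> z" if "\<tau> \<in> upper_half_plane" for \<tau> z
    using that by (simp add: \<phi>_def theta_fn_def)
  have "\<phi> \<in> jacobi_forms \<beta> k h"
    unfolding jacobi_forms_def mem_Collect_eq
  proof (intro conjI)
    show "\<forall>\<tau> z. \<tau> \<notin> upper_half_plane \<longrightarrow> \<phi> (\<tau>, z) = 0" by (simp add: \<phi>_def theta_fn_def)
    show "holomorphic_jacobi \<phi>" unfolding \<phi>_def by (rule holomorphic_multiple_of_theta [OF f_hol])
    show "\<forall>(A, w)\<in>Mp2Z. \<forall>\<tau>\<in>upper_half_plane. \<forall>z.
        \<phi> (moebius_act A \<tau>, inverse (cocycle A \<tau>) *s z)
          * ee (- of_int (A $ 2 $ 1) * quad \<beta> z / cocycle A \<tau>) * w \<tau> powi (- \<lfloor>2 * k\<rfloor>)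
        = eps (A, w) powi h * \<phi> (\<tau>, z)"
    proof (intro ballI, unfold split_paired_all case_prod_conv, intro ballI allI)
      fix A w \<tau> z assume \<alpha>: "(A, w) \<in> Mp2Z" and \<tau>: "\<tau> \<in> upper_half_plane"
      note A = Mp2ZD [OF \<alpha>]
      let ?e = "eps (A, w)" and ?J = "ee (- of_int (A $ 2 $ 1) * quad \<beta> z / cocycle A \<tau>)"
      have e: "?e powi (h - int (3 * CARD('n))) = ?e ^ a"
        by (rule powi_mod_24 [OF eta_transform(2) [OF \<alpha> \<tau>], of _ _ t]) (simp add: t)
      have w: "w \<tau> powi (\<lfloor>2 * k\<rfloor> - int CARD('n)) = w \<tau> ^ a * cocycle A \<tau> powi \<kappa>"
      proof -
        have "\<lfloor>2 * k\<rfloor> - int CARD('n) = int a + 2 * \<kappa>" by (simp add: K a_def)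
        then have "w \<tau> powi (\<lfloor>2 * k\<rfloor> - int CARD('n)) = w \<tau> ^ a * (w \<tau> powi 2) powi \<kappa>"
          using A(4) [OF \<tau>] by (simp add: power_int_add power_int_mult)
        also have "w \<tau> powi 2 = cocycle A \<tau>" using A(3) [OF \<tau>] by simp
        finally show ?thesis .
      qed
      have "f (moebius_act A \<tau>) = (?e * w \<tau> * eta \<tau>) ^ a * (cocycle A \<tau> powi \<kappa> * g \<tau>)"
        by (simp only: f_def eta_transform(1) [OF \<alpha> \<tau>] g_trans [OF A(1) \<tau>])
      also have "\<dots> = ?e powi (h - int (3 * CARD('n))) * w \<tau> powi (\<lfloor>2 * k\<rfloor> - int CARD('n)) * f \<tau>"
        unfolding e w f_def power_mult_distrib by (simp only: mult_ac)
      finally have X: "f (moebius_act A \<tau>) * (?e ^ (3 * CARD('n)) * w \<tau> ^ CARD('n)) * w \<tau> powi (- \<lfloor>2 * k\<rfloor>) = ?e powi h * f \<tau>"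
        using powi_transform_iff [OF eps_nonzero(1) [OF \<alpha>] A(4) [OF \<tau>]] by blast
      have "\<phi> (moebius_act A \<tau>, inverse (cocycle A \<tau>) *s z) * ?J * w \<tau> powi (- \<lfloor>2 * k\<rfloor>)
         = f (moebius_act A \<tau>) * (th (moebius_act A \<tau>) (inverse (cocycle A \<tau>) *s z) * ?J) * w \<tau> powi (- \<lfloor>2 * k\<rfloor>)"
        by (simp only: \<phi> [OF moebius_uhp [OF A(1) \<tau>]] mult.assoc)
      also have "\<dots> = (f (moebius_act A \<tau>) * (?e ^ (3 * CARD('n)) * w \<tau> ^ CARD('n)) * w \<tau> powi (- \<lfloor>2 * k\<rfloor>)) * th \<tau> z"
        unfolding theta_transform [OF \<alpha> \<tau>] by (simp only: mult_ac)
      also have "\<dots> = ?e powi h * \<phi> (\<tau>, z)" unfolding X by (simp only: \<phi> [OF \<tau>] mult.assoc)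
      finally show "\<phi> (moebius_act A \<tau>, inverse (cocycle A \<tau>) *s z) * ?J * w \<tau> powi (- \<lfloor>2 * k\<rfloor>) = ?e powi h * \<phi> (\<tau>, z)" .
    qed
    show "\<forall>x y. \<forall>\<tau>\<in>upper_half_plane. \<forall>z.
        \<phi> (\<tau>, z + \<tau> *s vec_of_int x + vec_of_int y)
          * ee (\<tau> * quad \<beta> (vec_of_int x) + bil \<beta> (vec_of_int x) z)
        = ee (quad \<beta> (vec_of_int (x + y))) * \<phi> (\<tau>, z)"
    proof (intro allI ballI)
      fix x y \<tau> z assume \<tau>: "\<tau> \<in> upper_half_plane"
      show "\<phi> (\<tau>, z + \<tau> *s vec_of_int x + vec_of_int y) * ee (\<tau> * quad \<beta> (vec_of_int x) + bil \<beta> (vec_of_int x) z)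
        = ee (quad \<beta> (vec_of_int (x + y))) * \<phi> (\<tau>, z)"
        using th_elliptic [OF \<tau>, of z x y] by (simp only: \<phi> [OF \<tau>] mult.assoc mult.left_commute)
    qed
    from modular_forms_holomorphic_in_q [OF g] obtain G where
      G: "G holomorphic_on ball 0 1" "\<And>\<tau>. \<tau> \<in> upper_half_plane \<Longrightarrow> g \<tau> = G (ee \<tau>)" by blast
    have F: "(\<lambda>q. euler_prod q ^ a * G q) holomorphic_on ball 0 1"
      by (intro holomorphic_intros G(1) euler_prod_holomorphic)
    from theta_multiple_expansion [where h = h, OF F, folded a_def] obtain c where c: "\<And>\<tau> z. \<tau> \<in> upper_half_plane \<Longrightarrow>
      ((\<lambda>(m, r). c (m, r) * ee (of_rat m * \<tau>) * ee (bil \<beta> z (vec_of_rat r)))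
       has_sum ee (of_nat a * \<tau> / 24) * (euler_prod (ee \<tau>) ^ a * G (ee \<tau>)) * th \<tau> z) (expansion_index h)"
      by blast
    have "\<phi> (\<tau>, z) = ee (of_nat a * \<tau> / 24) * (euler_prod (ee \<tau>) ^ a * G (ee \<tau>)) * th \<tau> z" if "\<tau> \<in> upper_half_plane" for \<tau> z
      by (simp only: \<phi> [OF that] f_def eta_power_eq [OF that] G(2) [OF that] mult.assoc)
    then show "\<exists>c :: rat \<times> (rat^'n) \<Rightarrow> complex. \<forall>\<tau>\<in>upper_half_plane. \<forall>z.
        ((\<lambda>(m, r). c (m, r) * ee (of_rat m * \<tau>) * ee (bil \<beta> z (vec_of_rat r))) has_sum \<phi> (\<tau>, z))
        {(m, r). m - of_int h / 24 \<in> \<int> \<and> r \<in> shadow \<beta> \<and> quad \<beta> r \<le> m}"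
      using c unfolding expansion_index_def [symmetric] by (intro exI [of _ c] ballI allI) (simp only:)
  qed
  then show ?thesis by (simp only: \<phi>_def f_def a_def)
qed

lemma eta_exponent_3n: "eta_exponent (3 * int CARD('n)) = 0"
  by (simp add: eta_exponent_def)

text \<open>
  In weight \<open>n/2\<close> the automorphy factor of \<open>\<phi>/\<theta>\<close> is a root of unity, so its absolute value is an
  invariant function.
\<close>
lemma singular_weight_unique:
  assumes \<phi>: "\<phi> \<in> jacobi_forms \<beta> (of_nat CARD('n) / 2) h"
  shows "\<exists>c. \<phi> = (\<lambda>p. c * theta_fn p)"
proof -
  define a where "a = eta_exponent h"
  from jacobi_form_multiple_of_theta [OF \<phi>, folded a_def] obtain F where F: "F holomorphic_on ball 0 1"
    and \<phi>F: "\<And>\<tau> z. \<tau> \<in> upper_half_plane \<Longrightarrow> \<phi> (\<tau>, z) = ee (of_nat a * \<tau> / 24) * F (ee \<tau>) * th \<tau> z"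
    by blast
  define f where "f \<tau> = ee (of_nat a * \<tau> / 24) * F (ee \<tau>)" for \<tau>
  have \<phi>f: "\<phi> (\<tau>, z) = f \<tau> * th \<tau> z" if "\<tau> \<in> upper_half_plane" for \<tau> z
    by (simp only: \<phi>F [OF that] f_def)
  have inv: "norm (f (moebius_act A \<tau>)) = norm (f \<tau>)" if A: "A \<in> SL2Z" and \<tau>: "\<tau> \<in> upper_half_plane" for A \<tau>
  proof -
    obtain w where w: "(A, w) \<in> Mp2Z" using Mp2Z_exists [OF A] by blast
    have "\<lfloor>2 * (of_nat CARD('n) / 2 :: rat)\<rfloor> - int CARD('n) = 0" by simp
    with multiple_transform [OF \<phi> \<phi>f w \<tau>]
    have "f (moebius_act A \<tau>) = eps (A, w) powi (h - int (3 * CARD('n))) * w \<tau> powi 0 * f \<tau>" by (simp only:)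
    then show ?thesis by (simp add: norm_mult norm_power_int eps_nonzero(2) [OF w])
  qed
  obtain c where c: "\<And>\<tau>. \<tau> \<in> upper_half_plane \<Longrightarrow> f \<tau> = c"
    using weight_zero_constant [OF F f_def inv] by blast
  have "\<phi> p = c * theta_fn p" for p
  proof -
    obtain \<tau> z where p: "p = (\<tau>, z)" by fastforce
    show ?thesis
    proof (cases "\<tau> \<in> upper_half_plane")
      case True
      then show ?thesis by (simp add: p \<phi>f c theta_fn_def)
    next
      case False
      then have "\<phi> (\<tau>, z) = 0" using \<phi> unfolding jacobi_forms_def by blast
      then show ?thesis using False by (simp add: p theta_fn_def)
    qed
  qed
  then show ?thesis by blast
qed

text \<open>
  From \<open>2k = n + a + 2\<kappa>\<close> and \<open>a \<equiv> h - 3n mod 24\<close> follows \<open>k - h/2 \<equiv> \<kappa> - n mod 12\<close>, where \<open>\<kappa>\<close> is even.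
\<close>
lemma parity_of_jacobi_form:
  assumes \<phi>: "\<phi> \<in> jacobi_forms \<beta> k h" and nz: "\<phi> \<noteq> 0" and j: "k - of_int h / 2 = of_int j"
  shows "even j \<longleftrightarrow> even (int CARD('n))"
proof -
  obtain \<kappa> where \<kappa>: "even \<kappa>" "\<lfloor>2 * k\<rfloor> = int CARD('n) + int (eta_exponent h) + 2 * \<kappa>"
    using jacobi_form_decomposition [OF \<phi> nz] by blast
  obtain t where t: "int (eta_exponent h) = h - 3 * int CARD('n) + 24 * t" using eta_exponent_cong by blast
  have "2 * k = of_int (2 * j + h)" using j by (simp add: field_simps)
  then have "\<lfloor>2 * k\<rfloor> = 2 * j + h" by (simp only: floor_of_int)
  then have "j = \<kappa> - int CARD('n) + 12 * t" using \<kappa>(2) t by linarith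
  then show ?thesis using \<kappa>(1) by simp
qed

lemma parity_star_wrong_parity:
  assumes P: "P = even \<or> P = odd" and nP: "\<not> P (int CARD('n))"
  shows "jacobi_forms_parity_star P \<beta> = {0}"
proof -
  have "\<phi> = 0" if "\<phi> \<in> jacobi_forms \<beta> k h" "P j" "k - of_int h / 2 = of_int j" for \<phi> k h j
  proof (rule ccontr)
    assume "\<phi> \<noteq> 0"
    then have "even j \<longleftrightarrow> even (int CARD('n))" by (rule parity_of_jacobi_form [OF that(1) _ that(3)])
    then show False using that(2) P nP by blast
  qed
  then have "(\<Union>k\<in>{k. \<exists>j. P j \<and> k - of_int h / 2 = of_int j}. jacobi_forms \<beta> k h) \<subseteq> {0}" for h by auto
  then have "jacobi_forms_parity P \<beta> h \<subseteq> {0}" for h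
    unfolding jacobi_forms_parity_def by (rule fun_space.span_minimal [OF _ fun_space.subspace_single_0])
  then have "(\<Union>h\<in>{0..23}. jacobi_forms_parity P \<beta> h) \<subseteq> {0}" by blast
  then have "jacobi_forms_parity_star P \<beta> \<subseteq> {0}"
    unfolding jacobi_forms_parity_star_def by (rule fun_space.span_minimal [OF _ fun_space.subspace_single_0])
  moreover have "0 \<in> jacobi_forms_parity_star P \<beta>"
    unfolding jacobi_forms_parity_star_def by (rule fun_space.span_zero)
  ultimately show ?thesis by blast
qed

lemma parity_star_subset:
  "jacobi_forms_parity_star P \<beta> \<subseteq> {\<lambda>p. f (fst p) * theta_fn p | f. f \<in> modular_forms_eps_star}"
    (is "_ \<subseteq> ?R")
proof -
  have R: "fun_space.subspace ?R"
    by (rule subspace_multiples) (simp add: modular_forms_eps_star_def fun_space.subspace_span)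
  have "\<phi> \<in> ?R" if \<phi>: "\<phi> \<in> jacobi_forms \<beta> k h" for \<phi> k h
  proof (cases "\<phi> = 0")
    case True
    then show ?thesis using fun_space.subspace_0 [OF R] by (simp only:)
  next
    case False
    obtain g \<kappa> where g: "even \<kappa>" "g \<in> modular_forms \<kappa>"
      "\<phi> = (\<lambda>p. eta (fst p) ^ eta_exponent h * g (fst p) * theta_fn p)"
      using jacobi_form_decomposition [OF \<phi> False] by blast
    have "g \<in> modular_forms_star"
      unfolding modular_forms_star_def by (rule fun_space.span_base) (use g in blast)
    moreover have "eta_exponent h \<in> {0..23}" using eta_exponent_less [of h] by simp
    ultimately have "(\<lambda>\<tau>. eta \<tau> ^ eta_exponent h * g \<tau>) \<in> modular_forms_eps_star"
      unfolding modular_forms_eps_star_def by (intro fun_space.span_base) blast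
    then show ?thesis
      unfolding g(3) by (intro CollectI exI [of _ "\<lambda>\<tau>. eta \<tau> ^ eta_exponent h * g \<tau>"] conjI refl)
  qed
  then have "(\<Union>k\<in>{k. \<exists>j. P j \<and> k - of_int h / 2 = of_int j}. jacobi_forms \<beta> k h) \<subseteq> ?R" for h by blast
  then have "jacobi_forms_parity P \<beta> h \<subseteq> ?R" for h
    unfolding jacobi_forms_parity_def by (rule fun_space.span_minimal [OF _ R])
  then have "(\<Union>h\<in>{0..23}. jacobi_forms_parity P \<beta> h) \<subseteq> ?R" by blast
  then show ?thesis
    unfolding jacobi_forms_parity_star_def by (rule fun_space.span_minimal [OF _ R])
qed

text \<open>
  A product \<open>\<eta>\<^sup>a g \<theta>\<close> is a Jacobi form for the exponent \<open>h \<equiv> 3n + a mod 24\<close> in the range from 0 to 23, of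
  the weight read off from \<open>2k = n + a + 2\<kappa>\<close>. Linearity extends this to the spans.
\<close>
lemma subset_parity_star:
  assumes P: "P = even \<or> P = odd" and nP: "P (int CARD('n))" and f: "f \<in> modular_forms_eps_star"
  shows "(\<lambda>p. f (fst p) * theta_fn p) \<in> jacobi_forms_parity_star P \<beta>"
proof -
  let ?S = "jacobi_forms_parity_star P \<beta>"
  have S: "fun_space.subspace ?S" unfolding jacobi_forms_parity_star_def by (rule fun_space.subspace_span)
  have base: "(\<lambda>p. g (fst p) * (eta (fst p) ^ a * theta_fn p)) \<in> ?S"
    if "g \<in> modular_forms \<kappa>" "even \<kappa>" "a \<in> {0..23}" for g \<kappa> a
  proof -
    define h where "h = (3 * int CARD('n) + int a) mod 24"
    define t where "t = (3 * int CARD('n) + int a) div 24"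
    have h: "h = 3 * int CARD('n) + int a - 24 * t" unfolding h_def t_def by (simp add: minus_mult_div_eq_mod)
    have a: "eta_exponent h = a"
    proof -
      have "(h - 3 * int CARD('n)) mod 24 = (int a + 24 * (- t)) mod 24" by (simp add: h)
      also have "\<dots> = int a" using that(3) by (simp only: mod_mult_self2) simp
      finally show ?thesis by (simp add: eta_exponent_def)
    qed
    define k :: rat where "k = of_int (int CARD('n) + int a + 2 * \<kappa>) / 2"
    have "2 * k = of_int (int CARD('n) + int a + 2 * \<kappa>)" by (simp add: k_def)
    then have K: "\<lfloor>2 * k\<rfloor> = int CARD('n) + int (eta_exponent h) + 2 * \<kappa>" unfolding a by (simp only: floor_of_int)
    have kj: "k - of_int h / 2 = of_int (\<kappa> - int CARD('n) + 12 * t)" by (simp add: k_def h field_simps)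
    have "P (\<kappa> - int CARD('n) + 12 * t)" using P nP that(2) by auto
    with kj have "k \<in> {k. \<exists>j. P j \<and> k - of_int h / 2 = of_int j}" by blast
    moreover have "(\<lambda>p. eta (fst p) ^ eta_exponent h * g (fst p) * theta_fn p) \<in> jacobi_forms \<beta> k h"
      by (rule multiple_of_theta_jacobi_form [OF that(1) K])
    ultimately have "(\<lambda>p. eta (fst p) ^ a * g (fst p) * theta_fn p) \<in> jacobi_forms_parity P \<beta> h"
      unfolding jacobi_forms_parity_def a by (intro fun_space.span_base) blast
    moreover have "h \<in> {0..23}" by (simp add: h_def)
    ultimately have "(\<lambda>p. eta (fst p) ^ a * g (fst p) * theta_fn p) \<in> ?S"
      unfolding jacobi_forms_parity_star_def by (intro fun_space.span_base) blast
    moreover have "(\<lambda>p. eta (fst p) ^ a * g (fst p) * theta_fn p) = (\<lambda>p. g (fst p) * (eta (fst p) ^ a * theta_fn p))"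
      by (simp only: mult_ac)
    ultimately show ?thesis by (simp only:)
  qed
  have star: "(\<lambda>p. g (fst p) * (eta (fst p) ^ a * theta_fn p)) \<in> ?S" if "g \<in> modular_forms_star" "a \<in> {0..23}" for g a
  proof -
    have "modular_forms_star \<subseteq> {g. (\<lambda>p. g (fst p) * (eta (fst p) ^ a * theta_fn p)) \<in> ?S}"
      unfolding modular_forms_star_def
      by (rule fun_space.span_minimal [OF _ subspace_multiplier [OF S]]) (use base [OF _ _ that(2)] in blast)
    then show ?thesis using that(1) by blast
  qed
  have "modular_forms_eps_star \<subseteq> {f. (\<lambda>p. f (fst p) * theta_fn p) \<in> ?S}"
    unfolding modular_forms_eps_star_def
  proof (rule fun_space.span_minimal [OF _ subspace_multiplier [OF S]], rule subsetI)
    fix f assume "f \<in> (\<Union>h\<in>{0..23::nat}. (\<lambda>f \<tau>. eta \<tau> ^ h * f \<tau>) ` modular_forms_star)"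
    then obtain a g where ag: "a \<in> {0..23}" "g \<in> modular_forms_star" "f = (\<lambda>\<tau>. eta \<tau> ^ a * g \<tau>)" by blast
    have "(\<lambda>p. f (fst p) * theta_fn p) = (\<lambda>p. g (fst p) * (eta (fst p) ^ a * theta_fn p))"
      unfolding ag(3) by (simp only: mult_ac)
    then show "f \<in> {f. (\<lambda>p. f (fst p) * theta_fn p) \<in> ?S}" using star [OF ag(2,1)] by simp
  qed
  then show ?thesis using f by blast
qed

lemma parity_star_right_parity:
  assumes P: "P = even \<or> P = odd" and nP: "P (int CARD('n))" and l: "l \<in> W_space \<beta>" "l r0 \<noteq> 0"
  shows "jacobi_forms_parity_star P \<beta> = {\<lambda>(\<tau>, z). f \<tau> * theta \<beta> l (\<tau>, z) | f. f \<in> modular_forms_eps_star}"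
proof -
  have M: "fun_space.subspace modular_forms_eps_star" by (simp add: modular_forms_eps_star_def fun_space.subspace_span)
  have eq: "(\<lambda>(\<tau>, z). f \<tau> * theta \<beta> l (\<tau>, z)) = (\<lambda>p. (\<lambda>\<tau>. l r0 * f \<tau>) (fst p) * theta_fn p)" for f
    unfolding theta_eq_theta_fn [OF l(1)] by (auto simp: fun_eq_iff)
  show ?thesis
  proof (intro equalityI subsetI)
    fix \<phi> assume "\<phi> \<in> jacobi_forms_parity_star P \<beta>"
    then obtain f where f: "f \<in> modular_forms_eps_star" "\<phi> = (\<lambda>p. f (fst p) * theta_fn p)"
      using parity_star_subset by blast
    have "\<phi> = (\<lambda>(\<tau>, z). (\<lambda>\<tau>. inverse (l r0) * f \<tau>) \<tau> * theta \<beta> l (\<tau>, z))"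
      unfolding eq f(2) using l(2) by (simp add: fun_eq_iff)
    moreover have "(\<lambda>\<tau>. inverse (l r0) * f \<tau>) \<in> modular_forms_eps_star" by (rule fun_space.subspace_scale [OF M f(1)])
    ultimately show "\<phi> \<in> {\<lambda>(\<tau>, z). f \<tau> * theta \<beta> l (\<tau>, z) | f. f \<in> modular_forms_eps_star}"
      by (intro CollectI exI [of _ "\<lambda>\<tau>. inverse (l r0) * f \<tau>"] conjI)
  next
    fix \<phi> assume "\<phi> \<in> {\<lambda>(\<tau>, z). f \<tau> * theta \<beta> l (\<tau>, z) | f. f \<in> modular_forms_eps_star}"
    then obtain f where f: "f \<in> modular_forms_eps_star" "\<phi> = (\<lambda>p. (\<lambda>\<tau>. l r0 * f \<tau>) (fst p) * theta_fn p)"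
      unfolding eq by blast
    show "\<phi> \<in> jacobi_forms_parity_star P \<beta>"
      unfolding f(2) by (rule subset_parity_star [OF P nP]) (rule fun_space.subspace_scale [OF M f(1)])
  qed
qed

lemma theta_jacobi_form:
  assumes l: "l \<in> W_space \<beta>"
  shows "theta \<beta> l \<in> jacobi_forms \<beta> (of_nat CARD('n) / 2) (3 * int CARD('n))"
proof -
  have "(\<lambda>\<tau>. l r0 * (if \<tau> \<in> upper_half_plane then 1 else 0)) \<in> modular_forms 0"
    by (rule constant_modular_form)
  from multiple_of_theta_jacobi_form [OF this, of "of_nat CARD('n) / 2" "3 * int CARD('n)"]
  have "(\<lambda>p. (l r0 * (if fst p \<in> upper_half_plane then 1 else 0)) * theta_fn p) \<in> jacobi_forms \<beta> (of_nat CARD('n) / 2) (3 * int CARD('n))"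
    by (simp only: eta_exponent_3n) simp
  moreover have "(\<lambda>p. (l r0 * (if fst p \<in> upper_half_plane then 1 else 0)) * theta_fn p) = theta \<beta> l"
    unfolding theta_eq_theta_fn [OF l] by (auto simp: fun_eq_iff theta_fn_def)
  ultimately show ?thesis by simp
qed

lemma theta_nonzero:
  assumes l: "l \<in> W_space \<beta>" "l r0 \<noteq> 0"
  shows "theta \<beta> l \<noteq> 0"
proof
  assume "theta \<beta> l = 0"
  moreover have i: "\<i> \<in> upper_half_plane" by (simp add: upper_half_plane_def)
  moreover obtain z where "th \<i> z \<noteq> 0" by (rule th_not_identically_zero [OF i])
  ultimately show False using theta_eq_th [OF l(1) i, of z] l(2) by simp
qed

end

theorem theorem5p1:
  fixes \<beta> :: "int^'n \<Rightarrow> int^'n \<Rightarrow> int"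
  assumes "integral_lattice \<beta>" and "positive_definite \<beta>" and "unimodular \<beta>"
  shows "fun_space.dim (W_space \<beta>) = 1 \<and>
    (\<forall>l\<in>W_space \<beta>. l \<noteq> 0 \<longrightarrow>
       (\<forall>P\<in>{even, odd}.
          jacobi_forms_parity_star P \<beta> =
            (if P (int CARD('n))
             then {\<lambda>(\<tau>, z). f \<tau> * theta \<beta> l (\<tau>, z) | f. f \<in> modular_forms_eps_star}
             else {0})) \<and>
       theta \<beta> l \<noteq> 0 \<and>
       theta \<beta> l \<in> jacobi_forms \<beta> (of_nat CARD('n) / 2) (3 * int CARD('n)) \<and>
       (\<forall>h. \<forall>\<phi>\<in>jacobi_forms \<beta> (of_nat CARD('n) / 2) h.
          \<exists>c. \<phi> = (\<lambda>p. c * theta \<beta> l p)))"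
proof -
  interpret unimodular_lattice \<beta> by (rule unimodular_lattice.intro [OF assms])
  show ?thesis
  proof (intro conjI ballI impI allI)
    show "fun_space.dim (W_space \<beta>) = 1" by (rule dim_W_space)
  next
    fix l :: "rat^'n \<Rightarrow> complex" assume l: "l \<in> W_space \<beta>" and "l \<noteq> 0"
    have r0: "l r0 \<noteq> 0"
    proof
      assume "l r0 = 0"
      then have "l = 0" using W_spaceD [OF l] by (simp add: fun_eq_iff)
      then show False using \<open>l \<noteq> 0\<close> by blast
    qed
    show "theta \<beta> l \<noteq> 0" by (rule theta_nonzero [OF l r0])
    show "theta \<beta> l \<in> jacobi_forms \<beta> (of_nat CARD('n) / 2) (3 * int CARD('n))" by (rule theta_jacobi_form [OF l])
    show "\<exists>c. \<phi> = (\<lambda>p. c * theta \<beta> l p)" if \<phi>: "\<phi> \<in> jacobi_forms \<beta> (of_nat CARD('n) / 2) h" for h \<phi>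
    proof -
      obtain c where "\<phi> = (\<lambda>p. c * theta_fn p)" using singular_weight_unique [OF \<phi>] by blast
      then have "\<phi> = (\<lambda>p. (c / l r0) * theta \<beta> l p)" using r0 by (simp add: theta_eq_theta_fn [OF l])
      then show ?thesis by blast
    qed
    fix P :: "int \<Rightarrow> bool" assume "P \<in> {even, odd}"
    then have P: "P = even \<or> P = odd" by blast
    show "jacobi_forms_parity_star P \<beta> = (if P (int CARD('n))
             then {\<lambda>(\<tau>, z). f \<tau> * theta \<beta> l (\<tau>, z) | f. f \<in> modular_forms_eps_star} else {0})"
      using parity_star_right_parity [OF P _ l r0] parity_star_wrong_parity [OF P] by simp
  qed
qed

end
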